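(* Let $(\mathcal{X},\mathcal{B},\mu)$ be a measure space with $\mu$ a positive $\sigma$-finite measure, let $\mathcal{B}_f=\{\alpha\in\mathcal{B}:\mu(\alpha)<\infty\}$, let $(M,\tau)$ be a tracial $W^*$-probability space and let $\Pi:\mathcal{B}_f\to M_h$ be a free Poisson process over $(\mathcal{X},\mathcal{B},\mu)$. For $\alpha\in\mathcal{B}_f$ let $Y(\alpha)\in\mathrm{Proj}(M)$ be the range projection of $\Pi(\alpha)$ (the projection onto the closure of the range of $\Pi(\alpha)$), and for $\omega\in\mathcal{B}$ with $\mu(\omega)=\infty$ let $Y(\omega)=\bigvee\{Y(\alpha):\alpha\in\mathcal{B}_f,\ \alpha\subset\omega\}$. Then $Y$ is the free projection-valued upper extremal process over $(\mathcal{X},\mathcal{B},\mu)$. Moreover, if $\mu$ has no atoms, then the von Neumann algebra generated by $\{\Pi(\alpha):\alpha\in\mathcal{B}_f\}$ and the von Neumann algebra generated by $\{Y(\alpha):\alpha\in\mathcal{B}_f\}$ are equal.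
   Context: A tracial $W^*$-probability space $(M,\tau)$ is a von Neumann algebra $M$ (acting on a Hilbert space) with an ultraweakly continuous faithful tracial state $\tau$; $M_h$ is the set of self-adjoint elements and $\mathrm{Proj}(M)$ the set of self-adjoint projections; $\bigvee$ denotes the supremum in the lattice $\mathrm{Proj}(M)$ (projection onto the closed span of the ranges). Free independence is in the sense of Voiculescu with respect to $\tau$. Free Poisson process over $(\mathcal{X},\mathcal{B},\mu)$: a map $\Pi:\mathcal{B}_f\to M_h$ such that (a) for each $\alpha\in\mathcal{B}_f$, $\Pi(\alpha)$ has with respect to $\tau$ the free Poisson distribution with parameters $a=\mu(\alpha)$ and $1$, i.e. the measure $(1-a)_+\delta_0+\frac{1}{2\pi t}\sqrt{4a-(t-(1+a))^2}\,\mathbf 1_{[(1-\sqrt a)^2,(1+\sqrt a)^2]}(t)\,dt$ (which is $\delta_0$ if $a=0$); (b) for pairwise disjoint $\alpha_1,\alpha_2,\ldots\in\mathcal{B}_f$ with $\sum_k\mu(\alpha_k)<\infty$, one has $\Pi(\bigcup_k\alpha_k)=\sum_k\Pi(\alpha_k)$ and the $\Pi(\alpha_k)$ are freely independent in $(M,\tau)$. Free projection-valued upper extremal process over $(\mathcal{X},\mathcal{B},\mu)$: with $\mathcal{B}/\!\sim$ denoting $\mathcal{B}$ modulo $\mu$-null sets, ordered by inclusion modulo null sets, it is a map $Y:\mathcal{B}/\!\sim\ \to\mathrm{Proj}(M)$ (so $Y(\omega)$ depends on $\omega$ only up to null sets) such that: (1) if $\alpha\in\mathcal{B}/\!\sim$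 is the least upper bound of a nonempty set $\Omega\subset\mathcal{B}/\!\sim$, then $Y(\alpha)=\bigvee\{Y(\omega):\omega\in\Omega\}$; (2) if $(\omega_k)_{k\in K}$ are pairwise disjoint modulo null sets, then $(Y(\omega_k))_{k\in K}$ are freely independent; (3) $\tau(Y(\omega))=\min(\mu(\omega),1)$ for all $\omega$. *)

theory Defs
  imports "HOL-Analysis.Analysis"
begin

section \<open>Complex Hilbert spaces\<close>

class scaleC =
  fixes scaleC :: "complex \<Rightarrow> 'a \<Rightarrow> 'a"  (infixr "*\<^sub>C" 75)

text \<open>
  The complex inner product is linear in its first argument. Its real part is the real inner
  product of the library, so norm, topology and completeness are those of \<open>real_inner\<close> and
  \<open>complete_space\<close>.
\<close>

class complex_hilbert_space = scaleC + real_inner + complete_space +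
  fixes cinner :: "'a \<Rightarrow> 'a \<Rightarrow> complex"
  assumes scaleC_add_right: "a *\<^sub>C (x + y) = a *\<^sub>C x + a *\<^sub>C y"
    and scaleC_add_left: "(a + b) *\<^sub>C x = a *\<^sub>C x + b *\<^sub>C x"
    and scaleC_scaleC: "a *\<^sub>C b *\<^sub>C x = (a * b) *\<^sub>C x"
    and scaleR_scaleC: "r *\<^sub>R x = complex_of_real r *\<^sub>C x"
    and cinner_commute: "cinner x y = cnj (cinner y x)"
    and cinner_add_left: "cinner (x + y) z = cinner x z + cinner y z"
    and cinner_scaleC_left: "cinner (a *\<^sub>C x) y = a * cinner x y"
    and Re_cinner: "Re (cinner x y) = inner x y"

instantiation complex :: complex_hilbert_space
begin
definition scaleC_complex :: "complex \<Rightarrow> complex \<Rightarrow> complex" where "scaleC_complex a x = a * x"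
definition cinner_complex :: "complex \<Rightarrow> complex \<Rightarrow> complex" where "cinner_complex x y = x * cnj y"
instance
  by standard
    (auto simp: scaleC_complex_def cinner_complex_def algebra_simps scaleR_conv_of_real
      inner_complex_def)
end

lemma cinner_add_right:
  "cinner x (y + z) = cinner x y + cinner (x::'a::complex_hilbert_space) z"
  by (subst (1 2 3) cinner_commute) (simp add: cinner_add_left)

lemma cinner_scaleC_right:
  "cinner x (a *\<^sub>C y) = cnj a * cinner (x::'a::complex_hilbert_space) y"
  by (subst (1 2) cinner_commute) (simp add: cinner_scaleC_left)

lemma Im_cinner: "Im (cinner x y) = inner (- \<i> *\<^sub>C x) (y::'a::complex_hilbert_space)"
  by (simp add: Re_cinner [symmetric] cinner_scaleC_left)

lemma cinner_eq_iff_inner: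
  fixes T :: "'a::complex_hilbert_space \<Rightarrow> 'a"
  assumes "\<And>c x. T (c *\<^sub>C x) = c *\<^sub>C T x"
  shows "(\<forall>x. cinner (T x) y = cinner x z) \<longleftrightarrow> (\<forall>x. inner (T x) y = inner x z)"
  by (auto simp: complex_eq_iff Re_cinner Im_cinner simp flip: assms)

lemma scaleC_one: "1 *\<^sub>C x = (x::'a::complex_hilbert_space)"
  using scaleR_scaleC [of 1 x] by simp

lemma scaleC_minus_one: "(-1) *\<^sub>C x = - (x::'a::complex_hilbert_space)"
  using scaleR_scaleC [of "-1" x] by simp

lemma scaleC_zero_left: "0 *\<^sub>C x = (0::'a::complex_hilbert_space)"
  using scaleR_scaleC [of 0 x] by simp

lemma scaleC_zero_right: "c *\<^sub>C 0 = (0::'a::complex_hilbert_space)"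
  using scaleC_add_right [of c 0 "0::'a"] by simp

lemma norm_scaleC: "norm (c *\<^sub>C x) = cmod c * norm (x::'a::complex_hilbert_space)"
proof -
  have "complex_of_real (inner y y) = cinner y y" for y :: 'a
  proof -
    have "Im (cinner y y) = 0"
      using cinner_commute [of y y] by (simp add: complex_eq_iff)
    then show ?thesis
      by (simp add: complex_eq_iff Re_cinner)
  qed
  then have "complex_of_real (inner (c *\<^sub>C x) (c *\<^sub>C x)) =
      c * cnj c * complex_of_real (inner x x)"
    by (simp add: cinner_scaleC_left cinner_scaleC_right)
  also have "\<dots> = complex_of_real ((cmod c)\<^sup>2 * inner x x)"
    by (simp add: complex_norm_square del: of_real_power)
  finally have "inner (c *\<^sub>C x) (c *\<^sub>C x) = (cmod c)\<^sup>2 * inner x x"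
    by (simp only: of_real_eq_iff)
  then show ?thesis
    by (simp add: norm_eq_sqrt_inner real_sqrt_mult)
qed

lemma bounded_linear_scaleC: "bounded_linear (\<lambda>x::'a::complex_hilbert_space. c *\<^sub>C x)"
proof (rule bounded_linear_intro)
  fix x y :: 'a and r :: real
  show "c *\<^sub>C (x + y) = c *\<^sub>C x + c *\<^sub>C y"
    by (rule scaleC_add_right)
  show "c *\<^sub>C (r *\<^sub>R x) = r *\<^sub>R (c *\<^sub>C x)"
    by (simp add: scaleR_scaleC scaleC_scaleC mult.commute)
  show "norm (c *\<^sub>C x) \<le> norm x * cmod c"
    by (simp add: norm_scaleC)
qed

definition csubspace :: "'a::complex_hilbert_space set \<Rightarrow> bool" where
  "csubspace V \<longleftrightarrow> 0 \<in> V \<and> (\<forall>x\<in>V. \<forall>y\<in>V. x + y \<in> V) \<and> (\<forall>c. \<forall>x\<in>V. c *\<^sub>C x \<in> V)"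

lemma csubspace_imp_subspace: "csubspace V \<Longrightarrow> subspace V"
  by (auto simp: csubspace_def subspace_def scaleR_scaleC)

lemma csubspace_hull: "csubspace (csubspace hull S)"
  by (rule hull_in) (auto simp: csubspace_def)

lemma csubspace_closure:
  assumes "csubspace V"
  shows "csubspace (closure V)"
proof -
  have "x + y \<in> closure V" if x: "x \<in> closure V" and y: "y \<in> closure V" for x y
  proof -
    obtain f g where fg: "\<And>n. f n \<in> V" "f \<longlonglongrightarrow> x" "\<And>n. g n \<in> V" "g \<longlonglongrightarrow> y"
      using x y unfolding closure_sequential by blast
    then have "(\<lambda>n. f n + g n) \<longlonglongrightarrow> x + y" "\<And>n. f n + g n \<in> V"
      using assms by (auto intro: tendsto_add simp: csubspace_def)
    then show ?thesis
      unfolding closure_sequential by (intro exI [of _ "\<lambda>n. f n + g n"]) auto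
  qed
  moreover have "c *\<^sub>C x \<in> closure V" if "x \<in> closure V" for c x
  proof -
    have "(\<lambda>x. c *\<^sub>C x) ` closure V \<subseteq> closure ((\<lambda>x. c *\<^sub>C x) ` V)"
      by (rule closure_bounded_linear_image_subset) (rule bounded_linear_scaleC)
    also have "\<dots> \<subseteq> closure V"
      using assms by (intro closure_mono) (auto simp: csubspace_def)
    finally show ?thesis
      using that by blast
  qed
  moreover have "0 \<in> closure V"
    using assms closure_subset by (auto simp: csubspace_def)
  ultimately show ?thesis
    by (simp add: csubspace_def)
qed

lemma orthogonal_projection_exists:
  fixes V :: "'a::{real_inner,complete_space} set"
  assumes V: "subspace V" "closed V"
  shows "\<exists>p\<in>V. \<forall>v\<in>V. inner (x - p) v = 0"
proof -
  define d where "d = infdist x V"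
  have ne: "V \<noteq> {}"
    using V subspace_0 by blast
  have dle: "d \<le> norm (x - v)" if "v \<in> V" for v
    using infdist_le [OF that, of x] by (simp add: d_def dist_norm)
  have d0: "d \<ge> 0"
    by (simp add: d_def infdist_nonneg)
  have "\<exists>v\<in>V. norm (x - v) < d + inverse (real (Suc n))" for n
  proof (rule ccontr)
    assume "\<not> ?thesis"
    then have "d + inverse (real (Suc n)) \<le> infdist x V"
      using ne by (auto simp: infdist_def dist_norm not_less intro!: cINF_greatest)
    then show False
      by (simp add: d_def)
  qed
  then obtain v where v: "\<And>n. v n \<in> V" "\<And>n. norm (x - v n) < d + inverse (real (Suc n))"
    by metis
  have est: "(norm (v m - v n))\<^sup>2 \<le> 2 * ((norm (x - v m))\<^sup>2 - d\<^sup>2) + 2 * ((norm (x - v n))\<^sup>2 - d\<^sup>2)"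
    for m n
  proof -
    have "(1/2) *\<^sub>R (v m + v n) \<in> V"
      using V v by (simp add: subspace_add subspace_scale)
    then have "d\<^sup>2 \<le> (norm (x - (1/2) *\<^sub>R (v m + v n)))\<^sup>2"
      by (intro power_mono dle d0)
    moreover have "(norm (v m - v n))\<^sup>2 + 4 * (norm (x - (1/2) *\<^sub>R (v m + v n)))\<^sup>2 =
        2 * (norm (x - v m))\<^sup>2 + 2 * (norm (x - v n))\<^sup>2"
      by (simp add: power2_norm_eq_inner inner_diff_left inner_diff_right inner_add_left
          inner_add_right inner_commute algebra_simps)
    ultimately show ?thesis
      by (simp add: algebra_simps)
  qed
  have lim: "(\<lambda>n. (norm (x - v n))\<^sup>2 - d\<^sup>2) \<longlonglongrightarrow> 0"
  proof -
    have 1: "(\<lambda>n. d + inverse (real (Suc n))) \<longlonglongrightarrow> d"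
      using tendsto_add [OF tendsto_const LIMSEQ_inverse_real_of_nat, of d] by simp
    have "(\<lambda>n. norm (x - v n)) \<longlonglongrightarrow> d"
      by (rule tendsto_sandwich [OF _ _ tendsto_const 1])
        (auto intro!: always_eventually less_imp_le [OF v(2)] dle v(1) simp del: of_nat_Suc)
    then have "(\<lambda>n. (norm (x - v n))\<^sup>2 - d\<^sup>2) \<longlonglongrightarrow> d\<^sup>2 - d\<^sup>2"
      by (intro tendsto_intros)
    then show ?thesis
      by simp
  qed
  have "Cauchy v"
  proof (rule metric_CauchyI)
    fix e :: real assume e: "e > 0"
    then have "\<forall>\<^sub>F n in sequentially. (norm (x - v n))\<^sup>2 - d\<^sup>2 < e\<^sup>2 / 4"
      by (intro order_tendstoD [OF lim]) auto
    then obtain N where N: "\<And>n. n \<ge> N \<Longrightarrow> (norm (x - v n))\<^sup>2 - d\<^sup>2 < e\<^sup>2 / 4"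
      by (auto simp: eventually_sequentially)
    have "dist (v m) (v n) < e" if "m \<ge> N" "n \<ge> N" for m n
    proof -
      have "(norm (v m - v n))\<^sup>2 < e\<^sup>2"
        using est [of m n] N [OF that(1)] N [OF that(2)] by (simp add: field_simps)
      then show ?thesis
        using e by (simp add: dist_norm power_less_imp_less_base)
    qed
    then show "\<exists>N. \<forall>m\<ge>N. \<forall>n\<ge>N. dist (v m) (v n) < e"
      by blast
  qed
  then obtain p where p: "v \<longlonglongrightarrow> p"
    using Cauchy_convergent_iff convergent_def by blast
  have pV: "p \<in> V"
    using V(2) p v(1) closed_sequentially by blast
  have "(\<lambda>n. (norm (x - v n))\<^sup>2 - d\<^sup>2) \<longlonglongrightarrow> (norm (x - p))\<^sup>2 - d\<^sup>2"
    by (intro tendsto_intros p)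
  with lim have pd: "(norm (x - p))\<^sup>2 = d\<^sup>2"
    using LIMSEQ_unique by fastforce
  have "inner (x - p) u = 0" if u: "u \<in> V" for u
  proof (cases "u = 0")
    case False
    define t where "t = inner (x - p) u / inner u u"
    have "p + t *\<^sub>R u \<in> V"
      using V pV u by (simp add: subspace_add subspace_scale)
    then have "d\<^sup>2 \<le> (norm (x - (p + t *\<^sub>R u)))\<^sup>2"
      by (intro power_mono dle d0)
    also have "x - (p + t *\<^sub>R u) = (x - p) - t *\<^sub>R u"
      by simp
    also have "(norm \<dots>)\<^sup>2 = (norm (x - p))\<^sup>2 - 2 * t * inner (x - p) u + t\<^sup>2 * inner u u"
    proof -
      have "(norm (a - t *\<^sub>R u))\<^sup>2 = (norm a)\<^sup>2 - 2 * t * inner a u + t\<^sup>2 * inner u u" for a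
        unfolding power2_norm_eq_inner
        by (simp add: inner_diff_left inner_diff_right inner_commute power2_eq_square algebra_simps)
      then show ?thesis .
    qed
    also have "\<dots> = d\<^sup>2 - (inner (x - p) u)\<^sup>2 / inner u u"
    proof -
      have *: "s - 2 * (a / b) * a + (a / b)\<^sup>2 * b = s - a\<^sup>2 / b" if "b \<noteq> 0" for s a b :: real
        using that by (simp add: power2_eq_square)
      have "inner u u \<noteq> 0"
        using False by simp
      then show ?thesis
        unfolding pd t_def by (rule *)
    qed
    finally have "(inner (x - p) u)\<^sup>2 / inner u u \<le> 0"
      by simp
    moreover have "inner u u > 0"
      using False by simp
    ultimately have "(inner (x - p) u)\<^sup>2 \<le> 0"
      by (simp add: divide_le_0_iff not_less)
    then show ?thesis
      by simp
  qed simp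
  with pV show ?thesis
    by blast
qed

lemma riesz_representation:
  fixes f :: "'a::{real_inner,complete_space} \<Rightarrow> real"
  assumes "bounded_linear f"
  shows "\<exists>z. \<forall>x. f x = inner x z"
proof (cases "\<forall>x. f x = 0")
  case True
  then show ?thesis
    by (intro exI [of _ 0]) simp
next
  case False
  interpret bounded_linear f
    by fact
  obtain x where x: "f x \<noteq> 0"
    using False by blast
  have "subspace {x. f x = 0}"
    by (auto simp: subspace_def add scale zero)
  moreover have "closed {x. f x = 0}"
    by (intro closed_Collect_eq continuous_on continuous_on_id continuous_intros)
  ultimately obtain p where p: "f p = 0" "\<And>v. f v = 0 \<Longrightarrow> inner (x - p) v = 0"
    using orthogonal_projection_exists [of "{x. f x = 0}" x] by auto
  define u where "u = x - p"
  have fu: "f u \<noteq> 0"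
    using x p by (simp add: u_def diff)
  then have uu: "inner u u \<noteq> 0"
    using zero by auto
  have "f y = inner y ((f u / inner u u) *\<^sub>R u)" for y
  proof -
    have "inner u (y - (f y / f u) *\<^sub>R u) = 0"
      using p(2) [of "y - (f y / f u) *\<^sub>R u"] fu by (simp add: u_def [symmetric] diff scale)
    then show ?thesis
      using fu uu by (simp add: inner_diff_right inner_commute field_simps)
  qed
  then show ?thesis
    by blast
qed


section \<open>Bounded operators and von Neumann algebras\<close>

typedef (overloaded) 'a bop =
    "{T::'a::complex_hilbert_space \<Rightarrow> 'a. bounded_linear T \<and> (\<forall>c x. T (c *\<^sub>C x) = c *\<^sub>C T x)}"
  morphisms bop_apply Bop
  by (rule exI [of _ "\<lambda>x. x"]) simp

declare [[coercion "bop_apply :: 'a::complex_hilbert_space bop \<Rightarrow> 'a \<Rightarrow> 'a"]]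

setup_lifting type_definition_bop

lemma bop_eqI: "(\<And>x. bop_apply S x = bop_apply T x) \<Longrightarrow> S = T"
  by transfer auto

lemma bounded_linear_bop: "bounded_linear (bop_apply T)"
  by transfer simp

lemma bop_scaleC: "bop_apply T (c *\<^sub>C x) = c *\<^sub>C bop_apply T x"
  by transfer simp

instantiation bop :: (complex_hilbert_space) "{ring, monoid_mult, scaleC}"
begin

lift_definition zero_bop :: "'a bop" is "\<lambda>x. 0"
  by (simp add: scaleC_zero_right)

lift_definition one_bop :: "'a bop" is "\<lambda>x. x"
  by simp

lift_definition plus_bop :: "'a bop \<Rightarrow> 'a bop \<Rightarrow> 'a bop" is "\<lambda>S T x. S x + T x"
  by (simp add: bounded_linear_add scaleC_add_right)

lift_definition scaleC_bop :: "complex \<Rightarrow> 'a bop \<Rightarrow> 'a bop" is "\<lambda>c T x. c *\<^sub>C T x"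
  by (auto intro: bounded_linear_compose [OF bounded_linear_scaleC]
      simp: scaleC_scaleC mult.commute)

definition uminus_bop :: "'a bop \<Rightarrow> 'a bop" where "uminus_bop T = (-1) *\<^sub>C T"

definition minus_bop :: "'a bop \<Rightarrow> 'a bop \<Rightarrow> 'a bop" where "minus_bop S T = S + (- T)"

lift_definition times_bop :: "'a bop \<Rightarrow> 'a bop \<Rightarrow> 'a bop" is "\<lambda>S T x. S (T x)"
  by (auto intro: bounded_linear_compose)

instance
proof
  fix S T U :: "'a bop"
  show "S + T + U = S + (T + U)"
    by transfer (simp add: add.assoc)
  show "S + T = T + S"
    by transfer (simp add: add.commute)
  show "0 + T = T"
    by transfer simp
  show "- T + T = 0"
    unfolding uminus_bop_def by transfer (simp add: scaleC_minus_one)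
  show "S - T = S + - T"
    by (rule minus_bop_def)
  show "S * T * U = S * (T * U)"
    by transfer simp
  show "(S + T) * U = S * U + T * U"
    by transfer simp
  show "S * (T + U) = S * T + S * U"
    by transfer (simp add: linear_simps)
  show "1 * T = T" "T * 1 = T"
    by (transfer, simp)+
qed

end

definition adj :: "'a::complex_hilbert_space bop \<Rightarrow> 'a bop" where
  "adj T = (THE S::'a bop. \<forall>x y. cinner (T x) y = cinner x (S y))"

lemma adjoint_ex1:
  fixes T :: "'a::complex_hilbert_space bop"
  shows "\<exists>!S::'a bop. \<forall>x y. cinner (T x) y = cinner x (S y)"
proof -
  interpret T: bounded_linear "bop_apply T"
    by (rule bounded_linear_bop)
  obtain K where K: "\<And>x. norm (T x) \<le> norm x * K"
    using T.bounded by blast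
  have cancel: "y = z" if "\<And>x. cinner x y = cinner x z" for y z :: 'a
  proof -
    have "inner x y = inner x z" for x
      using that [of x] by (simp flip: Re_cinner)
    then show ?thesis
      using vector_eq_ldot by blast
  qed
  have "\<exists>z. \<forall>x. cinner (T x) y = cinner x z" for y
    using riesz_representation [of "\<lambda>x. inner (T x) y"]
    by (auto simp: cinner_eq_iff_inner bop_scaleC
        intro: bounded_linear_compose [OF bounded_linear_inner_left T.bounded_linear_axioms])
  then obtain S where S: "\<And>x y. cinner (T x) y = cinner x (S y)"
    by metis
  have add: "S (x + y) = S x + S y" for x y
    by (rule cancel) (simp add: cinner_add_right flip: S)
  have scale: "S (c *\<^sub>C x) = c *\<^sub>C S x" for c x
    by (rule cancel) (simp add: cinner_scaleC_right flip: S)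
  have "bounded_linear S"
  proof (rule bounded_linear_intro)
    show "S (r *\<^sub>R x) = r *\<^sub>R S x" for r x
      by (simp add: scaleR_scaleC scale)
    show "norm (S y) \<le> norm y * K" for y
    proof (cases "S y = 0")
      case True
      have "0 \<le> norm y * K"
        using K [of y] norm_ge_zero order_trans by blast
      then show ?thesis
        using True by simp
    next
      case False
      have "norm (S y) * norm (S y) = inner (T (S y)) y"
        using S [of "S y" y] by (metis Re_cinner power2_eq_square power2_norm_eq_inner)
      also have "\<dots> \<le> norm (T (S y)) * norm y"
        by (rule norm_cauchy_schwarz)
      also have "\<dots> \<le> norm (S y) * K * norm y"
        by (intro mult_right_mono K norm_ge_zero)
      finally have "norm (S y) * norm (S y) \<le> norm (S y) * (norm y * K)"
        by (simp add: mult_ac)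
      then show ?thesis
        using False by simp
    qed
  qed (rule add)
  then have "bop_apply (Bop S) = S"
    by (simp add: Bop_inverse scale)
  with S have "\<forall>x y. cinner (T x) y = cinner x (Bop S y)"
    by simp
  then show ?thesis
    by (metis bop_eqI cancel)
qed

lemma cinner_adj: "cinner (bop_apply T x) y = cinner x (bop_apply (adj T) y)"
  using theI' [OF adjoint_ex1 [of T]] unfolding adj_def by blast

lemma adj_eqI: "(\<And>x y. cinner (bop_apply T x) y = cinner x (bop_apply S y)) \<Longrightarrow> adj T = S"
  using adjoint_ex1 [of T] cinner_adj [of T] by blast

definition star_subalgebra :: "'a::complex_hilbert_space bop set \<Rightarrow> bool" where
  "star_subalgebra A \<longleftrightarrow> 1 \<in> A \<and> (\<forall>S\<in>A. \<forall>T\<in>A. S + T \<in> A \<and> S * T \<in> A) \<and>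
     (\<forall>T\<in>A. adj T \<in> A \<and> (\<forall>c. c *\<^sub>C T \<in> A))"

definition commutant :: "'a::complex_hilbert_space bop set \<Rightarrow> 'a bop set" where
  "commutant A = {T. \<forall>S\<in>A. S * T = T * S}"

definition von_neumann_algebra :: "'a::complex_hilbert_space bop set \<Rightarrow> bool" where
  "von_neumann_algebra M \<longleftrightarrow> star_subalgebra M \<and> commutant (commutant M) = M"

lemma von_neumann_algebra_Inter:
  assumes "\<And>M. M \<in> \<M> \<Longrightarrow> von_neumann_algebra M"
  shows "von_neumann_algebra (\<Inter>\<M>)"
proof -
  have "star_subalgebra (\<Inter>\<M>)"
    using assms by (auto simp: von_neumann_algebra_def star_subalgebra_def)
  moreover have "commutant (commutant (\<Inter>\<M>)) \<subseteq> M" if "M \<in> \<M>" for M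
  proof -
    have "commutant (commutant (\<Inter>\<M>)) \<subseteq> commutant (commutant M)"
      using that unfolding commutant_def by blast
    then show ?thesis
      using assms [OF that] by (simp add: von_neumann_algebra_def)
  qed
  moreover have "\<Inter>\<M> \<subseteq> commutant (commutant (\<Inter>\<M>))"
    by (auto simp: commutant_def)
  ultimately show ?thesis
    unfolding von_neumann_algebra_def by blast
qed

abbreviation vn_generated :: "'a::complex_hilbert_space bop set \<Rightarrow> 'a bop set" where
  "vn_generated S \<equiv> von_neumann_algebra hull S"

text \<open>
  The ultraweak (sigma-weak) topology is the initial topology of the functionals
  \<open>T \<mapsto> \<Sum>n. \<langle>T (x n), y n\<rangle>\<close> with square-summable \<open>x\<close> and \<open>y\<close>.
\<close>

definition ultraweak_topology :: "'a::complex_hilbert_space bop topology" where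
  "ultraweak_topology = topology_generated_by
     {{T :: 'a bop. (\<Sum>n. cinner (T (x n)) (y n)) \<in> U} | x y U.
        summable (\<lambda>n. (norm (x n))\<^sup>2) \<and> summable (\<lambda>n. (norm (y n))\<^sup>2) \<and> open (U :: complex set)}"

locale tracial_wstar_probability_space =
  fixes M :: "'a::complex_hilbert_space bop set" and \<tau> :: "'a bop \<Rightarrow> complex"
  assumes vn: "von_neumann_algebra M"
    and trace_add: "\<lbrakk>S \<in> M; T \<in> M\<rbrakk> \<Longrightarrow> \<tau> (S + T) = \<tau> S + \<tau> T"
    and trace_scaleC: "T \<in> M \<Longrightarrow> \<tau> (c *\<^sub>C T) = c * \<tau> T"
    and trace_one: "\<tau> 1 = 1"
    and trace_positive: "T \<in> M \<Longrightarrow> \<tau> (adj T * T) \<in> \<real>\<^sub>\<ge>\<^sub>0"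
    and trace_faithful: "\<lbrakk>T \<in> M; \<tau> (adj T * T) = 0\<rbrakk> \<Longrightarrow> T = 0"
    and trace_commute: "\<lbrakk>S \<in> M; T \<in> M\<rbrakk> \<Longrightarrow> \<tau> (S * T) = \<tau> (T * S)"
    and trace_ultraweak: "continuous_map (subtopology ultraweak_topology M) euclidean \<tau>"

definition self_adjoints :: "'a::complex_hilbert_space bop set \<Rightarrow> 'a bop set" where
  "self_adjoints M = {T\<in>M. adj T = T}"

definition projections :: "'a::complex_hilbert_space bop set \<Rightarrow> 'a bop set" where
  "projections M = {P\<in>M. adj P = P \<and> P * P = P}"


section \<open>Range projections and suprema of projections\<close>

definition proj_onto :: "'a::complex_hilbert_space set \<Rightarrow> 'a bop" where
  "proj_onto V = (THE P. P \<in> projections UNIV \<and> range (bop_apply P) = V)"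

definition range_projection :: "'a::complex_hilbert_space bop \<Rightarrow> 'a bop" where
  "range_projection T = proj_onto (closure (range (bop_apply T)))"

definition Sup_projections :: "'a::complex_hilbert_space bop set \<Rightarrow> 'a bop" where
  "Sup_projections \<P> = proj_onto (closure (csubspace hull (\<Union>P\<in>\<P>. range (bop_apply P))))"

lemma proj_onto_ex1:
  fixes V :: "'a::complex_hilbert_space set"
  assumes V: "csubspace V" "closed V"
  shows "\<exists>!P. P \<in> projections UNIV \<and> range (bop_apply P) = V"
proof -
  have sub: "subspace V"
    by (rule csubspace_imp_subspace) fact
  obtain p where p: "\<And>x. p x \<in> V" "\<And>x v. v \<in> V \<Longrightarrow> inner (x - p x) v = 0"
    using orthogonal_projection_exists [OF sub V(2)] by metis
  have uniq: "p x = q" if q: "q \<in> V" "\<And>v. v \<in> V \<Longrightarrow> inner (x - q) v = 0" for x q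
  proof -
    have "p x - q \<in> V"
      using p q sub by (simp add: subspace_diff)
    then have "inner (x - q) (p x - q) = 0" "inner (x - p x) (p x - q) = 0"
      using p(2) q(2) by blast+
    then have "inner (p x - q) (p x - q) = 0"
      by (simp add: inner_diff_left)
    then show ?thesis
      by simp
  qed
  have add: "p (x + y) = p x + p y" for x y
  proof (rule uniq)
    fix v assume "v \<in> V"
    then show "inner (x + y - (p x + p y)) v = 0"
      using p(2) [of v x] p(2) [of v y] by (simp add: inner_diff_left inner_add_left)
  qed (use p sub in \<open>auto simp: subspace_add\<close>)
  have scale: "p (c *\<^sub>C x) = c *\<^sub>C p x" for c x
  proof (rule uniq)
    show "c *\<^sub>C p x \<in> V"
      using p V by (simp add: csubspace_def)
    fix v assume v: "v \<in> V"
    have *: "c *\<^sub>C x - c *\<^sub>C p x = c *\<^sub>C (x - p x)"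
      using scaleC_add_right [of c "x - p x" "p x"] by simp
    have "inner (c *\<^sub>C (x - p x)) v = Re (cinner (x - p x) (cnj c *\<^sub>C v))"
      by (simp add: cinner_scaleC_left cinner_scaleC_right flip: Re_cinner)
    also have "\<dots> = 0"
      using p(2) [of "cnj c *\<^sub>C v" x] v V by (simp add: Re_cinner csubspace_def)
    finally show "inner (c *\<^sub>C x - c *\<^sub>C p x) v = 0"
      by (simp add: *)
  qed
  have "bounded_linear p"
  proof (rule bounded_linear_intro)
    show "p (r *\<^sub>R x) = r *\<^sub>R p x" for r x
      by (simp add: scaleR_scaleC scale)
    show "norm (p x) \<le> norm x * 1" for x
    proof (cases "p x = 0")
      case False
      have "norm (p x) * norm (p x) = inner x (p x)"
        using p(2) [OF p(1), of x x]
        by (simp add: inner_diff_left flip: power2_eq_square power2_norm_eq_inner)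
      also have "\<dots> \<le> norm x * norm (p x)"
        by (rule norm_cauchy_schwarz)
      finally show ?thesis
        using False by simp
    qed simp
  qed (rule add)
  then have app: "bop_apply (Bop p) = p"
    by (simp add: Bop_inverse scale)
  have idem: "p v = v" if "v \<in> V" for v
    using that by (intro uniq) auto
  have sym: "inner (p x) y = inner x (p y)" for x y
  proof -
    have "inner x (p y) = inner (p x) (p y)" "inner y (p x) = inner (p y) (p x)"
      using p(2) [OF p(1), of x y] p(2) [OF p(1), of y x] by (simp_all add: inner_diff_left)
    then show ?thesis
      by (metis inner_commute)
  qed
  have "adj (Bop p) = Bop p"
  proof (rule adj_eqI)
    show "cinner (Bop p x) y = cinner x (Bop p y)" for x y
      using cinner_eq_iff_inner [of p y "p y"] scale sym by (simp add: app)
  qed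
  moreover have "Bop p * Bop p = Bop p"
    by (rule bop_eqI) (simp add: times_bop.rep_eq app idem p)
  moreover have "range (Bop p) = V"
  proof
    show "V \<subseteq> range (Bop p)"
      unfolding app using idem by (metis rangeI subsetI)
  qed (use p app in auto)
  moreover have "P = Bop p" if P: "adj P = P" "P * P = P" "range P = V" for P :: "'a bop"
  proof (rule bop_eqI)
    fix x
    have "p x = P x"
    proof (rule uniq)
      fix v assume "v \<in> V"
      then obtain y where y: "v = P y"
        using P by auto
      have "inner x v = inner (P x) v"
        using cinner_adj [of P x v] P y
        by (metis Re_cinner times_bop.rep_eq)
      then show "inner (x - P x) v = 0"
        by (simp add: inner_diff_left)
    qed (use P in auto)
    then show "P x = Bop p x"
      by (simp add: app)
  qed
  ultimately show ?thesis
    unfolding projections_def by blast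
qed

lemma proj_onto:
  assumes "csubspace V" "closed V"
  shows "proj_onto V \<in> projections UNIV" "range (bop_apply (proj_onto V)) = V"
  using theI' [OF proj_onto_ex1 [OF assms]] unfolding proj_onto_def by blast+

lemma range_projection:
  "range_projection T \<in> projections UNIV"
  "range (bop_apply (range_projection T)) = closure (range (bop_apply T))"
proof -
  interpret T: bounded_linear "bop_apply T"
    by (rule bounded_linear_bop)
  have "csubspace (range (bop_apply T))"
    unfolding csubspace_def
  proof (intro conjI ballI allI)
    show "0 \<in> range (bop_apply T)"
      using T.zero by (metis rangeI)
    show "x + y \<in> range (bop_apply T)" if "x \<in> range (bop_apply T)" "y \<in> range (bop_apply T)" for x y
      using that by (auto simp flip: T.add)
    show "c *\<^sub>C x \<in> range (bop_apply T)" if "x \<in> range (bop_apply T)" for c x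
      using that by (auto simp flip: bop_scaleC)
  qed
  then have V: "csubspace (closure (range (bop_apply T)))"
    by (rule csubspace_closure)
  show "range_projection T \<in> projections UNIV"
    "range (bop_apply (range_projection T)) = closure (range (bop_apply T))"
    using proj_onto [OF V closed_closure] by (simp_all only: range_projection_def)
qed

lemma Sup_projections:
  "Sup_projections \<P> \<in> projections UNIV"
  "range (bop_apply (Sup_projections \<P>)) = closure (csubspace hull (\<Union>P\<in>\<P>. range (bop_apply P)))"
  unfolding Sup_projections_def
  by (intro proj_onto csubspace_closure csubspace_hull closed_closure)+


section \<open>Free independence and distributions\<close>

definition free_subalgebras ::
    "('a::complex_hilbert_space bop \<Rightarrow> complex) \<Rightarrow> 'i set \<Rightarrow> ('i \<Rightarrow> 'a bop set) \<Rightarrow> bool" where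
  "free_subalgebras \<tau> I A \<longleftrightarrow>
     (\<forall>w. w \<noteq> [] \<and> distinct_adj (map fst w) \<and> (\<forall>(i, a)\<in>set w. i \<in> I \<and> a \<in> A i \<and> \<tau> a = 0) \<longrightarrow>
        \<tau> (prod_list (map snd w)) = 0)"

definition freely_independent ::
    "('a::complex_hilbert_space bop \<Rightarrow> complex) \<Rightarrow> 'i set \<Rightarrow> ('i \<Rightarrow> 'a bop) \<Rightarrow> bool" where
  "freely_independent \<tau> I X \<longleftrightarrow> free_subalgebras \<tau> I (\<lambda>i. star_subalgebra hull {X i})"

text \<open>
  The measure \<open>\<nu>\<close> is the distribution of a self-adjoint \<open>T\<close> if it has the moments of \<open>T\<close>;
  compactness of the support makes \<open>\<nu>\<close> unique.
\<close>

definition has_distribution ::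
    "('a::complex_hilbert_space bop \<Rightarrow> complex) \<Rightarrow> 'a bop \<Rightarrow> real measure \<Rightarrow> bool" where
  "has_distribution \<tau> T \<nu> \<longleftrightarrow>
     sets \<nu> = sets borel \<and> (\<exists>K. compact K \<and> emeasure \<nu> (- K) = 0) \<and>
     (\<forall>n. integrable \<nu> (\<lambda>t. t ^ n) \<and> \<tau> (T ^ n) = complex_of_real (\<integral>t. t ^ n \<partial>\<nu>))"

definition free_poisson_density :: "real \<Rightarrow> real \<Rightarrow> real" where
  "free_poisson_density a t =
     indicator {(1 - sqrt a)\<^sup>2..(1 + sqrt a)\<^sup>2} t * (sqrt (4 * a - (t - (1 + a))\<^sup>2) / (2 * pi * t))"

definition free_poisson :: "real \<Rightarrow> real measure" where
  "free_poisson a = measure_of UNIV (sets borel)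
     (\<lambda>A. ennreal (max 0 (1 - a)) * indicator A 0 +
          (\<integral>\<^sup>+t\<in>A. ennreal (free_poisson_density a t) \<partial>lborel))"

lemma sets_free_poisson: "sets (free_poisson a) = sets borel"
  unfolding free_poisson_def by (metis sets.sigma_sets_eq sets_measure_of space_borel subset_UNIV
      sets.space_closed)

lemma emeasure_free_poisson:
  assumes A: "A \<in> sets borel"
  shows "emeasure (free_poisson a) A = ennreal (max 0 (1 - a)) * indicator A 0 +
    (\<integral>\<^sup>+t\<in>A. ennreal (free_poisson_density a t) \<partial>lborel)"
proof -
  define D where "D = density lborel (\<lambda>t. ennreal (free_poisson_density a t))"
  have [measurable]: "free_poisson_density a \<in> borel_measurable borel"
    unfolding free_poisson_density_def [abs_def] by measurable
  have D: "emeasure D B = (\<integral>\<^sup>+t\<in>B. ennreal (free_poisson_density a t) \<partial>lborel)"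
    if "B \<in> sets borel" for B
    using that unfolding D_def by (subst emeasure_density) auto
  have setsD: "sets D = sets borel"
    by (simp add: D_def)
  show ?thesis
  proof (rule emeasure_measure_of [OF free_poisson_def])
    show "countably_additive (sets (free_poisson a))
       (\<lambda>A. ennreal (max 0 (1 - a)) * indicator A 0 +
          (\<integral>\<^sup>+t\<in>A. ennreal (free_poisson_density a t) \<partial>lborel))"
    proof (rule countably_additiveI)
      fix B :: "nat \<Rightarrow> real set"
      assume "range B \<subseteq> sets (free_poisson a)" and disj: "disjoint_family B"
      then have B: "range B \<subseteq> sets borel"
        by (simp add: sets_free_poisson)
      have "(\<Sum>i. ennreal (max 0 (1 - a)) * indicator (B i) 0 + emeasure D (B i)) =
          ennreal (max 0 (1 - a)) * (\<Sum>i. indicator (B i) 0) + (\<Sum>i. emeasure D (B i))"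
        by (simp add: suminf_add flip: ennreal_suminf_cmult)
      also have "(\<Sum>i. indicator (B i) 0) = (indicator (\<Union>i. B i) 0 :: ennreal)"
        by (rule suminf_indicator) fact
      also have "(\<Sum>i. emeasure D (B i)) = emeasure D (\<Union>i. B i)"
        using B disj by (intro suminf_emeasure) (auto simp: setsD)
      finally show "(\<Sum>i. ennreal (max 0 (1 - a)) * indicator (B i) 0 +
            (\<integral>\<^sup>+t\<in>B i. ennreal (free_poisson_density a t) \<partial>lborel)) =
          ennreal (max 0 (1 - a)) * indicator (\<Union>i. B i) 0 +
            (\<integral>\<^sup>+t\<in>(\<Union>i. B i). ennreal (free_poisson_density a t) \<partial>lborel)"
        using B by (subst (asm) (1 2) D) auto
    qed
  qed (use A in \<open>auto simp: positive_def sets_free_poisson\<close>)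
qed


section \<open>The two processes\<close>

definition finite_sets :: "'x measure \<Rightarrow> 'x set set" where
  "finite_sets \<mu> = {\<alpha>\<in>sets \<mu>. emeasure \<mu> \<alpha> < \<infinity>}"

definition measure_atom :: "'x measure \<Rightarrow> 'x set \<Rightarrow> bool" where
  "measure_atom \<mu> A \<longleftrightarrow> A \<in> sets \<mu> \<and> 0 < emeasure \<mu> A \<and>
     (\<forall>B\<in>sets \<mu>. B \<subseteq> A \<and> emeasure \<mu> B < emeasure \<mu> A \<longrightarrow> emeasure \<mu> B = 0)"

text \<open>
  The series in the additivity axiom converges in the strong operator topology; it does not
  converge in norm in general.
\<close>

definition free_poisson_process ::
    "'x measure \<Rightarrow> 'a::complex_hilbert_space bop set \<Rightarrow> ('a bop \<Rightarrow> complex) \<Rightarrow> ('x set \<Rightarrow> 'a bop) \<Rightarrow> bool"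
  where
  "free_poisson_process \<mu> M \<tau> \<pi> \<longleftrightarrow>
     (\<forall>\<alpha>\<in>finite_sets \<mu>. \<pi> \<alpha> \<in> self_adjoints M \<and>
        has_distribution \<tau> (\<pi> \<alpha>) (free_poisson (measure \<mu> \<alpha>))) \<and>
     (\<forall>\<alpha>::nat \<Rightarrow> 'x set.
        range \<alpha> \<subseteq> finite_sets \<mu> \<and> disjoint_family \<alpha> \<and> (\<Sum>k. emeasure \<mu> (\<alpha> k)) < \<infinity> \<longrightarrow>
        (\<forall>x. (\<lambda>k. \<pi> (\<alpha> k) x) sums \<pi> (\<Union>k. \<alpha> k) x) \<and> freely_independent \<tau> UNIV (\<lambda>k. \<pi> (\<alpha> k)))"

definition null_equiv :: "'x measure \<Rightarrow> ('x set \<times> 'x set) set" where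
  "null_equiv \<mu> = {(A, B). A \<in> sets \<mu> \<and> B \<in> sets \<mu> \<and> sym_diff A B \<in> null_sets \<mu>}"

definition null_subset :: "'x measure \<Rightarrow> 'x set \<Rightarrow> 'x set \<Rightarrow> bool" where
  "null_subset \<mu> A B \<longleftrightarrow> A - B \<in> null_sets \<mu>"

definition null_lub :: "'x measure \<Rightarrow> 'x set set \<Rightarrow> 'x set \<Rightarrow> bool" where
  "null_lub \<mu> \<Omega> \<alpha> \<longleftrightarrow> \<alpha> \<in> sets \<mu> \<and> (\<forall>\<omega>\<in>\<Omega>. null_subset \<mu> \<omega> \<alpha>) \<and>
     (\<forall>\<beta>\<in>sets \<mu>. (\<forall>\<omega>\<in>\<Omega>. null_subset \<mu> \<omega> \<beta>) \<longrightarrow> null_subset \<mu> \<alpha> \<beta>)"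

text \<open>
  A map on the quotient of the sigma-algebra by null sets is a map on measurable sets that
  respects \<open>null_equiv \<mu>\<close>, and the order on the quotient is expressed on representatives by
  \<open>null_subset \<mu>\<close>. The \<open>itself\<close> argument is the type of the indices of the families in the
  freeness axiom, which may be arbitrary.
\<close>

definition free_upper_extremal_process ::
    "'k itself \<Rightarrow> 'x measure \<Rightarrow> 'a::complex_hilbert_space bop set \<Rightarrow> ('a bop \<Rightarrow> complex) \<Rightarrow>
      ('x set \<Rightarrow> 'a bop) \<Rightarrow> bool"
  where
  "free_upper_extremal_process K_type \<mu> M \<tau> Y \<longleftrightarrow>
     Y respects null_equiv \<mu> \<and>
     (\<forall>\<omega>\<in>sets \<mu>. Y \<omega> \<in> projections M) \<and>
     (\<forall>\<Omega> \<alpha>. \<Omega> \<subseteq> sets \<mu> \<and> \<Omega> \<noteq> {} \<and> null_lub \<mu> \<Omega> \<alpha> \<longrightarrow> Y \<alpha> = Sup_projections (Y ` \<Omega>)) \<and>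
     (\<forall>(K::'k set) \<omega>. \<omega> ` K \<subseteq> sets \<mu> \<and>
        (\<forall>j\<in>K. \<forall>k\<in>K. j \<noteq> k \<longrightarrow> \<omega> j \<inter> \<omega> k \<in> null_sets \<mu>) \<longrightarrow>
        freely_independent \<tau> K (\<lambda>k. Y (\<omega> k))) \<and>
     (\<forall>\<omega>\<in>sets \<mu>. \<tau> (Y \<omega>) = complex_of_real (enn2real (min (emeasure \<mu> \<omega>) 1)))"

end

theory Submission
  imports Defs
begin

text \<open>
  Moments control order: if a polynomial is nonnegative on the support of the distribution of a
  self-adjoint \<open>T\<close>, then it is positive at \<open>T\<close>, because the trace is faithful. In particular every
  \<open>\<pi> \<alpha>\<close> is positive, so the kernel of a sum of such operators is the intersection of the kernels.
  Since \<open>Y \<alpha>\<close> has the kernel of \<open>\<pi> \<alpha>\<close>, the additivity of \<open>\<pi>\<close> turns countable unions of sets into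
  intersections of kernels of \<open>Y\<close>, that is, into suprema of projections, and by sigma-finiteness
  every supremum modulo null sets is attained by a countable union. The range projection is a
  bounded strong limit of polynomials in \<open>\<pi> \<alpha>\<close>, which gives its trace \<open>1 - \<nu> {0}\<close> and transfers
  freeness from \<open>\<pi>\<close> to \<open>Y\<close>.

  Without atoms, \<open>\<alpha>\<close> splits into countably many pieces of measure less than \<open>a\<close>, and on each
  piece \<open>(1 - sqrt a)\<^sup>2 Y \<le> \<pi> \<le> (1 + sqrt a)\<^sup>2 Y\<close>. Summation shows that \<open>\<pi> \<alpha>\<close> commutes with everything that
  commutes with all \<open>Y \<beta>\<close>.
\<close>

section \<open>Bounded operators\<close>

text \<open>The hypotheses give the moments of one operator at a time, so every order statement has
  to pass through the trace. The bridge is a sequence of polynomials \<open>p n\<close> with two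
  simultaneous limits: \<open>op_poly T (p n)\<close> converges strongly with a uniform bound, and
  \<open>poly (p n)\<close> converges boundedly almost everywhere for the distribution of
  \<open>T\<close>. The trace of the operator limit is then the integral of the pointwise limit. Two
  such sequences stand in for the spectral theorem: a square root iteration for absolute values, and
  powers of a contraction for range projections. In the part without atoms, the pieces have to
  shrink while their number is infinite, so the error made on a piece must be summable. It is
  therefore measured against \<pi> of the piece: these operators are positive and add up to
  \<open>\<pi> \<alpha>\<close>, whatever the partition is.\<close>

lemma bop_apply_simps [simp]:
  fixes S T :: "'a::complex_hilbert_space bop"
  shows "(0 :: 'a bop) x = 0" "(1 :: 'a bop) x = x" "(S + T) x = S x + T x"
    "(S * T) x = S (T x)" "(c *\<^sub>C T) x = c *\<^sub>C T x" "(- T) x = - T x" "(S - T) x = S x - T x"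
proof -
  show *: "(0 :: 'a bop) x = 0" "(1 :: 'a bop) x = x" "(S + T) x = S x + T x"
    "(S * T) x = S (T x)" and c: "(c *\<^sub>C T) x = c *\<^sub>C T x" for T :: "'a bop" and c
    by (transfer, simp)+
  show m: "(- T) x = - T x" for T :: "'a bop"
    by (simp add: uminus_bop_def c scaleC_minus_one)
  show "(S - T) x = S x - T x"
    unfolding minus_bop_def * m by simp
qed

lemma bop_linear [simp]:
  fixes T :: "'a::complex_hilbert_space bop"
  shows "T 0 = 0" "T (x + y) = T x + T y" "T (x - y) = T x - T y" "T (- x) = - T x"
    "T (r *\<^sub>R x) = r *\<^sub>R T x" "T (c *\<^sub>C x) = c *\<^sub>C T x"
proof -
  interpret bounded_linear "bop_apply T"
    by (rule bounded_linear_bop)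
  show "T 0 = 0" "T (x + y) = T x + T y" "T (x - y) = T x - T y" "T (- x) = - T x"
    "T (r *\<^sub>R x) = r *\<^sub>R T x"
    by (rule zero add diff neg scale)+
qed (rule bop_scaleC)

lemma tendsto_bop [tendsto_intros]:
  "(f \<longlongrightarrow> l) F \<Longrightarrow> ((\<lambda>n. bop_apply T (f n)) \<longlongrightarrow> T l) F"
  using bounded_linear.tendsto [OF bounded_linear_bop] .

lemma scaleC_bop_simps [simp]:
  fixes S T :: "'a::complex_hilbert_space bop"
  shows "(c *\<^sub>C S) * T = c *\<^sub>C (S * T)" "S * (c *\<^sub>C T) = c *\<^sub>C (S * T)" "1 *\<^sub>C T = T" "0 *\<^sub>C T = 0"
    "c *\<^sub>C d *\<^sub>C T = (c * d) *\<^sub>C T" "c *\<^sub>C (0 :: 'a bop) = 0"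
  by (rule bop_eqI; simp add: scaleC_one scaleC_zero_left scaleC_zero_right scaleC_scaleC)+

lemma scaleC_bop_distrib:
  fixes S T :: "'a::complex_hilbert_space bop"
  shows "c *\<^sub>C (S + T) = c *\<^sub>C S + c *\<^sub>C T" "(c + d) *\<^sub>C T = c *\<^sub>C T + d *\<^sub>C T"
  by (rule bop_eqI; simp add: scaleC_add_left scaleC_add_right)+

lemma inner_adj: "inner (bop_apply T x) y = inner x (adj T y)"
  using arg_cong [OF cinner_adj [of T x y], of Re] by (simp only: Re_cinner)

lemma inner_self_adjoint: "adj T = T \<Longrightarrow> inner (bop_apply T x) y = inner x (T y)"
  by (simp add: inner_adj)

lemma adj_simps [simp]:
  fixes S T :: "'a::complex_hilbert_space bop"
  shows "adj (0 :: 'a bop) = 0" "adj (1 :: 'a bop) = 1" "adj (S + T) = adj S + adj T"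
    "adj (S * T) = adj T * adj S" "adj (c *\<^sub>C T) = cnj c *\<^sub>C adj T"
    "adj (- T) = - adj T" "adj (S - T) = adj S - adj T"
proof -
  have c0: "cinner 0 y = 0" "cinner y 0 = 0" for y :: 'a
    using cinner_scaleC_left [of 0 0 y] cinner_scaleC_right [of y 0 0]
    by (simp_all add: scaleC_zero_right)
  show "adj (0 :: 'a bop) = 0" "adj (1 :: 'a bop) = 1" "adj (S * T) = adj T * adj S"
    by (rule adj_eqI; simp add: c0 cinner_adj)+
  show *: "adj (S + T) = adj S + adj T" "adj (c *\<^sub>C T) = cnj c *\<^sub>C adj T" for S T :: "'a bop" and c
    by (rule adj_eqI; simp add: cinner_adj cinner_add_left cinner_add_right cinner_scaleC_left
        cinner_scaleC_right)+
  show m: "adj (- T) = - adj T" for T :: "'a bop"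
    by (simp add: uminus_bop_def *)
  show "adj (S - T) = adj S - adj T"
    unfolding minus_bop_def * m ..
qed

lemma bop_bound: "\<exists>C>0. \<forall>x. norm (bop_apply T x) \<le> C * norm x"
  using bounded_linear.pos_bounded [OF bounded_linear_bop [of T]] by (auto simp: mult.commute)

lemma norm_bop_self_adjoint_square:
  "adj T = T \<Longrightarrow> (norm (bop_apply T x))\<^sup>2 = inner (T (T x)) x"
  by (simp add: power2_norm_eq_inner inner_self_adjoint)

text \<open>Only the real part of the complex form is tested, so self-adjointness is not contained
  here; \<open>positive_bop_ker\<close> assumes it separately.\<close>

definition positive_bop :: "'a::complex_hilbert_space bop \<Rightarrow> bool" where
  "positive_bop T \<longleftrightarrow> (\<forall>x. 0 \<le> inner (T x) x)"

text \<open>Moving from \<open>x\<close> in the direction \<open>- A x\<close> changes the form,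
  which starts at 0, by a negative first-order term unless \<open>A x = 0\<close>.\<close>

lemma positive_bop_ker:
  assumes A: "positive_bop A" "adj A = A" and x: "inner (bop_apply A x) x = 0"
  shows "A x = 0"
proof (rule ccontr)
  assume nz: "A x \<noteq> 0"
  define k where "k = inner (A (A x)) (A x)"
  have k: "k \<ge> 0"
    using A by (simp add: k_def positive_bop_def)
  \<comment> \<open>The step is so short that the quadratic term is at most half of the linear one;
    the 1 in the denominator covers \<open>k = 0\<close>.\<close>
  define t where "t = (norm (A x))\<^sup>2 / (k + 1)"
  have "0 \<le> inner (A (x - t *\<^sub>R A x)) (x - t *\<^sub>R A x)"
    using A by (simp only: positive_bop_def)
  also have "\<dots> = t * (t * k - 2 * (norm (A x))\<^sup>2)"
    using x by (simp add: k_def inner_diff_left inner_diff_right power2_norm_eq_inner algebra_simps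
        inner_self_adjoint [OF A(2)])
  also have "\<dots> < 0"
  proof -
    have n: "(norm (A x))\<^sup>2 > 0"
      using nz by simp
    have "t * k \<le> (norm (A x))\<^sup>2"
      using k n by (simp add: t_def field_simps)
    moreover have "t > 0"
      using k n by (simp add: t_def)
    ultimately show ?thesis
      using n by (intro mult_pos_neg) linarith+
  qed
  finally show False
    by simp
qed

lemma star_subalgebra_hull: "star_subalgebra (star_subalgebra hull S)"
  by (rule hull_in) (auto simp: star_subalgebra_def)

lemma von_neumann_algebra_hull: "von_neumann_algebra (vn_generated S)"
  by (rule hull_in) (auto intro: von_neumann_algebra_Inter)

lemma star_subalgebraD:
  assumes "star_subalgebra A"
  shows "1 \<in> A" "0 \<in> A" "S \<in> A \<Longrightarrow> T \<in> A \<Longrightarrow> S + T \<in> A" "S \<in> A \<Longrightarrow> T \<in> A \<Longrightarrow> S * T \<in> A"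
    "T \<in> A \<Longrightarrow> adj T \<in> A" "T \<in> A \<Longrightarrow> c *\<^sub>C T \<in> A" "S \<in> A \<Longrightarrow> T \<in> A \<Longrightarrow> S - T \<in> A"
    "T \<in> A \<Longrightarrow> - T \<in> A"
proof -
  show *: "1 \<in> A" "S \<in> A \<Longrightarrow> T \<in> A \<Longrightarrow> S + T \<in> A" "S \<in> A \<Longrightarrow> T \<in> A \<Longrightarrow> S * T \<in> A"
    "T \<in> A \<Longrightarrow> adj T \<in> A" "T \<in> A \<Longrightarrow> c *\<^sub>C T \<in> A" for S T c
    using assms by (auto simp: star_subalgebra_def)
  show "0 \<in> A"
    using *(5) [OF *(1), of 0] by simp
  show m: "T \<in> A \<Longrightarrow> - T \<in> A" for T
    by (simp add: uminus_bop_def *)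
  show "S \<in> A \<Longrightarrow> T \<in> A \<Longrightarrow> S - T \<in> A"
    unfolding minus_bop_def by (intro * m)
qed

lemma star_subalgebra_power: "star_subalgebra A \<Longrightarrow> T \<in> A \<Longrightarrow> T ^ n \<in> A"
  by (induction n) (auto simp: star_subalgebraD)

section \<open>Bounded strongly convergent sequences\<close>

text \<open>The uniform bound lets products pass to the limit and supplies the majorant for
  ultraweak convergence.\<close>

definition strong_limit :: "(nat \<Rightarrow> 'a::complex_hilbert_space bop) \<Rightarrow> 'a bop \<Rightarrow> bool" where
  "strong_limit A T \<longleftrightarrow> (\<exists>C. \<forall>n x. norm (A n x) \<le> C * norm x) \<and> (\<forall>x. (\<lambda>n. A n x) \<longlonglongrightarrow> T x)"

lemma strong_limitI:
  "(\<And>n x. norm (bop_apply (A n) x) \<le> C * norm x) \<Longrightarrow> (\<And>x. (\<lambda>n. A n x) \<longlonglongrightarrow> bop_apply T x) \<Longrightarrow> strong_limit A T"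
  unfolding strong_limit_def by blast

lemma strong_limitD: "strong_limit A T \<Longrightarrow> (\<lambda>n. A n x) \<longlonglongrightarrow> T x"
  unfolding strong_limit_def by blast

lemma strong_limit_boundE:
  assumes "strong_limit A T"
  obtains C where "C > 0" "\<And>n x. norm (A n x) \<le> C * norm x"
proof -
  obtain C where C: "\<And>n x. norm (A n x) \<le> C * norm x"
    using assms unfolding strong_limit_def by blast
  have "norm (A n x) \<le> (max C 1) * norm x" for n x
    by (rule order_trans [OF C]) (simp add: mult_right_mono)
  then show ?thesis
    by (rule that [rotated]) simp
qed

lemma strong_limit_const: "strong_limit (\<lambda>n. T) T"
  using bop_bound [of T] unfolding strong_limit_def by auto

lemma strong_limit_add:
  assumes "strong_limit A S" "strong_limit B T"
  shows "strong_limit (\<lambda>n. A n + B n) (S + T)"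
proof -
  obtain C D where C: "\<And>n x. norm (A n x) \<le> C * norm x" and D: "\<And>n x. norm (B n x) \<le> D * norm x"
    using strong_limit_boundE assms by metis
  show ?thesis
  proof (rule strong_limitI)
    show "norm ((A n + B n) x) \<le> (C + D) * norm x" for n x
      using norm_triangle_ineq [of "A n x" "B n x"] C [of n x] D [of n x] by (simp add: algebra_simps)
  qed (auto intro!: tendsto_intros assms strong_limitD)
qed

lemma strong_limit_mult:
  assumes "strong_limit A S" "strong_limit B T"
  shows "strong_limit (\<lambda>n. A n * B n) (S * T)"
proof -
  obtain C D where C: "C > 0" "\<And>n x. norm (A n x) \<le> C * norm x"
    and D: "\<And>n x. norm (B n x) \<le> D * norm x"
    using strong_limit_boundE assms by metis
  show ?thesis
  proof (rule strong_limitI)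
    show "norm ((A n * B n) x) \<le> (C * D) * norm x" for n x
    proof -
      have "norm (A n (B n x)) \<le> C * norm (B n x)"
        by (rule C)
      also have "\<dots> \<le> C * (D * norm x)"
        using C D by (intro mult_left_mono) auto
      finally show ?thesis
        by (simp add: mult.assoc)
    qed
    show "(\<lambda>n. (A n * B n) x) \<longlonglongrightarrow> (S * T) x" for x
    proof -
      have "(\<lambda>n. C * norm (B n x - T x)) \<longlonglongrightarrow> C * norm (T x - T x)"
        by (intro tendsto_intros strong_limitD assms)
      then have "(\<lambda>n. C * norm (B n x - T x)) \<longlonglongrightarrow> 0"
        by simp
      then have "(\<lambda>n. A n (B n x - T x)) \<longlonglongrightarrow> 0"
        by (rule Lim_null_comparison [rotated]) (simp add: C del: bop_linear)
      moreover have "(\<lambda>n. A n (T x)) \<longlonglongrightarrow> S (T x)"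
        by (intro strong_limitD assms)
      ultimately have "(\<lambda>n. A n (B n x - T x) + A n (T x)) \<longlonglongrightarrow> 0 + S (T x)"
        by (rule tendsto_add)
      then show ?thesis
        by simp
    qed
  qed
qed

lemma tendsto_scaleC:
  assumes "(c \<longlongrightarrow> d) F" "(f \<longlongrightarrow> x) F"
  shows "((\<lambda>n. c n *\<^sub>C f n) \<longlongrightarrow> d *\<^sub>C (x::'a::complex_hilbert_space)) F"
proof -
  have "((\<lambda>n. (c n - d) *\<^sub>C f n) \<longlongrightarrow> 0) F"
  proof (rule tendsto_norm_zero_cancel)
    have "((\<lambda>n. cmod (c n - d) * norm (f n)) \<longlongrightarrow> cmod (d - d) * norm x) F"
      by (intro tendsto_intros assms)
    then show "((\<lambda>n. norm ((c n - d) *\<^sub>C f n)) \<longlongrightarrow> 0) F"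
      by (simp add: norm_scaleC)
  qed
  moreover have "((\<lambda>n. d *\<^sub>C f n) \<longlongrightarrow> d *\<^sub>C x) F"
    by (rule bounded_linear.tendsto [OF bounded_linear_scaleC]) fact
  ultimately have "((\<lambda>n. (c n - d) *\<^sub>C f n + d *\<^sub>C f n) \<longlongrightarrow> 0 + d *\<^sub>C x) F"
    by (rule tendsto_add)
  then show ?thesis
    by (simp flip: scaleC_add_left)
qed

lemma strong_limit_scaleC:
  assumes "strong_limit A S" "c \<longlonglongrightarrow> d"
  shows "strong_limit (\<lambda>n. c n *\<^sub>C A n) (d *\<^sub>C S)"
proof -
  obtain C where C: "C > 0" "\<And>n x. norm (A n x) \<le> C * norm x"
    using strong_limit_boundE assms by metis
  obtain K where K: "\<And>n. cmod (c n) \<le> K"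
    using convergent_imp_Bseq [of c] assms(2) by (auto simp: convergent_def Bseq_def)
  show ?thesis
  proof (rule strong_limitI)
    show "norm ((c n *\<^sub>C A n) x) \<le> (K * C) * norm x" for n x
      using mult_mono [OF K [of n] C(2) [of n x]] order_trans [OF norm_ge_zero K]
      by (simp add: norm_scaleC mult.assoc)
  qed (auto intro!: tendsto_scaleC assms strong_limitD)
qed

lemma strong_limit_diff:
  assumes "strong_limit A S" "strong_limit B T"
  shows "strong_limit (\<lambda>n. A n - B n) (S - T)"
  using strong_limit_add [OF assms(1) strong_limit_scaleC [OF assms(2) tendsto_const, of "-1"]]
  by (simp add: minus_bop_def uminus_bop_def)

lemma strong_limit_prod_list:
  assumes "\<And>a. a \<in> set w \<Longrightarrow> strong_limit (\<lambda>n. b n a) (f a)"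
  shows "strong_limit (\<lambda>n. prod_list (map (b n) w)) (prod_list (map f w))"
  using assms by (induction w) (auto intro: strong_limit_const strong_limit_mult)

lemma strong_limit_positive:
  assumes "strong_limit A T" "\<And>n. positive_bop (A n)"
  shows "positive_bop T"
  unfolding positive_bop_def
proof
  fix x
  have "(\<lambda>n. inner (A n x) x) \<longlonglongrightarrow> inner (T x) x"
    by (intro tendsto_intros strong_limitD assms)
  then show "0 \<le> inner (T x) x"
    by (rule LIMSEQ_le_const) (use assms(2) in \<open>auto simp: positive_bop_def\<close>)
qed

lemma strong_limit_adj:
  assumes "strong_limit A T" "\<And>n. adj (A n) = A n"
  shows "adj T = T"
proof (rule bop_eqI)
  fix x
  have "inner y (adj T x) = inner y (T x)" for y
  proof (rule LIMSEQ_unique)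
    show "(\<lambda>n. inner (A n y) x) \<longlonglongrightarrow> inner y (adj T x)"
      unfolding inner_adj [symmetric] by (intro tendsto_intros strong_limitD assms)
    show "(\<lambda>n. inner (A n y) x) \<longlonglongrightarrow> inner y (T x)"
      unfolding inner_adj assms(2) by (intro tendsto_intros strong_limitD assms)
  qed
  then show "adj T x = T x"
    using vector_eq_ldot by blast
qed

lemma strong_limit_Cauchy:
  assumes C: "\<And>n x. norm (bop_apply (A n) x) \<le> C * norm x" and "\<And>x. Cauchy (\<lambda>n. A n x)"
  shows "\<exists>T. strong_limit A T"
proof -
  have "\<exists>l. (\<lambda>n. A n x) \<longlonglongrightarrow> l" for x
    using assms(2) [of x] Cauchy_convergent_iff convergent_def by blast
  then obtain f where f: "\<And>x. (\<lambda>n. A n x) \<longlonglongrightarrow> f x"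
    by metis
  have add: "f (x + y) = f x + f y" for x y
  proof (rule LIMSEQ_unique [OF f])
    have "(\<lambda>n. A n x + A n y) \<longlonglongrightarrow> f x + f y"
      by (intro tendsto_intros f)
    then show "(\<lambda>n. A n (x + y)) \<longlonglongrightarrow> f x + f y"
      by simp
  qed
  have scale: "f (c *\<^sub>C x) = c *\<^sub>C f x" for c x
  proof (rule LIMSEQ_unique [OF f])
    have "(\<lambda>n. c *\<^sub>C A n x) \<longlonglongrightarrow> c *\<^sub>C f x"
      by (intro tendsto_intros tendsto_scaleC f)
    then show "(\<lambda>n. A n (c *\<^sub>C x)) \<longlonglongrightarrow> c *\<^sub>C f x"
      by simp
  qed
  have "bounded_linear f"
  proof (rule bounded_linear_intro [of _ C])
    show "f (r *\<^sub>R x) = r *\<^sub>R f x" for r x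
      by (simp add: scaleR_scaleC scale)
    have "(\<lambda>n. norm (A n x)) \<longlonglongrightarrow> norm (f x)" for x
      by (intro tendsto_intros f)
    then show "norm (f x) \<le> norm x * C" for x
      by (rule LIMSEQ_le_const2) (use C in \<open>auto simp: mult.commute\<close>)
  qed (rule add)
  then have "bop_apply (Bop f) = f"
    by (simp add: Bop_inverse scale)
  then show ?thesis
    using f C by (intro exI [of _ "Bop f"] strong_limitI) auto
qed

lemma strong_limit_commute:
  assumes "strong_limit A T" "\<And>n. S * A n = A n * S"
  shows "S * T = T * S"
proof (rule bop_eqI)
  fix x
  have "(\<lambda>n. S (A n x)) \<longlonglongrightarrow> S (T x)"
    by (intro tendsto_intros strong_limitD assms)
  moreover have "S (A n x) = A n (S x)" for n
    using arg_cong [OF assms(2) [of n], of "\<lambda>B. B x"] by simp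
  ultimately have "(\<lambda>n. A n (S x)) \<longlonglongrightarrow> S (T x)"
    by simp
  then show "(S * T) x = (T * S) x"
    using LIMSEQ_unique [OF _ strong_limitD [OF assms(1)]] by simp
qed

text \<open>Commutation with a fixed operator survives strong limits, so the limit lies in the
  double commutant.\<close>

lemma von_neumann_algebra_strong_limit:
  assumes "von_neumann_algebra N" "strong_limit A T" "\<And>n. A n \<in> N"
  shows "T \<in> N"
proof -
  have "T \<in> commutant (commutant N)"
    using assms(3) unfolding commutant_def
    by (auto intro!: strong_limit_commute [OF assms(2)])
  then show ?thesis
    using assms(1) by (simp add: von_neumann_algebra_def)
qed

section \<open>Ultraweak continuity of the trace along bounded strongly convergent sequences\<close>

lemma strong_limit_ultraweak:
  assumes A: "strong_limit A T"
  shows "limitin ultraweak_topology A T sequentially"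
proof -
  obtain C where C: "C > 0" "\<And>n x. norm (A n x) \<le> C * norm x"
    using strong_limit_boundE A by metis
  have series: "(\<lambda>n. \<Sum>k. cinner (A n (x k)) (y k)) \<longlonglongrightarrow> (\<Sum>k. cinner (T (x k)) (y k))"
    if x: "summable (\<lambda>n. (norm (x n))\<^sup>2)" and y: "summable (\<lambda>n. (norm (y n))\<^sup>2)"
    for x y :: "nat \<Rightarrow> 'a"
  proof (rule tannerys_theorem [THEN conjunct2, THEN conjunct2])
    \<comment> \<open>Dominated convergence for series: the uniform bound on \<open>A n\<close> and
      \<open>2 * a * b \<le> a^2 + b^2\<close> give a majorant independent of
      \<open>n\<close>.\<close>
    show "summable (\<lambda>k. 2 * C * ((norm (x k))\<^sup>2 + (norm (y k))\<^sup>2))"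
      by (intro summable_mult summable_add x y)
    \<comment> \<open>Real and imaginary part are each a real inner product, so Cauchy-Schwarz is
      applied twice; this is the source of the factor 2.\<close>
    have bound: "cmod (cinner u v) \<le> 2 * (norm u * norm v)" for u v :: 'a
    proof -
      have "cmod (cinner u v) \<le> \<bar>Re (cinner u v)\<bar> + \<bar>Im (cinner u v)\<bar>"
        by (rule cmod_le)
      also have "\<dots> \<le> norm u * norm v + norm (- \<i> *\<^sub>C u) * norm v"
        unfolding Re_cinner Im_cinner by (intro add_mono Cauchy_Schwarz_ineq2)
      finally show ?thesis
        by (simp add: norm_scaleC)
    qed
    show "\<forall>\<^sub>F (k, n) in at_top \<times>\<^sub>F sequentially.
        cmod (cinner (A n (x k)) (y k)) \<le> 2 * C * ((norm (x k))\<^sup>2 + (norm (y k))\<^sup>2)"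
    proof (intro always_eventually allI, clarify)
      fix k n
      have "cmod (cinner (A n (x k)) (y k)) \<le> 2 * (norm (A n (x k)) * norm (y k))"
        by (rule bound)
      also have "\<dots> \<le> 2 * (C * norm (x k) * norm (y k))"
        by (intro mult_left_mono mult_right_mono C) auto
      also have "\<dots> = C * (2 * norm (x k) * norm (y k))"
        by simp
      also have "\<dots> \<le> C * ((norm (x k))\<^sup>2 + (norm (y k))\<^sup>2)"
        using C(1) by (intro mult_left_mono sum_squares_bound) auto
      also have "\<dots> \<le> 2 * C * ((norm (x k))\<^sup>2 + (norm (y k))\<^sup>2)"
        using C(1) by (intro mult_right_mono) auto
      finally show "cmod (cinner (A n (x k)) (y k)) \<le> 2 * C * ((norm (x k))\<^sup>2 + (norm (y k))\<^sup>2)" .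
    qed
    show "(\<lambda>n. cinner (A n (x k)) (y k)) \<longlonglongrightarrow> cinner (T (x k)) (y k)" for k
    proof (subst tendsto_complex_iff, intro conjI)
      show "(\<lambda>n. Re (cinner (A n (x k)) (y k))) \<longlonglongrightarrow> Re (cinner (T (x k)) (y k))"
        unfolding Re_cinner by (intro tendsto_intros strong_limitD A)
      show "(\<lambda>n. Im (cinner (A n (x k)) (y k))) \<longlonglongrightarrow> Im (cinner (T (x k)) (y k))"
        unfolding Im_cinner by (intro tendsto_intros tendsto_scaleC strong_limitD A)
    qed
  qed simp
  \<comment> \<open>The topology is given by generators, so convergence is checked by induction on
    how an open set is built from them.\<close>
  define \<B> where "\<B> = {{T :: 'a bop. (\<Sum>n. cinner (T (x n)) (y n)) \<in> U} | x y U.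
        summable (\<lambda>n. (norm (x n))\<^sup>2) \<and> summable (\<lambda>n. (norm (y n))\<^sup>2) \<and> open (U :: complex set)}"
  have top: "ultraweak_topology = topology_generated_by \<B>"
    unfolding ultraweak_topology_def \<B>_def ..
  have "\<forall>\<^sub>F n in sequentially. A n \<in> V" if "generate_topology_on \<B> V" "T \<in> V" for V
    using that
  proof (induction rule: generate_topology_on.induct)
    case (Basis V)
    then obtain x y U where V: "V = {T :: 'a bop. (\<Sum>n. cinner (T (x n)) (y n)) \<in> U}"
      and xy: "summable (\<lambda>n. (norm (x n))\<^sup>2)" "summable (\<lambda>n. (norm (y n))\<^sup>2)" "open U"
      unfolding \<B>_def by blast
    show ?case
      using topological_tendstoD [OF series [OF xy(1,2)] xy(3)] Basis V by simp
  next
    case (UN K)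
    then obtain k where "k \<in> K" "\<forall>\<^sub>F n in sequentially. A n \<in> k"
      by blast
    then show ?case
      by (auto elim: eventually_mono)
  qed (auto intro: eventually_conj)
  moreover have "T \<in> topspace ultraweak_topology"
  proof -
    have "UNIV \<in> \<B>"
      unfolding \<B>_def by (auto intro!: exI [of _ "\<lambda>_. 0"] exI [of _ UNIV])
    then show ?thesis
      unfolding top topology_generated_by_topspace by blast
  qed
  ultimately show ?thesis
    unfolding limitin_def top openin_topology_generated_by_iff by blast
qed

lemma (in tracial_wstar_probability_space) trace_strong_limit:
  assumes "strong_limit A T" "\<And>n. A n \<in> M"
  shows "(\<lambda>n. \<tau> (A n)) \<longlonglongrightarrow> \<tau> T"
proof -
  have "T \<in> M"
    using von_neumann_algebra_strong_limit vn assms by blast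
  then have "limitin (subtopology ultraweak_topology M) A T sequentially"
    using strong_limit_ultraweak [OF assms(1)] assms(2)
    by (auto simp: limitin_subtopology intro: always_eventually)
  then have "limitin euclidean (\<tau> \<circ> A) (\<tau> T) sequentially"
    by (rule continuous_map_limit [OF trace_ultraweak])
  then show ?thesis
    by (simp add: limitin_canonical_iff o_def)
qed

section \<open>Polynomials in a self-adjoint operator\<close>

text \<open>Horner evaluation, so that the algebraic laws follow by induction along
  \<open>pCons\<close>. Real coefficients keep the value self-adjoint for self-adjoint
  \<open>T\<close>.\<close>

definition op_poly :: "'a::complex_hilbert_space bop \<Rightarrow> real poly \<Rightarrow> 'a bop" where
  "op_poly T p = fold_coeffs (\<lambda>a S. complex_of_real a *\<^sub>C 1 + T * S) p 0"

lemma op_poly_0 [simp]: "op_poly T 0 = 0"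
  by (simp add: op_poly_def)

lemma op_poly_pCons [simp]: "op_poly T (pCons a p) = complex_of_real a *\<^sub>C 1 + T * op_poly T p"
  by (cases "p = 0 \<and> a = 0") (auto simp: op_poly_def)

lemma op_poly_1 [simp]: "op_poly T 1 = 1"
  by (simp add: one_pCons)

lemma op_poly_add [simp]: "op_poly T (p + q) = op_poly T p + op_poly T q"
  by (induction p q rule: poly_induct2) (simp_all add: scaleC_bop_distrib algebra_simps)

lemma op_poly_smult [simp]: "op_poly T (smult a p) = complex_of_real a *\<^sub>C op_poly T p"
  by (induction p) (simp_all add: scaleC_bop_distrib)

lemma op_poly_diff [simp]: "op_poly T (p - q) = op_poly T p - op_poly T q"
  using op_poly_add [of T "p - q" q] by (simp add: algebra_simps del: op_poly_add)

lemma op_poly_mult [simp]: "op_poly T (p * q) = op_poly T p * op_poly T q"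
  by (induction p) (simp_all add: algebra_simps)

lemma op_poly_power [simp]: "op_poly T (p ^ n) = op_poly T p ^ n"
  by (induction n) simp_all

lemma op_poly_commute: "op_poly T p * op_poly T q = op_poly T q * op_poly T p"
  by (metis mult.commute op_poly_mult)

lemma op_poly_commute_self: "T * op_poly T p = op_poly T p * T"
  using op_poly_commute [of T "[:0, 1:]" p] by simp

lemma adj_op_poly [simp]: "adj T = T \<Longrightarrow> adj (op_poly T p) = op_poly T p"
  by (induction p) (simp_all add: op_poly_commute_self)

lemma op_poly_mem: "star_subalgebra A \<Longrightarrow> T \<in> A \<Longrightarrow> op_poly T p \<in> A"
  by (induction p) (auto intro!: star_subalgebraD)

text \<open>The loss term shows that only vectors with \<open>S x = 0\<close> keep their norm.
  Dropping it gives the contraction fed to the square root iteration; keeping it identifies the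
  fixed vectors in \<open>strong_limit_range_poly\<close>.\<close>

lemma contraction_of_square:
  assumes S: "adj S = S" and c: "c > 0" "\<And>x. norm (bop_apply S x) \<le> c * norm x"
  shows "(norm ((1 - complex_of_real (1 / c\<^sup>2) *\<^sub>C (S * S)) x))\<^sup>2 \<le> (norm x)\<^sup>2 - (norm (S x))\<^sup>2 / c\<^sup>2"
proof -
  have "(norm (x - (1 / c\<^sup>2) *\<^sub>R S (S x)))\<^sup>2 =
      (norm x)\<^sup>2 - 2 / c\<^sup>2 * inner x (S (S x)) + (norm (S (S x)))\<^sup>2 / c^4"
    unfolding power2_norm_eq_inner
    by (simp add: inner_diff_left inner_diff_right inner_commute power2_eq_square power4_eq_xxxx
        algebra_simps)
  also have "inner x (S (S x)) = (norm (S x))\<^sup>2"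
    by (simp add: power2_norm_eq_inner inner_self_adjoint [OF S])
  also have "(norm (S (S x)))\<^sup>2 / c^4 \<le> (c * norm (S x))\<^sup>2 / c^4"
    by (intro divide_right_mono power_mono c) auto
  also have "\<dots> = (norm (S x))\<^sup>2 / c\<^sup>2"
    using c(1) by (simp add: field_simps power2_eq_square power4_eq_xxxx)
  finally show ?thesis
    by (simp add: scaleR_scaleC algebra_simps)
qed

section \<open>Distributions and positivity\<close>

context tracial_wstar_probability_space
begin

lemma star_subalgebra_M: "star_subalgebra M"
  using vn by (simp add: von_neumann_algebra_def)

lemmas M_mem = star_subalgebraD [OF star_subalgebra_M]

lemma trace_zero [simp]: "\<tau> 0 = 0"
  using trace_scaleC [OF M_mem(1), of 0] by simp

lemma trace_diff: "S \<in> M \<Longrightarrow> T \<in> M \<Longrightarrow> \<tau> (S - T) = \<tau> S - \<tau> T"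
  using trace_add [of "S - T" T] by (simp add: M_mem)

text \<open>The factor \<open>T ^ k\<close> strengthens the induction: peeling off a coefficient
  raises \<open>k\<close> by one.\<close>

lemma distribution_moment:
  assumes T: "T \<in> M" and \<nu>: "has_distribution \<tau> T \<nu>"
  shows "integrable \<nu> (\<lambda>t. t ^ k * poly p t) \<and>
    \<tau> (T ^ k * op_poly T p) = complex_of_real (\<integral>t. t ^ k * poly p t \<partial>\<nu>)"
proof (induction p arbitrary: k)
  case (pCons a p)
  have int: "integrable \<nu> (\<lambda>t. t ^ k)" and tau: "\<tau> (T ^ k) = complex_of_real (\<integral>t. t ^ k \<partial>\<nu>)"
    using \<nu> by (auto simp: has_distribution_def)
  have *: "t ^ k * poly (pCons a p) t = a * t ^ k + t ^ Suc k * poly p t" for t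
    by (simp add: algebra_simps)
  have "T ^ k * op_poly T (pCons a p) = complex_of_real a *\<^sub>C T ^ k + T ^ Suc k * op_poly T p"
    by (simp add: distrib_left power_Suc2 mult.assoc del: power_Suc)
  moreover have "T ^ k \<in> M" "T ^ Suc k * op_poly T p \<in> M"
    using T by (auto intro!: M_mem star_subalgebra_power op_poly_mem star_subalgebra_M)
  ultimately show ?case
    using pCons(2) [of "Suc k"] int tau unfolding *
    by (simp add: trace_add trace_scaleC M_mem)
qed simp

lemma distribution_poly:
  assumes "T \<in> M" and "has_distribution \<tau> T \<nu>"
  shows "integrable \<nu> (poly p)" "\<tau> (op_poly T p) = complex_of_real (\<integral>t. poly p t \<partial>\<nu>)"
  using distribution_moment [OF assms, of 0 p] by simp_all

text \<open>Total mass is the moment of order zero, and \<open>T ^ 0 = 1\<close> has trace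
  1.\<close>

lemma distribution_prob_space:
  assumes "has_distribution \<tau> T \<nu>"
  shows "finite_measure \<nu>" "measure \<nu> UNIV = 1"
proof -
  have "integrable \<nu> (\<lambda>t. 1 :: real)" "\<tau> 1 = complex_of_real (\<integral>t. 1 \<partial>\<nu>)"
    using conjunct2 [OF conjunct2 [OF assms [unfolded has_distribution_def]], THEN spec, of 0]
    by simp_all
  then have 1: "integrable \<nu> (\<lambda>t. 1 :: real)" "(\<integral>t. 1 \<partial>\<nu>) = (1 :: real)"
    by (simp_all only: trace_one complex_eq_iff one_complex.sel Re_complex_of_real)
  then show "finite_measure \<nu>"
    by (auto simp: integrable_iff_bounded intro: finite_measureI)
  have "space \<nu> = UNIV"
    using assms by (metis has_distribution_def sets_eq_imp_space_eq space_borel)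
  then show "measure \<nu> UNIV = 1"
    using 1(2) by simp
qed

lemma distribution_bounded:
  assumes "has_distribution \<tau> T \<nu>"
  shows "\<exists>R. AE t in \<nu>. \<bar>t\<bar> \<le> R"
proof -
  obtain K where K: "compact K" "emeasure \<nu> (- K) = 0" and s: "sets \<nu> = sets borel"
    using assms unfolding has_distribution_def by blast
  then obtain R where "\<And>t. t \<in> K \<Longrightarrow> \<bar>t\<bar> \<le> R"
    using compact_imp_bounded [OF K(1)] by (auto simp: bounded_iff)
  moreover have "- K \<in> null_sets \<nu>"
    using K compact_imp_closed [OF K(1)] by (intro null_setsI) (auto simp: s)
  ultimately show ?thesis
    by (intro exI [of _ R] AE_I' [of "- K"]) auto
qed

text \<open>One sequence of polynomials is evaluated on both sides: the trace is continuous along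
  the strong limit, and dominated convergence with the constant \<open>C\<close> handles the
  integrals, since the measure is finite.\<close>

lemma distribution_limit:
  assumes T: "T \<in> M" "has_distribution \<tau> T \<nu>" and A: "strong_limit (\<lambda>n. op_poly T (p n)) A"
    and lim: "AE t in \<nu>. (\<lambda>n. poly (p n) t) \<longlonglongrightarrow> f t" and f: "f \<in> borel_measurable borel"
    and bound: "\<And>n. AE t in \<nu>. \<bar>poly (p n) t\<bar> \<le> C"
  shows "\<tau> A = complex_of_real (\<integral>t. f t \<partial>\<nu>)"
proof (rule LIMSEQ_unique)
  have s: "sets \<nu> = sets borel"
    using T by (simp add: has_distribution_def)
  show "(\<lambda>n. \<tau> (op_poly T (p n))) \<longlonglongrightarrow> \<tau> A"
    using T by (intro trace_strong_limit A op_poly_mem star_subalgebra_M)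
  interpret finite_measure \<nu>
    by (rule distribution_prob_space) fact
  have "(\<lambda>n. \<integral>t. poly (p n) t \<partial>\<nu>) \<longlonglongrightarrow> (\<integral>t. f t \<partial>\<nu>)"
  proof (rule integral_dominated_convergence [where w = "\<lambda>_. C"])
    show "f \<in> borel_measurable \<nu>"
      using f measurable_cong_sets [OF s refl] by blast
  qed (use T lim bound distribution_poly(1) in \<open>auto intro: borel_measurable_integrable\<close>)
  then show "(\<lambda>n. \<tau> (op_poly T (p n))) \<longlonglongrightarrow> complex_of_real (\<integral>t. f t \<partial>\<nu>)"
    unfolding distribution_poly(2) [OF T] by (rule tendsto_of_real)
qed

end

section \<open>Square roots by a monotone polynomial iteration\<close>

primrec sqrt_iter :: "real \<Rightarrow> nat \<Rightarrow> real" where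
  "sqrt_iter x 0 = 0"
| "sqrt_iter x (Suc n) = (x + (sqrt_iter x n)\<^sup>2) / 2"

text \<open>Iterating \<open>r\<close> to \<open>(x + r^2) / 2\<close> has the fixed points
  \<open>1 - sqrt (1 - x)\<close> and \<open>1 + sqrt (1 - x)\<close>. As a polynomial in
  \<open>b\<close>, each iterate has nonnegative coefficients, so the scalar values at
  \<open>x = 1\<close> majorise what happens for an operator of norm at most 1.\<close>

primrec sqrt_poly :: "real poly \<Rightarrow> nat \<Rightarrow> real poly" where
  "sqrt_poly b 0 = 0"
| "sqrt_poly b (Suc n) = smult (1/2) (b + (sqrt_poly b n)\<^sup>2)"

lemma poly_sqrt_poly: "poly (sqrt_poly b n) t = sqrt_iter (poly b t) n"
  by (induction n) simp_all

lemma sqrt_iter_bounds: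
  assumes "0 \<le> x" "x \<le> 1"
  shows "0 \<le> sqrt_iter x n" "sqrt_iter x n \<le> 1" "sqrt_iter x n \<le> sqrt_iter x (Suc n)"
proof -
  have *: "0 \<le> sqrt_iter x n \<and> sqrt_iter x n \<le> 1" for n
  proof (induction n)
    case (Suc n)
    then have "(sqrt_iter x n)\<^sup>2 \<le> 1"
      by (simp add: power_le_one)
    then show ?case
      using assms by simp
  qed simp
  then show "0 \<le> sqrt_iter x n" "sqrt_iter x n \<le> 1"
    by auto
  show "sqrt_iter x n \<le> sqrt_iter x (Suc n)"
  proof (induction n)
    case (Suc n)
    then have "(sqrt_iter x n)\<^sup>2 \<le> (sqrt_iter x (Suc n))\<^sup>2"
      using * by (intro power_mono) auto
    then show ?case
      by simp
  qed (use assms in simp)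
qed

lemma sqrt_iter_tendsto:
  assumes x: "0 \<le> x" "x \<le> 1"
  shows "sqrt_iter x \<longlonglongrightarrow> 1 - sqrt (1 - x)"
proof -
  obtain L where L: "sqrt_iter x \<longlonglongrightarrow> L"
  proof (rule incseq_convergent)
    show "incseq (sqrt_iter x)"
      using sqrt_iter_bounds(3) [OF x] by (rule incseq_SucI)
    show "\<forall>i. sqrt_iter x i \<le> 1"
      using sqrt_iter_bounds(2) [OF x] by blast
  qed
  have "(\<lambda>n. sqrt_iter x (Suc n)) \<longlonglongrightarrow> (x + L\<^sup>2) / 2"
    by (simp, intro tendsto_intros L) simp
  then have "L = (x + L\<^sup>2) / 2"
    using L LIMSEQ_Suc LIMSEQ_unique by blast
  then have "(1 - L)\<^sup>2 = 1 - x"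
    by (simp add: power2_eq_square algebra_simps)
  \<comment> \<open>This selects the smaller fixed point.\<close>
  moreover have "L \<le> 1"
    using L by (rule LIMSEQ_le_const2) (use sqrt_iter_bounds [OF x] in auto)
  ultimately have "1 - L = sqrt (1 - x)"
    by (metis diff_ge_0_iff_ge real_sqrt_abs abs_of_nonneg)
  then have "L = 1 - sqrt (1 - x)"
    by simp
  then show ?thesis
    using L by simp
qed

text \<open>The scalar iteration at 1, called \<rho>, majorises both the iterates and their
  increments. The increments telescope and \<rho> converges, which makes the operator iterates
  Cauchy at every vector.\<close>

lemma strong_limit_sqrt_poly:
  assumes B: "\<And>x. norm (bop_apply (op_poly T b) x) \<le> norm x"
  shows "norm (op_poly T (sqrt_poly b n) x) \<le> norm x"
    and "\<exists>R. strong_limit (\<lambda>n. op_poly T (sqrt_poly b n)) R"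
proof -
  define R where "R n = op_poly T (sqrt_poly b n)" for n
  define \<rho> where "\<rho> = sqrt_iter 1"
  have \<rho>: "0 \<le> \<rho> n" "\<rho> n \<le> 1" "\<rho> n \<le> \<rho> (Suc n)" for n
    unfolding \<rho>_def by (intro sqrt_iter_bounds; simp)+
  have R: "norm (R n x) \<le> \<rho> n * norm x" for n x
  proof (induction n arbitrary: x)
    case (Suc n)
    have "norm (R n (R n x)) \<le> \<rho> n * (\<rho> n * norm x)"
      using Suc [of "R n x"] mult_left_mono [OF Suc [of x] \<rho>(1)] by (rule order_trans)
    then have "norm (op_poly T b x + R n (R n x)) \<le> (1 + (\<rho> n)\<^sup>2) * norm x"
      using B [of x] norm_triangle_ineq [of "op_poly T b x" "R n (R n x)"]
      by (simp add: algebra_simps power2_eq_square)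
    moreover have "R (Suc n) x = (1/2) *\<^sub>R (op_poly T b x + R n (R n x))"
      by (simp add: R_def power2_eq_square scaleR_scaleC)
    ultimately show ?case
      by (simp add: \<rho>_def)
  qed (simp add: R_def \<rho>_def)
  show "norm (op_poly T (sqrt_poly b n) x) \<le> norm x"
    using R [of n x] mult_right_mono [OF \<rho>(2) norm_ge_zero, of n x] by (simp add: R_def)
  have step: "norm (R (Suc n) x - R n x) \<le> (\<rho> (Suc n) - \<rho> n) * norm x" for n x
  proof (induction n arbitrary: x)
    case 0
    then show ?case
      using B [of x] by (simp add: R_def \<rho>_def norm_scaleC)
  next
    case (Suc n)
    define p where "p k = sqrt_poly b k" for k
    define y where "y = R (Suc n) x + R n x"
    \<comment> \<open>The difference of squares is factored among polynomials, where multiplication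
      commutes, and only then evaluated at \<open>T\<close>; the induction hypothesis is used at the
      vector \<open>y\<close>.\<close>
    have "p (Suc (Suc n)) - p (Suc n) = smult (1/2) ((p (Suc n) - p n) * (p (Suc n) + p n))"
    proof -
      have "p (Suc (Suc n)) - p (Suc n) = smult (1/2) ((p (Suc n))\<^sup>2 - (p n)\<^sup>2)"
        by (simp add: p_def smult_diff_right smult_add_right)
      then show ?thesis
        by (simp only: power2_eq_square square_diff_square_factored mult.commute)
    qed
    from arg_cong [OF this, of "\<lambda>q. op_poly T q x"]
    have "R (Suc (Suc n)) x - R (Suc n) x = (1/2) *\<^sub>R (R (Suc n) y - R n y)"
      by (simp only: op_poly_diff op_poly_smult op_poly_mult op_poly_add bop_apply_simps
          R_def p_def y_def scaleR_scaleC)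
    also have "norm \<dots> \<le> (1/2) * ((\<rho> (Suc n) - \<rho> n) * norm y)"
      using Suc [of y] by simp
    also have "norm y \<le> \<rho> (Suc n) * norm x + \<rho> n * norm x"
      unfolding y_def by (intro order_trans [OF norm_triangle_ineq] add_mono R)
    also have "(1/2) * ((\<rho> (Suc n) - \<rho> n) * (\<rho> (Suc n) * norm x + \<rho> n * norm x)) =
        ((\<rho> (Suc n))\<^sup>2 - (\<rho> n)\<^sup>2) / 2 * norm x"
      by (simp add: algebra_simps power2_eq_square)
    also have "((\<rho> (Suc n))\<^sup>2 - (\<rho> n)\<^sup>2) / 2 = \<rho> (Suc (Suc n)) - \<rho> (Suc n)"
      by (simp add: \<rho>_def field_simps)
    finally show ?case
      using \<rho>(3) [of n] by (simp add: mult_left_mono)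
  qed
  have diff: "norm (R m x - R n x) \<le> (\<rho> m - \<rho> n) * norm x" if "n \<le> m" for m n x
    using that
  proof (induction m rule: dec_induct)
    case (step m)
    have "norm (R (Suc m) x - R n x) \<le> norm (R (Suc m) x - R m x) + norm (R m x - R n x)"
      using norm_triangle_ineq [of "R (Suc m) x - R m x" "R m x - R n x"] by simp
    also have "\<dots> \<le> (\<rho> (Suc m) - \<rho> m) * norm x + (\<rho> m - \<rho> n) * norm x"
      by (intro add_mono step \<open>\<And>x n. norm (R (Suc n) x - R n x) \<le> _ n x\<close>)
    finally show ?case
      by (simp add: algebra_simps)
  qed simp
  have "\<rho> \<longlonglongrightarrow> 1"
    using sqrt_iter_tendsto [of 1] by (simp add: \<rho>_def)
  have "Cauchy (\<lambda>n. R n x)" for x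
  proof (rule CauchyI')
    fix e :: real assume e: "e > 0"
    have "(\<lambda>n. (1 - \<rho> n) * norm x) \<longlonglongrightarrow> (1 - 1) * norm x"
      by (intro tendsto_intros \<open>\<rho> \<longlonglongrightarrow> 1\<close>)
    then have "\<forall>\<^sub>F n in sequentially. (1 - \<rho> n) * norm x < e"
      using e by (intro order_tendstoD) auto
    then obtain N where N: "\<And>n. n \<ge> N \<Longrightarrow> (1 - \<rho> n) * norm x < e"
      by (auto simp: eventually_sequentially)
    have "norm (R n x - R m x) < e" if "N \<le> m" "m < n" for m n
    proof -
      have "norm (R n x - R m x) \<le> (\<rho> n - \<rho> m) * norm x"
        using that by (intro diff) auto
      also have "\<dots> \<le> (1 - \<rho> m) * norm x"
        using \<rho>(2) [of n] by (intro mult_right_mono) auto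
      also have "\<dots> < e"
        using that N by auto
      finally show ?thesis .
    qed
    then show "\<exists>N. \<forall>m\<ge>N. \<forall>n>m. dist (R m x) (R n x) < e"
      by (auto simp: dist_norm norm_minus_commute)
  qed
  moreover have "norm (R n x) \<le> 1 * norm x" for n x
    using order_trans [OF R mult_right_mono [OF \<rho>(2) norm_ge_zero]] .
  ultimately show "\<exists>R. strong_limit (\<lambda>n. op_poly T (sqrt_poly b n)) R"
    using strong_limit_Cauchy [of R 1] unfolding R_def by blast
qed

text \<open>
  The absolute value of \<open>S = p(T)\<close> is a strong limit of positive polynomials in \<open>T\<close>, and the
  trace of \<open>(\<bar>S\<bar> - S)\<^sup>2\<close> is the integral of \<open>(\<bar>p\<bar> - p)\<^sup>2\<close>.
\<close>

lemma (in tracial_wstar_probability_space) positive_op_poly: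
  assumes T: "T \<in> M" "adj T = T" and \<nu>: "has_distribution \<tau> T \<nu>"
    and p: "AE t in \<nu>. 0 \<le> poly p t"
  shows "positive_bop (op_poly T p)"
proof -
  define S where "S = op_poly T p"
  have S: "S \<in> M" "adj S = S"
    using T by (auto simp: S_def intro: op_poly_mem star_subalgebra_M)
  obtain c1 where c1: "\<And>x. norm (S x) \<le> c1 * norm x"
    using bop_bound [of S] by blast
  obtain R0 where R0: "AE t in \<nu>. \<bar>t\<bar> \<le> R0"
    using distribution_bounded [OF \<nu>] by blast
  have "bounded (poly p ` {-R0..R0})"
    by (intro compact_imp_bounded compact_continuous_image continuous_intros) auto
  then obtain c2 where c2: "\<And>t. \<bar>t\<bar> \<le> R0 \<Longrightarrow> \<bar>poly p t\<bar> \<le> c2"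
    by (force simp: bounded_iff abs_le_iff)
  \<comment> \<open>\<open>c\<close> bounds the operator, so that the iteration acts on a
    contraction, and bounds \<open>p\<close> on the support, so that the scalar iteration starts in
    the unit interval; the 1 makes it positive.\<close>
  define c where "c = max (max c1 c2) 1"
  have c: "c > 0" "\<And>x. norm (S x) \<le> c * norm x" "AE t in \<nu>. \<bar>poly p t\<bar> \<le> c"
  proof -
    show "norm (S x) \<le> c * norm x" for x
      by (rule order_trans [OF c1]) (auto simp: c_def intro: mult_right_mono)
    show "AE t in \<nu>. \<bar>poly p t\<bar> \<le> c"
      using R0 by eventually_elim (use c2 in \<open>force simp: c_def\<close>)
  qed (simp add: c_def)
  \<comment> \<open>Chosen so that \<open>c * sqrt (1 - b)\<close> is the absolute value of
    \<open>p\<close>, which is then the limit of \<open>a n\<close> on the support.\<close>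
  define b where "b = 1 - smult (1 / c\<^sup>2) (p * p)"
  have B: "norm (op_poly T b x) \<le> norm x" for x
  proof -
    have "(norm (op_poly T b x))\<^sup>2 \<le> (norm x)\<^sup>2 - (norm (S x))\<^sup>2 / c\<^sup>2"
      using contraction_of_square [OF S(2) c(1,2), of x] by (simp add: b_def S_def)
    also have "\<dots> \<le> (norm x)\<^sup>2"
      by simp
    finally show ?thesis
      by (rule power2_le_imp_le) simp
  qed
  define a where "a n = smult c (1 - sqrt_poly b n)" for n
  obtain R where R: "strong_limit (\<lambda>n. op_poly T (sqrt_poly b n)) R"
    using strong_limit_sqrt_poly(2) [OF B] by blast
  define A where "A = complex_of_real c *\<^sub>C (1 - R)"
  have A: "strong_limit (\<lambda>n. op_poly T (a n)) A"
    unfolding a_def A_def op_poly_smult op_poly_diff op_poly_1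
    by (intro strong_limit_scaleC strong_limit_diff strong_limit_const R tendsto_const)
  \<comment> \<open>The iterates are contractions, so 1 minus an iterate has a nonnegative
    form.\<close>
  have "positive_bop (op_poly T (a n))" for n
    unfolding positive_bop_def
  proof
    fix x
    have "inner (op_poly T (sqrt_poly b n) x) x \<le> norm (op_poly T (sqrt_poly b n) x) * norm x"
      by (rule norm_cauchy_schwarz)
    also have "\<dots> \<le> norm x * norm x"
      by (intro mult_right_mono strong_limit_sqrt_poly(1) B) auto
    finally have "0 \<le> c * (inner x x - inner (op_poly T (sqrt_poly b n) x) x)"
      using c(1) by (simp flip: power2_norm_eq_inner power2_eq_square)
    then show "0 \<le> inner (op_poly T (a n) x) x"
      by (simp add: a_def inner_diff_left right_diff_distrib flip: scaleR_scaleC)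
  qed
  with A have "positive_bop A"
    by (rule strong_limit_positive)
  have "A - S \<in> M"
    using von_neumann_algebra_strong_limit [OF vn A] S T
    by (auto intro!: M_mem op_poly_mem star_subalgebra_M)
  moreover have "adj (A - S) = A - S"
    using strong_limit_adj [OF A] T S by simp
  moreover have "\<tau> ((A - S) * (A - S)) = complex_of_real (\<integral>t. (\<lambda>_. 0) t \<partial>\<nu>)"
  proof (rule distribution_limit [OF T(1) \<nu>])
    show "strong_limit (\<lambda>n. op_poly T ((a n - p) * (a n - p))) ((A - S) * (A - S))"
      unfolding op_poly_mult op_poly_diff S_def
      by (intro strong_limit_mult strong_limit_diff A strong_limit_const)
    have val: "0 \<le> poly b t \<and> poly b t \<le> 1 \<and> c * sqrt (1 - poly b t) = \<bar>poly p t\<bar>"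
      if "\<bar>poly p t\<bar> \<le> c" for t
    proof -
      have "\<bar>poly p t\<bar>\<^sup>2 \<le> c\<^sup>2"
        using that by (intro power_mono) auto
      then have "(poly p t)\<^sup>2 / c\<^sup>2 \<le> 1"
        using c(1) by (simp add: divide_simps)
      moreover have "poly b t = 1 - (poly p t)\<^sup>2 / c\<^sup>2"
        by (simp add: b_def power2_eq_square)
      ultimately show ?thesis
        using c(1) by (simp add: real_sqrt_divide)
    qed
    show "AE t in \<nu>. (\<lambda>n. poly ((a n - p) * (a n - p)) t) \<longlonglongrightarrow> 0"
      using c(3) p
    proof eventually_elim
      case (elim t)
      have "(\<lambda>n. poly (a n - p) t) \<longlonglongrightarrow> c * (1 - (1 - sqrt (1 - poly b t))) - poly p t"
        unfolding a_def using val elim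
        unfolding poly_diff poly_smult poly_sqrt_poly poly_1
        by (intro tendsto_intros sqrt_iter_tendsto) auto
      then have "(\<lambda>n. poly (a n - p) t) \<longlonglongrightarrow> 0"
        using val elim by simp
      from tendsto_mult [OF this this] show ?case
        by simp
    qed
    show "AE t in \<nu>. \<bar>poly ((a n - p) * (a n - p)) t\<bar> \<le> (2 * c) * (2 * c)" for n
      using c(3)
    proof eventually_elim
      case (elim t)
      have "0 \<le> c * (1 - sqrt_iter (poly b t) n)" "c * (1 - sqrt_iter (poly b t) n) \<le> c * 1"
        using val [OF elim] c(1) sqrt_iter_bounds [of "poly b t" n]
        by (auto intro!: mult_nonneg_nonneg mult_left_mono simp del: mult_1_right)
      then have "\<bar>poly (a n - p) t\<bar> \<le> 2 * c"
        using elim by (simp add: a_def poly_sqrt_poly)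
      then show ?case
        using c(1) unfolding poly_mult abs_mult by (intro mult_mono) auto
    qed
  qed simp
  ultimately have "A - S = 0"
    by (intro trace_faithful) simp_all
  then show ?thesis
    using \<open>positive_bop A\<close> by (simp add: S_def)
qed

section \<open>Kernels of projections\<close>

text \<open>Kernels serve as coordinates on projections: they determine the projection, and suprema
  become plain intersections, whereas ranges would need closed spans.\<close>

definition bop_ker :: "'a::complex_hilbert_space bop \<Rightarrow> 'a set" where
  "bop_ker T = {x. T x = 0}"

lemma projectionsD:
  assumes "P \<in> projections N"
  shows "P \<in> N" "adj P = P" "P * P = P" "bop_apply P (P x) = P x"
proof -
  show *: "P \<in> N" "adj P = P" "P * P = P"
    using assms by (auto simp: projections_def)
  show "P (P x) = P x"
    using arg_cong [OF *(3), of "\<lambda>B. B x"] by simp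
qed

lemma projection_norm:
  assumes "P \<in> projections N"
  shows "norm (bop_apply P x) \<le> norm x"
proof -
  have "(norm (P x))\<^sup>2 \<le> norm (P x) * norm x"
    using norm_cauchy_schwarz [of "P x" x]
    by (simp add: norm_bop_self_adjoint_square projectionsD [OF assms])
  then show ?thesis
    by (cases "norm (P x) = 0") (auto simp: power2_eq_square)
qed

text \<open>\<open>x - Q x\<close> lies in the kernel of \<open>Q\<close>, hence of
  \<open>P\<close>; taking adjoints gives the second identity.\<close>

lemma projection_ker_subset:
  assumes P: "P \<in> projections N" and Q: "Q \<in> projections N'" and le: "bop_ker Q \<subseteq> bop_ker P"
  shows "P * Q = P" "Q * P = P"
proof -
  show *: "P * Q = P"
  proof (rule bop_eqI)
    fix x
    have "x - Q x \<in> bop_ker Q"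
      by (simp add: bop_ker_def projectionsD [OF Q])
    then have "x - Q x \<in> bop_ker P"
      using le by blast
    then show "(P * Q) x = P x"
      by (simp add: bop_ker_def)
  qed
  show "Q * P = P"
    using arg_cong [OF *, of adj] projectionsD [OF P] projectionsD [OF Q] by simp
qed

lemma projection_eqI:
  assumes "P \<in> projections N" "Q \<in> projections N'" "bop_ker P = bop_ker Q"
  shows "P = Q"
  using projection_ker_subset(1) [OF assms(1,2)] projection_ker_subset(2) [OF assms(2,1)] assms(3)
  by (metis order_refl)

lemma bop_ker_eq_orthogonal:
  assumes "adj T = T"
  shows "bop_ker T = {x. \<forall>y\<in>range (bop_apply T). inner x y = 0}"
proof -
  have "T x = 0" if "\<And>y. inner x (T y) = 0" for x
    using that [of "T x"] that by (metis inner_self_adjoint [OF assms] inner_eq_zero_iff)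
  then show ?thesis
    by (auto simp: bop_ker_def simp flip: inner_self_adjoint [OF assms])
qed

lemma orthogonal_closure:
  "(\<forall>y\<in>closure S. inner x y = 0) \<longleftrightarrow> (\<forall>y\<in>S. inner x (y::'a::real_inner) = 0)"
proof
  assume *: "\<forall>y\<in>S. inner x y = 0"
  have "closed {y. inner x y = 0}"
    by (intro closed_Collect_eq continuous_intros)
  then have "closure S \<subseteq> {y. inner x y = 0}"
    using * by (intro closure_minimal) auto
  then show "\<forall>y\<in>closure S. inner x y = 0"
    by blast
qed (use closure_subset in blast)

text \<open>Both kernels are orthogonal complements, and these do not distinguish a set from its
  closure.\<close>

lemma bop_ker_range_projection:
  assumes "adj T = T"
  shows "bop_ker (range_projection T) = bop_ker T"
  by (simp add: bop_ker_eq_orthogonal projectionsD [OF range_projection(1)] assms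
      range_projection(2) orthogonal_closure)

lemma bop_ker_Sup_projections:
  assumes \<P>: "\<P> \<subseteq> projections UNIV"
  shows "bop_ker (Sup_projections \<P>) = (\<Inter>P\<in>\<P>. bop_ker P)"
proof -
  define S where "S = (\<Union>P\<in>\<P>. range (bop_apply P))"
  \<comment> \<open>\<open>cinner\<close> replaces \<open>inner\<close> here: the vectors orthogonal
    to \<open>x\<close> for the real inner product alone need not be closed under complex
    scalars.\<close>
  have "csubspace {y. cinner x y = 0}" for x :: 'a
    using cinner_scaleC_right [of x 0 0]
    by (auto simp: csubspace_def cinner_add_right cinner_scaleC_right scaleC_zero_right)
  moreover have "cinner x y = 0" if P: "P \<in> \<P>" "x \<in> bop_ker P" "y \<in> range (bop_apply P)" for x y P
  proof -
    obtain z where "y = P z"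
      using P(3) by blast
    moreover have "cinner 0 z = 0"
      using cinner_scaleC_left [of 0 0 z] by (simp add: scaleC_zero_right)
    ultimately show ?thesis
      using P \<P> cinner_adj [of P x z] projectionsD(2) [of P UNIV] by (auto simp: bop_ker_def)
  qed
  ultimately have "csubspace hull S \<subseteq> {y. cinner x y = 0}" if "\<forall>P\<in>\<P>. x \<in> bop_ker P" for x
    using that by (intro hull_minimal) (auto simp: S_def)
  then have "cinner x y = 0" if "\<forall>P\<in>\<P>. x \<in> bop_ker P" "y \<in> csubspace hull S" for x y
    using that by blast
  then have "inner x y = 0" if "\<forall>P\<in>\<P>. x \<in> bop_ker P" "y \<in> csubspace hull S" for x y
    using that by (simp flip: Re_cinner)
  moreover have "x \<in> bop_ker P" if "\<forall>y\<in>csubspace hull S. inner x y = 0" "P \<in> \<P>" for x P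
  proof -
    have "range (bop_apply P) \<subseteq> csubspace hull S"
      using that hull_subset [of S csubspace] by (auto simp: S_def)
    then show ?thesis
      using that \<P> bop_ker_eq_orthogonal [OF projectionsD(2), of P UNIV] by auto
  qed
  ultimately have "(\<forall>y\<in>csubspace hull S. inner x y = 0) \<longleftrightarrow> (\<forall>P\<in>\<P>. x \<in> bop_ker P)" for x
    by blast
  then show ?thesis
    by (auto simp: bop_ker_eq_orthogonal [OF projectionsD(2) [OF Sup_projections(1)]]
        Sup_projections(2) orthogonal_closure S_def [symmetric])
qed

text \<open>By Pythagoras, the squared distance of \<open>P m x\<close> and \<open>P n x\<close> is
  the growth of a bounded monotone sequence, so the limit exists. It is \<open>Q x\<close> because
  the error lies in every kernel and the limit in the range of \<open>Q\<close>.\<close>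

lemma strong_limit_projections:
  assumes P: "\<And>n. P n \<in> projections N" and Q: "Q \<in> projections N'"
    and dec: "\<And>n. bop_ker (P (Suc n)) \<subseteq> bop_ker (P n)" and ker: "bop_ker Q = (\<Inter>n. bop_ker (P n))"
  shows "strong_limit P Q"
proof (rule strong_limitI [of _ 1])
  show "norm (P n x) \<le> 1 * norm x" for n x
    using projection_norm [OF P] by simp
  have "bop_ker (P m) \<subseteq> bop_ker (P n)" if "n \<le> m" for m n
    using lift_Suc_antimono_le [of "\<lambda>n. bop_ker (P n)", OF dec that] .
  then have PP: "P n (P m x) = P n x" "P m (P n x) = P n x" if "n \<le> m" for m n x
    using projection_ker_subset [OF P P, of m n] that bop_apply_simps(4) by metis+
  fix x
  have diff: "(norm (P m x - P n x))\<^sup>2 = (norm (P m x))\<^sup>2 - (norm (P n x))\<^sup>2" if "n \<le> m" for m n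
  proof -
    have "inner (P m x) (P n x) = inner (P n x) (P n x)"
      by (simp add: inner_self_adjoint [OF projectionsD(2) [OF P]] PP [OF that] projectionsD(4) [OF P])
    then show ?thesis
      by (simp add: power2_norm_eq_inner inner_diff_left inner_diff_right inner_commute)
  qed
  define r where "r n = (norm (P n x))\<^sup>2" for n
  have "incseq r"
  proof (rule incseq_SucI)
    show "r n \<le> r (Suc n)" for n
      using diff [of n "Suc n"] zero_le_power2 [of "norm (P (Suc n) x - P n x)"] by (simp add: r_def)
  qed
  moreover have "\<forall>n. r n \<le> (norm x)\<^sup>2"
    using projection_norm [OF P] by (auto simp: r_def intro: power_mono)
  ultimately obtain L where L: "r \<longlonglongrightarrow> L" "\<forall>n. r n \<le> L"
    by (rule incseq_convergent)
  have "Cauchy (\<lambda>n. P n x)"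
  proof (rule CauchyI')
    fix e :: real assume e: "e > 0"
    then have "\<forall>\<^sub>F n in sequentially. L - e\<^sup>2 < r n"
      by (intro order_tendstoD [OF L(1)]) auto
    then obtain k where k: "\<And>n. n \<ge> k \<Longrightarrow> L - e\<^sup>2 < r n"
      by (auto simp: eventually_sequentially)
    have "dist (P m x) (P n x) < e" if "k \<le> m" "m < n" for m n
    proof -
      have "(norm (P n x - P m x))\<^sup>2 < e\<^sup>2"
        using diff [of m n] that k [of m] L(2) [rule_format, of n] by (simp add: r_def)
      then show ?thesis
        using e by (simp add: dist_norm norm_minus_commute power_less_imp_less_base)
    qed
    then show "\<exists>k. \<forall>m\<ge>k. \<forall>n>m. dist (P m x) (P n x) < e"
      by blast
  qed
  then obtain z where z: "(\<lambda>n. P n x) \<longlonglongrightarrow> z"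
    using Cauchy_convergent_iff convergent_def by blast
  have "P k (x - z) = 0" for k
  proof -
    have "(\<lambda>n. P k (P n x)) \<longlonglongrightarrow> P k z"
      by (intro tendsto_intros z)
    moreover have "(\<lambda>n. P k (P n x)) \<longlonglongrightarrow> P k x"
      by (rule tendsto_eventually) (auto intro!: eventually_sequentiallyI [of k] simp: PP)
    ultimately show ?thesis
      using LIMSEQ_unique by fastforce
  qed
  then have "x - z \<in> (\<Inter>n. bop_ker (P n))"
    by (simp add: bop_ker_def del: bop_linear)
  then have "Q (x - z) = 0"
    unfolding ker [symmetric] by (simp only: bop_ker_def mem_Collect_eq)
  moreover have "Q z = z"
  proof (rule LIMSEQ_unique)
    show "(\<lambda>n. Q (P n x)) \<longlonglongrightarrow> Q z"
      by (intro tendsto_intros z)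
    have "Q (P n x) = P n x" for n
      using projection_ker_subset(2) [OF P Q, of n] ker bop_apply_simps(4) by (metis INF_lower UNIV_I)
    then show "(\<lambda>n. Q (P n x)) \<longlonglongrightarrow> z"
      using z by simp
  qed
  ultimately show "(\<lambda>n. P n x) \<longlonglongrightarrow> Q x"
    using z by simp
qed

section \<open>Range projections as limits of polynomials\<close>

definition range_poly :: "real \<Rightarrow> nat \<Rightarrow> real poly" where
  "range_poly c n = 1 - (1 - smult (1 / c\<^sup>2) [:0, 0, 1:]) ^ (2 * n)"

lemma poly_range_poly: "poly (range_poly c n) t = 1 - (1 - t\<^sup>2 / c\<^sup>2) ^ (2 * n)"
  by (simp add: range_poly_def power2_eq_square)

text \<open>\<open>B = 1 - T^2 / c^2\<close> is a self-adjoint contraction whose fixed vectors form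
  the kernel of \<open>T\<close>. Its even powers converge to the projection onto them, because the
  squared norms of the iterates decrease.\<close>

lemma strong_limit_range_poly:
  assumes T: "adj T = T" and c: "c > 0" "\<And>x. norm (bop_apply T x) \<le> c * norm x"
    and P: "P \<in> projections N" "bop_ker P = bop_ker T"
  shows "strong_limit (\<lambda>n. op_poly T (range_poly c n)) P"
proof -
  define b :: "real poly" where "b = 1 - smult (1 / c\<^sup>2) [:0, 0, 1:]"
  define B where "B = op_poly T b"
  have B_eq: "B = 1 - complex_of_real (1 / c\<^sup>2) *\<^sub>C (T * T)"
    by (simp add: B_def b_def)
  have adjB: "adj (B ^ n) = B ^ n" for n
    using adj_op_poly [OF T, of "b ^ n"] by (simp add: B_def)
  have B: "(norm (B x))\<^sup>2 \<le> (norm x)\<^sup>2 - (norm (T x))\<^sup>2 / c\<^sup>2" for x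
    unfolding B_eq by (rule contraction_of_square [OF T c])
  have Bc: "norm (B x) \<le> norm x" for x
  proof (rule power2_le_imp_le)
    show "(norm (B x))\<^sup>2 \<le> (norm x)\<^sup>2"
      by (rule order_trans [OF B]) simp
  qed simp
  have Bn: "norm ((B ^ n) x) \<le> norm x" for n x
    by (induction n) (auto intro: order_trans [OF Bc])
  have fixed: "B y = y" if "T y = 0" for y
    using that by (simp add: B_eq scaleC_zero_right)
  have "(\<lambda>n. (B ^ (2 * n)) x) \<longlonglongrightarrow> x - P x" for x
  proof -
    define r where "r n = (norm ((B ^ n) x))\<^sup>2" for n
    \<comment> \<open>Even exponents make the inner product of two iterates the squared norm of the
      iterate halfway between them.\<close>
    have ip: "inner ((B ^ (2 * m)) x) ((B ^ (2 * n)) x) = r (m + n)" for m n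
    proof -
      have "inner ((B ^ (2 * m)) x) ((B ^ (2 * n)) x) = inner ((B ^ (2 * n)) ((B ^ (2 * m)) x)) x"
        by (simp add: inner_self_adjoint [OF adjB])
      also have "(B ^ (2 * n)) ((B ^ (2 * m)) x) = (B ^ (m + n)) ((B ^ (m + n)) x)"
      proof -
        have "2 * n + 2 * m = (m + n) + (m + n)"
          by simp
        then have "B ^ (2 * n) * B ^ (2 * m) = B ^ (m + n) * B ^ (m + n)"
          by (simp only: power_add [symmetric])
        from arg_cong [OF this, of "\<lambda>S. S x"] show ?thesis
          by (simp only: bop_apply_simps)
      qed
      finally show ?thesis
        by (simp add: r_def norm_bop_self_adjoint_square [OF adjB])
    qed
    have diff: "(norm ((B ^ (2 * m)) x - (B ^ (2 * n)) x))\<^sup>2 = r (2 * m) + r (2 * n) - 2 * r (m + n)"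
      for m n
      unfolding power2_norm_eq_inner inner_diff_left inner_diff_right ip
      by (simp add: add.commute flip: mult_2)
    have "decseq r"
      by (rule decseq_SucI) (auto simp: r_def intro: power_mono Bc)
    moreover have "\<forall>n. 0 \<le> r n"
      by (simp add: r_def)
    ultimately obtain L where L: "r \<longlonglongrightarrow> L"
      using decseq_convergent by blast
    have "Cauchy (\<lambda>n. (B ^ (2 * n)) x)"
    proof (rule metric_CauchyI)
      fix e :: real assume e: "e > 0"
      then have "\<forall>\<^sub>F n in sequentially. dist (r n) L < e\<^sup>2 / 4"
        by (intro tendstoD [OF L]) auto
      then obtain k where k: "\<And>n. n \<ge> k \<Longrightarrow> \<bar>r n - L\<bar> < e\<^sup>2 / 4"
        by (auto simp: eventually_sequentially dist_real_def)
      have "dist ((B ^ (2 * m)) x) ((B ^ (2 * n)) x) < e" if "k \<le> m" "k \<le> n" for m n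
      proof -
        have "\<bar>r (2 * m) - L\<bar> < e\<^sup>2 / 4" "\<bar>r (2 * n) - L\<bar> < e\<^sup>2 / 4" "\<bar>r (m + n) - L\<bar> < e\<^sup>2 / 4"
          using that by (intro k; simp)+
        then have "(norm ((B ^ (2 * m)) x - (B ^ (2 * n)) x))\<^sup>2 < e\<^sup>2"
          unfolding diff abs_less_iff by linarith
        then show ?thesis
          using e by (simp add: dist_norm power_less_imp_less_base)
      qed
      then show "\<exists>k. \<forall>m\<ge>k. \<forall>n\<ge>k. dist ((B ^ (2 * m)) x) ((B ^ (2 * n)) x) < e"
        by blast
    qed
    then obtain z where z: "(\<lambda>n. (B ^ (2 * n)) x) \<longlonglongrightarrow> z"
      using Cauchy_convergent_iff convergent_def by blast
    \<comment> \<open>Consecutive even powers differ by \<open>B * B\<close>. As \<open>B\<close>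
      does not increase norms, \<open>B z\<close> has the norm of \<open>z\<close>, and the loss
      term forces \<open>T z = 0\<close>.\<close>
    have "B (B z) = z"
    proof (rule LIMSEQ_unique)
      show "(\<lambda>n. B (B ((B ^ (2 * n)) x))) \<longlonglongrightarrow> B (B z)"
        by (intro tendsto_intros z)
      show "(\<lambda>n. B (B ((B ^ (2 * n)) x))) \<longlonglongrightarrow> z"
        using LIMSEQ_Suc [OF z] by simp
    qed
    then have "norm z \<le> norm (B z)"
      using Bc [of "B z"] by simp
    then have "(norm z)\<^sup>2 \<le> (norm (B z))\<^sup>2"
      by (intro power_mono) auto
    then have "(norm (T z))\<^sup>2 / c\<^sup>2 \<le> 0"
      using B [of z] by linarith
    then have "z \<in> bop_ker P"
      unfolding P using c(1) by (simp add: divide_le_0_iff bop_ker_def)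
    \<comment> \<open>Every power of \<open>B\<close> fixes the kernel pointwise, so the component
      of \<open>x\<close> there never changes and \<open>x - z\<close> is orthogonal to it.\<close>
    moreover have "P (x - z) = x - z"
    proof -
      have orth: "inner (x - z) y = 0" if "y \<in> bop_ker P" for y
      proof -
        have "(B ^ n) y = y" for n
          using that fixed unfolding P by (induction n) (auto simp: bop_ker_def)
        then have "inner ((B ^ (2 * n)) x) y = inner x y" for n
          by (simp add: inner_self_adjoint [OF adjB])
        moreover have "(\<lambda>n. inner ((B ^ (2 * n)) x) y) \<longlonglongrightarrow> inner z y"
          by (intro tendsto_intros z)
        ultimately show ?thesis
          using LIMSEQ_unique [OF tendsto_const] by (fastforce simp: inner_diff_left)
      qed
      have "inner (x - z - P (x - z)) w = 0" for w
      proof -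
        have "w - P w \<in> bop_ker P"
          by (simp add: bop_ker_def projectionsD [OF P(1)])
        then have "inner (x - z) (w - P w) = 0"
          by (rule orth)
        then show ?thesis
          using inner_self_adjoint [OF projectionsD(2) [OF P(1)], of "x - z" w]
          by (simp only: inner_diff_left inner_diff_right)
      qed
      from this [of "x - z - P (x - z)"] show ?thesis
        by (simp only: inner_eq_zero_iff right_minus_eq)
    qed
    ultimately have "z = x - P x"
      by (simp add: bop_ker_def)
    then show ?thesis
      using z by simp
  qed
  then have "(\<lambda>n. x - (B ^ (2 * n)) x) \<longlonglongrightarrow> x - (x - P x)" for x
    by (intro tendsto_intros)
  moreover have "op_poly T (range_poly c n) = 1 - B ^ (2 * n)" for n
    by (simp only: range_poly_def op_poly_diff op_poly_1 op_poly_power B_def b_def)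
  moreover have "norm (x - (B ^ (2 * n)) x) \<le> 2 * norm x" for n x
    using norm_triangle_ineq4 [of x "(B ^ (2 * n)) x"] Bn [where n = "2 * n" and x = x] by linarith
  ultimately show ?thesis
    by (intro strong_limitI [of _ 2]) simp_all
qed

text \<open>The arbitrary lower bound \<open>R\<close> for \<open>c\<close> lets the same
  polynomials converge on the support of the distribution as well, as the computation of the trace
  requires.\<close>

lemma range_projection_limit:
  assumes T: "adj T = T"
  shows "\<exists>c>0. strong_limit (\<lambda>n. op_poly T (range_poly c n)) (range_projection T) \<and> R \<le> c"
proof -
  obtain c where c: "c > 0" "\<And>x. norm (T x) \<le> c * norm x"
    using bop_bound [of T] by blast
  define c' where "c' = max c R"
  have "c' > 0"
    using c by (simp add: c'_def)
  moreover have "norm (T x) \<le> c' * norm x" for x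
    by (rule order_trans [OF c(2)]) (auto simp: c'_def intro: mult_right_mono)
  moreover have "R \<le> c'"
    by (simp add: c'_def)
  ultimately show ?thesis
    using strong_limit_range_poly [OF T _ _ range_projection(1) bop_ker_range_projection [OF T]]
    by blast
qed

lemma range_projection_mem:
  assumes "von_neumann_algebra N" "T \<in> N" "adj T = T"
  shows "range_projection T \<in> N"
proof -
  obtain c where "strong_limit (\<lambda>n. op_poly T (range_poly c n)) (range_projection T)"
    using range_projection_limit [OF assms(3)] by blast
  then show ?thesis
    by (rule von_neumann_algebra_strong_limit [OF assms(1)])
      (use assms in \<open>auto simp: von_neumann_algebra_def intro: op_poly_mem\<close>)
qed

text \<open>On the support, the polynomials tend boundedly to the indicator of the nonzero reals, so
  the trace is the mass away from 0.\<close>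

lemma (in tracial_wstar_probability_space) trace_range_projection:
  assumes T: "T \<in> M" "adj T = T" and \<nu>: "has_distribution \<tau> T \<nu>"
  shows "\<tau> (range_projection T) = complex_of_real (1 - measure \<nu> {0})"
proof -
  obtain R where R: "AE t in \<nu>. \<bar>t\<bar> \<le> R"
    using distribution_bounded [OF \<nu>] by blast
  obtain c where c: "c > 0" "strong_limit (\<lambda>n. op_poly T (range_poly c n)) (range_projection T)"
    and "R \<le> c"
    using range_projection_limit [OF T(2)] by blast
  have val: "0 \<le> 1 - t\<^sup>2 / c\<^sup>2" "1 - t\<^sup>2 / c\<^sup>2 \<le> 1" if "\<bar>t\<bar> \<le> R" for t
  proof -
    have "\<bar>t\<bar>\<^sup>2 \<le> c\<^sup>2"
      using that \<open>R \<le> c\<close> by (intro power_mono) auto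
    then show "0 \<le> 1 - t\<^sup>2 / c\<^sup>2" "1 - t\<^sup>2 / c\<^sup>2 \<le> 1"
      using c(1) by (simp_all add: divide_simps)
  qed
  interpret finite_measure \<nu>
    using distribution_prob_space [OF \<nu>] by blast
  have s: "sets \<nu> = sets borel"
    using \<nu> by (simp add: has_distribution_def)
  have "\<tau> (range_projection T) = complex_of_real (\<integral>t. indicator (UNIV - {0}) t \<partial>\<nu>)"
  proof (rule distribution_limit [OF T(1) \<nu> c(2)])
    show "AE t in \<nu>. (\<lambda>n. poly (range_poly c n) t) \<longlonglongrightarrow> indicator (UNIV - {0}) t"
      using R
    proof eventually_elim
      case (elim t)
      show ?case
      proof (cases "t = 0")
        case False
        then have "(1 - t\<^sup>2 / c\<^sup>2)\<^sup>2 < 1"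
          using val [OF elim] c(1) by (intro power_less_one_iff [THEN iffD2]) auto
        then have "(\<lambda>n. ((1 - t\<^sup>2 / c\<^sup>2)\<^sup>2) ^ n) \<longlonglongrightarrow> 0"
          by (intro LIMSEQ_realpow_zero) auto
        then have "(\<lambda>n. 1 - ((1 - t\<^sup>2 / c\<^sup>2)\<^sup>2) ^ n) \<longlonglongrightarrow> 1 - 0"
          by (rule tendsto_diff [OF tendsto_const])
        moreover have "indicator (UNIV - {0}) t = (1 - 0 :: real)"
          using False by simp
        ultimately show ?thesis
          by (simp only: poly_range_poly power_mult)
      qed (simp add: poly_range_poly)
    qed
    show "AE t in \<nu>. \<bar>poly (range_poly c n) t\<bar> \<le> 1" for n
      using R
    proof eventually_elim
      case (elim t)
      then have "(1 - t\<^sup>2 / c\<^sup>2) ^ (2 * n) \<le> 1" "0 \<le> (1 - t\<^sup>2 / c\<^sup>2) ^ (2 * n)"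
        using val [OF elim] by (auto intro: power_le_one)
      then show ?case
        by (simp add: poly_range_poly)
    qed
  qed simp
  also have "(\<integral>t. indicator (UNIV - {0}) t \<partial>\<nu>) = measure \<nu> (UNIV - {0})"
    by (simp add: s)
  also have "\<dots> = measure \<nu> UNIV - measure \<nu> {0}"
    by (rule finite_measure_Diff) (auto simp: s)
  finally show ?thesis
    by (simp add: distribution_prob_space(2) [OF \<nu>])
qed

text \<open>
  The cubic inequalities say that \<open>l T\<^sup>2 \<le> T\<^sup>3 \<le> u T\<^sup>2\<close>, that is, \<open>l \<le> T \<le> u\<close> on the range of
  \<open>T\<close>; this avoids the spectral theorem.
\<close>

lemma (in tracial_wstar_probability_space) range_projection_bounds:
  assumes T: "T \<in> M" "adj T = T" and \<nu>: "has_distribution \<tau> T \<nu>"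
    and lu: "AE t in \<nu>. t = 0 \<or> l \<le> t \<and> t \<le> u"
  shows "l * inner (range_projection T x) x \<le> inner (T x) x"
    and "inner (T x) x \<le> u * inner (range_projection T x) x"
proof -
  define P where "P = range_projection T"
  have P: "P \<in> projections UNIV"
    unfolding P_def by (rule range_projection(1))
  \<comment> \<open>The cubic inequalities give both bounds on the range of \<open>T\<close>;
    closedness extends them to its closure, where \<open>P x\<close> lies.\<close>
  have closed: "closed {y. l * inner y y \<le> inner (T y) y \<and> inner (T y) y \<le> u * inner y y}"
    by (intro closed_Collect_conj closed_Collect_le continuous_intros
        bounded_linear.continuous_on [OF bounded_linear_bop])
  have "positive_bop (op_poly T [:0, 0, - l, 1:])" "positive_bop (op_poly T [:0, 0, u, - 1:])"
  proof (rule_tac [!] positive_op_poly [OF T \<nu>])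
    have [simp]: "poly [:0, 0, - l, 1:] t = t\<^sup>2 * (t - l)" "poly [:0, 0, u, - 1:] t = t\<^sup>2 * (u - t)" for t
      by (simp_all add: power2_eq_square algebra_simps)
    show "AE t in \<nu>. 0 \<le> poly [:0, 0, - l, 1:] t"
      using lu by eventually_elim (auto simp del: poly_pCons)
    show "AE t in \<nu>. 0 \<le> poly [:0, 0, u, - 1:] t"
      using lu by eventually_elim (auto simp del: poly_pCons)
  qed
  then have "l * inner (T y) (T y) \<le> inner (T (T y)) (T y) \<and>
      inner (T (T y)) (T y) \<le> u * inner (T y) (T y)" for y
    by (auto simp: positive_bop_def inner_self_adjoint [OF T(2), symmetric] algebra_simps
        inner_add_left inner_diff_left inner_left_distrib simp flip: scaleR_scaleC of_real_minus)
  then have "range (bop_apply T) \<subseteq> {y. l * inner y y \<le> inner (T y) y \<and> inner (T y) y \<le> u * inner y y}"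
    by auto
  then have "closure (range (bop_apply T)) \<subseteq>
      {y. l * inner y y \<le> inner (T y) y \<and> inner (T y) y \<le> u * inner y y}"
    using closed by (rule closure_minimal)
  moreover have "P x \<in> closure (range (bop_apply T))"
    unfolding P_def range_projection(2) [symmetric] by simp
  ultimately have "l * inner (P x) (P x) \<le> inner (T (P x)) (P x)"
    "inner (T (P x)) (P x) \<le> u * inner (P x) (P x)"
    by auto
  moreover have "inner (P x) (P x) = inner (P x) x"
    by (simp add: inner_self_adjoint [OF projectionsD(2) [OF P]] projectionsD [OF P] inner_commute)
  moreover have "T x = T (P x)"
  proof -
    have "x - P x \<in> bop_ker P"
      by (simp add: bop_ker_def projectionsD [OF P])
    then show ?thesis
      unfolding P_def bop_ker_range_projection [OF T(2)] by (simp add: bop_ker_def)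
  qed
  moreover have "inner (T (P x)) (P x) = inner (T x) x"
    using \<open>T x = T (P x)\<close> by (metis inner_self_adjoint [OF T(2)])
  ultimately show "l * inner (range_projection T x) x \<le> inner (T x) x"
    "inner (T x) x \<le> u * inner (range_projection T x) x"
    by (simp_all add: P_def)
qed

section \<open>Countable suprema and small partitions\<close>

lemma UN_prod_decode: "(\<Union>m. case prod_decode m of (n, k) \<Rightarrow> F n k) = (\<Union>n k. F n k)"
proof -
  have "F n k \<subseteq> (\<Union>m. case prod_decode m of (n, k) \<Rightarrow> F n k)" for n k
    by (rule UN_upper [where a = "prod_encode (n, k)", THEN order_trans [rotated]]) auto
  then show ?thesis
    by (auto split: prod.splits)
qed

text \<open>Maximise the measure of \<open>X \<inter> (\<Union>n. C n)\<close> over sequences in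
  \<Omega>. Merging countably many near-optimal sequences attains the supremum; as it is finite,
  adjoining one more \<omega> adds only a null set.\<close>

lemma essential_countable_union_finite:
  assumes \<Omega>: "\<Omega> \<subseteq> sets \<mu>" "\<Omega> \<noteq> {}" and X: "X \<in> sets \<mu>" "emeasure \<mu> X \<noteq> \<infinity>"
  shows "\<exists>C :: nat \<Rightarrow> 'x set. range C \<subseteq> \<Omega> \<and> (\<forall>\<omega>\<in>\<Omega>. X \<inter> (\<omega> - (\<Union>n. C n)) \<in> null_sets \<mu>)"
proof -
  define \<C> where "\<C> = {C :: nat \<Rightarrow> 'x set. range C \<subseteq> \<Omega>}"
  define f where "f C = emeasure \<mu> (X \<inter> (\<Union>n. C n))" for C :: "nat \<Rightarrow> 'x set"
  have sets: "C n \<in> sets \<mu>" if "C \<in> \<C>" for C n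
    using that \<Omega> by (auto simp: \<C>_def)
  have "f ` \<C> \<noteq> {}"
    using \<Omega>(2) by (auto simp: \<C>_def)
  from ennreal_Sup_countable_SUP [OF this] obtain g :: "nat \<Rightarrow> ennreal"
    where g: "range g \<subseteq> f ` \<C>" "Sup (f ` \<C>) = (SUP n. g n)"
    by blast
  then have "\<forall>n. \<exists>C\<in>\<C>. g n = f C"
    by blast
  then obtain C where C: "\<And>n. C n \<in> \<C>" "\<And>n. g n = f (C n)"
    by metis
  define D where "D m = (case prod_decode m of (n, k) \<Rightarrow> C n k)" for m
  have D: "D \<in> \<C>"
    using C(1) by (force simp: \<C>_def D_def split: prod.splits)
  have UD: "(\<Union>m. D m) = (\<Union>n k. C n k)"
    unfolding D_def by (rule UN_prod_decode)
  have "g n \<le> f D" for n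
    unfolding C(2) f_def
  proof (rule emeasure_mono)
    show "X \<inter> (\<Union>k. C n k) \<subseteq> X \<inter> (\<Union>m. D m)"
      unfolding UD by blast
    show "X \<inter> (\<Union>m. D m) \<in> sets \<mu>"
      using sets [OF D] X by (intro sets.Int sets.countable_UN) auto
  qed
  then have "Sup (f ` \<C>) \<le> f D"
    unfolding g(2) by (intro SUP_least)
  then have max: "f E \<le> f D" if "E \<in> \<C>" for E
    using Sup_upper [of "f E" "f ` \<C>"] that by (meson imageI order_trans)
  have "X \<inter> (\<omega> - (\<Union>n. D n)) \<in> null_sets \<mu>" if \<omega>: "\<omega> \<in> \<Omega>" for \<omega>
  proof -
    have meas: "X \<inter> (\<omega> - (\<Union>n. D n)) \<in> sets \<mu>" "X \<inter> (\<Union>n. D n) \<in> sets \<mu>"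
      using sets [OF D] \<omega> \<Omega> X by auto
    have "case_nat \<omega> D \<in> \<C>"
      using D \<omega> by (force simp: \<C>_def split: nat.splits)
    then have "f (case_nat \<omega> D) \<le> f D"
      by (rule max)
    moreover have "f (case_nat \<omega> D) = f D + emeasure \<mu> (X \<inter> (\<omega> - (\<Union>n. D n)))"
    proof -
      have "(\<Union>n. case_nat \<omega> D n) = \<omega> \<union> (\<Union>n. D n)"
        by (auto split: nat.splits)
      then have "X \<inter> (\<Union>n. case_nat \<omega> D n) = (X \<inter> (\<Union>n. D n)) \<union> (X \<inter> (\<omega> - (\<Union>n. D n)))"
        by blast
      then show ?thesis
        unfolding f_def using meas by (auto intro!: plus_emeasure [symmetric])
    qed
    moreover have "f D < \<infinity>"
    proof -
      have "f D \<le> emeasure \<mu> X"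
        unfolding f_def using X by (intro emeasure_mono) auto
      then show ?thesis
        using X(2) by (auto simp: less_top intro: order_le_less_trans)
    qed
    ultimately have "emeasure \<mu> (X \<inter> (\<omega> - (\<Union>n. D n))) = 0"
      using ennreal_add_left_cancel_le [of "f D" _ 0] by (auto simp: less_top)
    then show ?thesis
      using meas by blast
  qed
  then show ?thesis
    using D by (auto simp: \<C>_def)
qed

text \<open>Modulo null sets, every family has the same least upper bound as some sequence in it,
  which brings arbitrary suprema within reach of countable additivity.\<close>

lemma essential_countable_union:
  assumes "sigma_finite_measure \<mu>" and \<Omega>: "\<Omega> \<subseteq> sets \<mu>" "\<Omega> \<noteq> {}"
  shows "\<exists>C :: nat \<Rightarrow> 'x set. range C \<subseteq> \<Omega> \<and> (\<forall>\<omega>\<in>\<Omega>. \<omega> - (\<Union>n. C n) \<in> null_sets \<mu>)"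
proof -
  obtain X :: "nat \<Rightarrow> 'x set" where X: "range X \<subseteq> sets \<mu>" "(\<Union>i. X i) = space \<mu>"
    "\<And>i. emeasure \<mu> (X i) \<noteq> \<infinity>"
    using sigma_finite_measure.sigma_finite [OF assms(1)] by metis
  have "\<forall>i. \<exists>C :: nat \<Rightarrow> 'x set. range C \<subseteq> \<Omega> \<and>
      (\<forall>\<omega>\<in>\<Omega>. X i \<inter> (\<omega> - (\<Union>n. C n)) \<in> null_sets \<mu>)"
    using X \<Omega> by (intro allI essential_countable_union_finite) auto
  then obtain C :: "nat \<Rightarrow> nat \<Rightarrow> 'x set" where C: "\<And>i. range (C i) \<subseteq> \<Omega>"
    "\<And>i \<omega>. \<omega> \<in> \<Omega> \<Longrightarrow> X i \<inter> (\<omega> - (\<Union>n. C i n)) \<in> null_sets \<mu>"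
    by metis
  define D where "D m = (case prod_decode m of (n, k) \<Rightarrow> C n k)" for m
  have UD: "(\<Union>m. D m) = (\<Union>n k. C n k)"
    unfolding D_def by (rule UN_prod_decode)
  have D: "range D \<subseteq> \<Omega>"
    using C(1) by (force simp: D_def split: prod.splits)
  have "\<omega> - (\<Union>n. D n) \<in> null_sets \<mu>" if \<omega>: "\<omega> \<in> \<Omega>" for \<omega>
  proof (rule null_sets_subset)
    show "(\<Union>i. X i \<inter> (\<omega> - (\<Union>n. C i n))) \<in> null_sets \<mu>"
      using C(2) [OF \<omega>] by (rule null_sets_UN)
    show "\<omega> - (\<Union>n. D n) \<in> sets \<mu>"
      using D \<omega> \<Omega> by (intro sets.Diff sets.countable_UN) auto
    show "\<omega> - (\<Union>n. D n) \<subseteq> (\<Union>i. X i \<inter> (\<omega> - (\<Union>n. C i n)))"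
    proof
      fix t assume t: "t \<in> \<omega> - (\<Union>n. D n)"
      have "\<omega> \<subseteq> (\<Union>i. X i)"
        unfolding X(2) using \<omega> \<Omega> sets.sets_into_space by blast
      then obtain i where "t \<in> X i"
        using t by blast
      moreover have "t \<notin> (\<Union>n. C i n)"
        using t unfolding UD by blast
      ultimately show "t \<in> (\<Union>i. X i \<inter> (\<omega> - (\<Union>n. C i n)))"
        using t by blast
    qed
  qed
  with D show ?thesis
    by blast
qed

section \<open>Partitions into small sets for a measure without atoms\<close>

lemma finite_sets_eq_fmeasurable: "finite_sets \<mu> = fmeasurable \<mu>"
  by (auto simp: finite_sets_def fmeasurable_def)

text \<open>A set that is no atom has a part of positive, strictly smaller measure; this part or its
  complement has at most half the measure.\<close>

lemma no_atoms_halve: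
  assumes "\<nexists>A. measure_atom \<mu> A" and E: "E \<in> fmeasurable \<mu>" "0 < measure \<mu> E"
  shows "\<exists>B\<in>fmeasurable \<mu>. B \<subseteq> E \<and> 0 < measure \<mu> B \<and> measure \<mu> B \<le> measure \<mu> E / 2"
proof -
  have em: "emeasure \<mu> B = ennreal (measure \<mu> B)" if "B \<in> fmeasurable \<mu>" for B
    using that by (intro emeasure_eq_measure2) (auto simp: fmeasurable_def less_top)
  have sub: "B \<in> fmeasurable \<mu>" if "B \<in> sets \<mu>" "B \<subseteq> E" for B
    using that E by (meson fmeasurableI2)
  have "\<not> measure_atom \<mu> E"
    using assms by blast
  then obtain B where B: "B \<in> sets \<mu>" "B \<subseteq> E" "emeasure \<mu> B < emeasure \<mu> E" "emeasure \<mu> B \<noteq> 0"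
    using E by (auto simp: measure_atom_def em)
  have f: "B \<in> fmeasurable \<mu>" "E - B \<in> fmeasurable \<mu>"
    using B E by (auto intro!: sub fmeasurable.Diff)
  have "0 < measure \<mu> B" "measure \<mu> B < measure \<mu> E"
    using B f E by (auto simp: em ennreal_less_iff zero_less_measure_iff)
  moreover have "measure \<mu> (E - B) = measure \<mu> E - measure \<mu> B"
    using B E by (intro measure_Diff) (auto simp: fmeasurable_def less_top)
  ultimately have "0 < measure \<mu> B \<and> measure \<mu> B \<le> measure \<mu> E / 2 \<or>
      0 < measure \<mu> (E - B) \<and> measure \<mu> (E - B) \<le> measure \<mu> E / 2"
    by linarith
  then show ?thesis
    using B(2) f by blast
qed

lemma no_atoms_small:
  assumes "\<nexists>A. measure_atom \<mu> A" and E: "E \<in> fmeasurable \<mu>" "0 < measure \<mu> E" and \<delta>: "\<delta> > 0"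
  shows "\<exists>B\<in>fmeasurable \<mu>. B \<subseteq> E \<and> 0 < measure \<mu> B \<and> measure \<mu> B < \<delta>"
proof -
  have *: "\<exists>B\<in>fmeasurable \<mu>. B \<subseteq> E \<and> 0 < measure \<mu> B \<and> measure \<mu> B \<le> measure \<mu> E / 2 ^ n" for n
  proof (induction n)
    case (Suc n)
    then obtain B where B: "B \<in> fmeasurable \<mu>" "B \<subseteq> E" "0 < measure \<mu> B"
      "measure \<mu> B \<le> measure \<mu> E / 2 ^ n"
      by blast
    obtain D where D: "D \<in> fmeasurable \<mu>" "D \<subseteq> B" "0 < measure \<mu> D" "measure \<mu> D \<le> measure \<mu> B / 2"
      using no_atoms_halve [OF assms(1) B(1,3)] by blast
    have "measure \<mu> D \<le> measure \<mu> E / 2 ^ Suc n"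
      using D(4) B(4) by simp
    then show ?case
      using B D by blast
  qed (use E in auto)
  obtain n where "measure \<mu> E / \<delta> < 2 ^ n"
    using real_arch_pow [of 2] by auto
  then have "measure \<mu> E / 2 ^ n < \<delta>"
    using \<delta> by (simp add: field_simps)
  with * [of n] show ?thesis
    by (meson order_le_less_trans)
qed

text \<open>An essential union of all small subsets of \<alpha> leaves a remainder without small
  subsets of positive measure, and \<open>no_atoms_small\<close> makes such a remainder
  null.\<close>

lemma no_atoms_partition:
  assumes "sigma_finite_measure \<mu>" "\<nexists>A. measure_atom \<mu> A" and \<alpha>: "\<alpha> \<in> fmeasurable \<mu>" and \<delta>: "\<delta> > 0"
  shows "\<exists>A :: nat \<Rightarrow> 'x set. disjoint_family A \<and> range A \<subseteq> fmeasurable \<mu> \<and> (\<Union>n. A n) = \<alpha> \<and>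
    (\<forall>n. measure \<mu> (A n) < \<delta>)"
proof -
  define \<Omega> where "\<Omega> = {B \<in> fmeasurable \<mu>. B \<subseteq> \<alpha> \<and> measure \<mu> B < \<delta>}"
  have "\<Omega> \<subseteq> sets \<mu>" "{} \<in> \<Omega>"
    using \<delta> by (auto simp: \<Omega>_def)
  then have "\<exists>C :: nat \<Rightarrow> 'x set. range C \<subseteq> \<Omega> \<and> (\<forall>\<omega>\<in>\<Omega>. \<omega> - (\<Union>n. C n) \<in> null_sets \<mu>)"
    by (intro essential_countable_union assms) auto
  then obtain C :: "nat \<Rightarrow> 'x set" where C: "range C \<subseteq> \<Omega>"
    "\<And>\<omega>. \<omega> \<in> \<Omega> \<Longrightarrow> \<omega> - (\<Union>n. C n) \<in> null_sets \<mu>"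
    by blast
  have Cs: "C n \<in> fmeasurable \<mu>" "C n \<subseteq> \<alpha>" "measure \<mu> (C n) < \<delta>" for n
    using C(1) by (auto simp: \<Omega>_def)
  define rest where "rest = \<alpha> - (\<Union>n. C n)"
  have rest: "rest \<in> fmeasurable \<mu>"
    unfolding rest_def using Cs(1) \<alpha> by (intro fmeasurableI2 [OF \<alpha>] sets.Diff sets.countable_UN) auto
  have "measure \<mu> rest = 0"
  proof (rule ccontr)
    assume "measure \<mu> rest \<noteq> 0"
    then have "0 < measure \<mu> rest"
      by (simp add: zero_less_measure_iff)
    then obtain B where B: "B \<in> fmeasurable \<mu>" "B \<subseteq> rest" "0 < measure \<mu> B" "measure \<mu> B < \<delta>"
      using no_atoms_small [OF assms(2) rest _ \<delta>] by blast
    then have "B - (\<Union>n. C n) \<in> null_sets \<mu>"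
      by (intro C) (auto simp: \<Omega>_def rest_def)
    moreover have "B - (\<Union>n. C n) = B"
      using B(2) by (auto simp: rest_def)
    ultimately show False
      using B(3) by (auto simp: measure_def)
  qed
  \<comment> \<open>The null remainder becomes piece 0, so that the pieces cover \<alpha>
    exactly.\<close>
  define D where "D = case_nat rest C"
  have D: "D n \<in> fmeasurable \<mu>" "measure \<mu> (D n) < \<delta>" "D n \<subseteq> \<alpha>" for n
    using rest Cs \<open>measure \<mu> rest = 0\<close> \<delta> by (auto simp: D_def rest_def split: nat.splits)
  have UD: "(\<Union>n. D n) = \<alpha>"
  proof
    have "rest \<subseteq> (\<Union>n. D n)"
      by (rule UN_upper [of 0 UNIV, THEN order_trans [rotated]]) (auto simp: D_def)
    moreover have "C n \<subseteq> (\<Union>n. D n)" for n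
      by (rule UN_upper [of "Suc n" UNIV, THEN order_trans [rotated]]) (auto simp: D_def)
    ultimately show "\<alpha> \<subseteq> (\<Union>n. D n)"
      by (auto simp: rest_def)
  qed (use D in blast)
  have ds: "disjointed D n \<in> fmeasurable \<mu>" for n
  proof (rule fmeasurableI2 [OF D(1) disjointed_subset])
    show "disjointed D n \<in> sets \<mu>"
      using sets.range_disjointed_sets [of D \<mu>] D(1) by auto
  qed
  have "measure \<mu> (disjointed D n) < \<delta>" for n
  proof (rule le_less_trans [OF _ D(2)])
    show "measure \<mu> (disjointed D n) \<le> measure \<mu> (D n)"
      using ds [of n] by (intro measure_mono_fmeasurable disjointed_subset D(1)) auto
  qed
  then show ?thesis
    using ds UD by (intro exI [of _ "disjointed D"]) (auto simp: disjoint_family_disjointed UN_disjointed_eq)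
qed

section \<open>The free Poisson distribution\<close>

lemma AE_free_poisson:
  "AE t in free_poisson a. t = 0 \<or> (1 - sqrt a)\<^sup>2 \<le> t \<and> t \<le> (1 + sqrt a)\<^sup>2"
proof (rule AE_I')
  define N where "N = - ({0} \<union> {(1 - sqrt a)\<^sup>2..(1 + sqrt a)\<^sup>2})"
  have N: "N \<in> sets borel"
    by (auto simp: N_def)
  have "free_poisson_density a t = 0" if "t \<in> N" for t
    using that by (auto simp: N_def free_poisson_density_def)
  then have zero: "ennreal (free_poisson_density a t) * indicator N t = 0" for t
    by (simp split: split_indicator)
  have "emeasure (free_poisson a) N = 0"
    unfolding emeasure_free_poisson [OF N] zero by (simp add: N_def)
  then show "N \<in> null_sets (free_poisson a)"
    using N by (intro null_setsI) (simp_all add: sets_free_poisson)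
  show "{t \<in> space (free_poisson a). \<not> (t = 0 \<or> (1 - sqrt a)\<^sup>2 \<le> t \<and> t \<le> (1 + sqrt a)\<^sup>2)} \<subseteq> N"
    by (auto simp: N_def)
qed

text \<open>A single point is Lebesgue-null, so only the atom of the distribution
  contributes.\<close>

lemma measure_free_poisson_0: "measure (free_poisson a) {0} = max 0 (1 - a)"
proof -
  have "(\<integral>\<^sup>+t\<in>{0}. ennreal (free_poisson_density a t) \<partial>lborel) = (\<integral>\<^sup>+(t::real). 0 \<partial>lborel)"
    by (intro nn_integral_cong_AE AE_I' [of "{0}"]) (auto split: split_indicator_asm)
  then show ?thesis
    by (simp add: measure_def emeasure_free_poisson)
qed

section \<open>Kernels of the free Poisson process\<close>

locale free_poisson_ranges = tracial_wstar_probability_space M \<tau>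
  for M :: "'a::complex_hilbert_space bop set" and \<tau> +
  fixes \<mu> :: "'x measure" and \<pi> Y :: "'x set \<Rightarrow> 'a bop"
  assumes sigma_finite: "sigma_finite_measure \<mu>"
    and process: "free_poisson_process \<mu> M \<tau> \<pi>"
    and Y_finite: "\<alpha> \<in> finite_sets \<mu> \<Longrightarrow> Y \<alpha> = range_projection (\<pi> \<alpha>)"
    and Y_infinite: "\<lbrakk>\<omega> \<in> sets \<mu>; emeasure \<mu> \<omega> = \<infinity>\<rbrakk> \<Longrightarrow>
      Y \<omega> = Sup_projections (Y ` {\<alpha> \<in> finite_sets \<mu>. \<alpha> \<subseteq> \<omega>})"
begin

lemma process_mem: "\<alpha> \<in> finite_sets \<mu> \<Longrightarrow> \<pi> \<alpha> \<in> M"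
  and process_adj: "\<alpha> \<in> finite_sets \<mu> \<Longrightarrow> adj (\<pi> \<alpha>) = \<pi> \<alpha>"
  and process_distribution:
    "\<alpha> \<in> finite_sets \<mu> \<Longrightarrow> has_distribution \<tau> (\<pi> \<alpha>) (free_poisson (measure \<mu> \<alpha>))"
  using process by (auto simp: free_poisson_process_def self_adjoints_def)

lemma process_disjoint:
  assumes A: "disjoint_family A" "range A \<subseteq> finite_sets \<mu>" and U: "(\<Union>n. A n) \<in> finite_sets \<mu>"
  shows "(\<lambda>n. \<pi> (A n) x) sums \<pi> (\<Union>n. A n) x" "freely_independent \<tau> UNIV (\<lambda>n. \<pi> (A n))"
proof -
  have "(\<Sum>n. emeasure \<mu> (A n)) = emeasure \<mu> (\<Union>n. A n)"
    using A by (intro suminf_emeasure) (auto simp: finite_sets_def)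
  then have "(\<Sum>n. emeasure \<mu> (A n)) < \<infinity>"
    using U by (simp add: finite_sets_def)
  then show "(\<lambda>n. \<pi> (A n) x) sums \<pi> (\<Union>n. A n) x" "freely_independent \<tau> UNIV (\<lambda>n. \<pi> (A n))"
    using process A unfolding free_poisson_process_def by blast+
qed

lemma process_positive:
  assumes "\<alpha> \<in> finite_sets \<mu>"
  shows "positive_bop (\<pi> \<alpha>)"
proof -
  have "positive_bop (op_poly (\<pi> \<alpha>) [:0, 1:])"
  proof (rule positive_op_poly [OF process_mem process_adj process_distribution, OF assms assms assms])
    show "AE t in free_poisson (measure \<mu> \<alpha>). 0 \<le> poly [:0, 1:] t"
      using AE_free_poisson
      by eventually_elim (use zero_le_power2 order_trans in \<open>auto; blast\<close>)
  qed
  then show ?thesis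
    by simp
qed

lemma Y_projection: "\<omega> \<in> sets \<mu> \<Longrightarrow> Y \<omega> \<in> projections UNIV"
  by (cases "emeasure \<mu> \<omega> = \<infinity>")
    (auto simp: Y_infinite Y_finite finite_sets_def less_top Sup_projections range_projection)

lemma ker_Y_finite: "\<alpha> \<in> finite_sets \<mu> \<Longrightarrow> bop_ker (Y \<alpha>) = bop_ker (\<pi> \<alpha>)"
  by (simp add: Y_finite bop_ker_range_projection process_adj)

lemma ker_Y_disjoint_UN:
  fixes A :: "nat \<Rightarrow> 'x set"
  assumes A: "disjoint_family A" "range A \<subseteq> finite_sets \<mu>" and U: "(\<Union>n. A n) \<in> finite_sets \<mu>"
  shows "bop_ker (Y (\<Union>n. A n)) = (\<Inter>n. bop_ker (Y (A n)))"
proof -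
  have fin: "A n \<in> finite_sets \<mu>" for n
    using A by auto
  note sums = process_disjoint(1) [OF A U]
  have "\<pi> (A n) x = 0" if "\<pi> (\<Union>n. A n) x = 0" for n x
  proof (rule positive_bop_ker)
    have "(\<lambda>n. inner (\<pi> (A n) x) x) sums inner (\<pi> (\<Union>n. A n) x) x"
      by (rule bounded_linear.sums [OF bounded_linear_inner_left sums])
    then have s: "(\<lambda>n. inner (\<pi> (A n) x) x) sums 0"
      by (simp add: that)
    have pos: "0 \<le> inner (\<pi> (A n) x) x" for n
      using process_positive [OF fin] by (simp add: positive_bop_def)
    have "(\<Sum>n. inner (\<pi> (A n) x) x) = 0"
      using s sums_unique by metis
    then show "inner (\<pi> (A n) x) x = 0"
      using suminf_eq_zero_iff [of "\<lambda>n. inner (\<pi> (A n) x) x"] pos s sums_summable by blast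
  qed (use process_positive process_adj fin in auto)
  moreover have "\<pi> (\<Union>n. A n) x = 0" if "\<And>n. \<pi> (A n) x = 0" for x
    using sums_unique2 [OF sums [of x]] that by simp
  ultimately show ?thesis
    unfolding ker_Y_finite [OF fin] ker_Y_finite [OF U] unfolding bop_ker_def by auto
qed

lemma ker_Y_finite_mono:
  assumes "\<alpha> \<in> finite_sets \<mu>" "\<beta> \<in> finite_sets \<mu>" "\<alpha> \<subseteq> \<beta>"
  shows "bop_ker (Y \<beta>) \<subseteq> bop_ker (Y \<alpha>)"
proof -
  \<comment> \<open>\<open>binaryset\<close> pads the two pieces with empty sets to a sequence, the
    form in which additivity is available.\<close>
  define A where "A = binaryset \<alpha> (\<beta> - \<alpha>)"
  have "disjoint_family A" "range A \<subseteq> finite_sets \<mu>" "(\<Union>n. A n) = \<beta>"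
    using assms unfolding A_def
    by (auto simp: disjoint_family_on_def binaryset_def UN_binaryset_eq finite_sets_eq_fmeasurable
        range_binaryset_eq intro: fmeasurable.Diff)
  then have "bop_ker (Y \<beta>) = (\<Inter>n. bop_ker (Y (A n)))"
    using ker_Y_disjoint_UN [of A] assms by simp
  moreover have "A 0 = \<alpha>"
    by (simp add: A_def binaryset_def)
  ultimately show ?thesis
    by blast
qed

text \<open>A single formula for both clauses in the definition of \<open>Y\<close>: for \<omega> of
  finite measure, \<omega> itself is the largest index and monotonicity applies.\<close>

lemma ker_Y:
  assumes \<omega>: "\<omega> \<in> sets \<mu>"
  shows "bop_ker (Y \<omega>) = (\<Inter>\<alpha>\<in>{\<alpha> \<in> finite_sets \<mu>. \<alpha> \<subseteq> \<omega>}. bop_ker (Y \<alpha>))"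
proof (cases "emeasure \<mu> \<omega> = \<infinity>")
  case True
  have "Y ` {\<alpha> \<in> finite_sets \<mu>. \<alpha> \<subseteq> \<omega>} \<subseteq> projections UNIV"
    by (auto simp: finite_sets_def intro: Y_projection)
  then show ?thesis
    by (subst Y_infinite [OF \<omega> True]) (simp add: bop_ker_Sup_projections)
next
  case False
  then have "\<omega> \<in> finite_sets \<mu>"
    using \<omega> by (simp add: finite_sets_def less_top)
  then show ?thesis
    using ker_Y_finite_mono by blast
qed

lemma ker_Y_mono:
  assumes "A \<in> sets \<mu>" "B \<in> sets \<mu>" "A \<subseteq> B"
  shows "bop_ker (Y B) \<subseteq> bop_ker (Y A)"
  unfolding ker_Y [OF assms(1)] ker_Y [OF assms(2)] using assms(3) by blast

text \<open>The sets may overlap and have infinite measure, so the union is tested on its finite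
  subsets \<alpha>, each cut into the disjoint pieces
  \<open>\<alpha> \<inter> disjointed B n\<close>.\<close>

lemma ker_Y_UN:
  fixes B :: "nat \<Rightarrow> 'x set"
  assumes B: "range B \<subseteq> sets \<mu>"
  shows "bop_ker (Y (\<Union>n. B n)) = (\<Inter>n. bop_ker (Y (B n)))"
proof
  have UB: "(\<Union>n. B n) \<in> sets \<mu>"
    using B by blast
  show "bop_ker (Y (\<Union>n. B n)) \<subseteq> (\<Inter>n. bop_ker (Y (B n)))"
    using B UB by (intro INF_greatest ker_Y_mono) auto
  show "(\<Inter>n. bop_ker (Y (B n))) \<subseteq> bop_ker (Y (\<Union>n. B n))"
    unfolding ker_Y [OF UB]
  proof (rule INF_greatest)
    fix \<alpha> assume "\<alpha> \<in> {\<alpha> \<in> finite_sets \<mu>. \<alpha> \<subseteq> (\<Union>n. B n)}"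
    then have \<alpha>: "\<alpha> \<in> finite_sets \<mu>" "\<alpha> \<subseteq> (\<Union>n. B n)"
      by auto
    define A where "A n = \<alpha> \<inter> disjointed B n" for n
    have "disjointed B n \<in> sets \<mu>" for n
      using sets.range_disjointed_sets [OF B] by auto
    then have A: "A n \<in> finite_sets \<mu>" for n
      using \<alpha>(1) unfolding A_def finite_sets_eq_fmeasurable by (intro fmeasurable_Int_fmeasurable)
    have "A n \<subseteq> B n" for n
      using disjointed_subset [of B n] by (auto simp: A_def)
    then have "bop_ker (Y (B n)) \<subseteq> bop_ker (Y (A n))" for n
      using A [of n] B by (intro ker_Y_mono) (auto simp: finite_sets_def)
    then have "(\<Inter>n. bop_ker (Y (B n))) \<subseteq> (\<Inter>n. bop_ker (Y (A n)))"
      by blast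
    also have "\<dots> = bop_ker (Y (\<Union>n. A n))"
    proof (rule ker_Y_disjoint_UN [symmetric])
      show "disjoint_family A"
        using disjoint_family_disjointed [of B] by (auto simp: A_def disjoint_family_on_def)
      show "(\<Union>n. A n) \<in> finite_sets \<mu>"
        using \<alpha> by (simp add: A_def UN_disjointed_eq Int_absorb2 flip: Int_UN_distrib)
    qed (use A in auto)
    also have "(\<Union>n. A n) = \<alpha>"
      using \<alpha>(2) by (simp add: A_def UN_disjointed_eq Int_absorb2 flip: Int_UN_distrib)
    finally show "(\<Inter>n. bop_ker (Y (B n))) \<subseteq> bop_ker (Y \<alpha>)" .
  qed
qed

section \<open>Trace, null sets and suprema for the extremal process\<close>

lemma Y_finite_mem: "\<alpha> \<in> finite_sets \<mu> \<Longrightarrow> Y \<alpha> \<in> M"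
  by (simp add: Y_finite range_projection_mem [OF vn] process_mem process_adj)

lemma trace_Y_finite:
  assumes "\<alpha> \<in> finite_sets \<mu>"
  shows "\<tau> (Y \<alpha>) = complex_of_real (min (measure \<mu> \<alpha>) 1)"
  using trace_range_projection [OF process_mem process_adj process_distribution, OF assms assms assms]
  by (auto simp: Y_finite [OF assms] measure_free_poisson_0 min_def max_def)

text \<open>\<open>Y Z\<close> is a projection of trace 0, so faithfulness makes it vanish. This is
  how null sets become invisible to \<open>Y\<close>.\<close>

lemma ker_Y_null:
  assumes "Z \<in> null_sets \<mu>"
  shows "bop_ker (Y Z) = UNIV"
proof -
  have Z: "Z \<in> finite_sets \<mu>" "measure \<mu> Z = 0"
    using assms by (auto simp: finite_sets_def measure_def)
  note P = projectionsD [OF Y_projection [of Z]]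
  have "adj (Y Z) * Y Z = Y Z"
    using P assms by (simp add: null_setsD2)
  then have "\<tau> (adj (Y Z) * Y Z) = 0"
    using trace_Y_finite [OF Z(1)] Z(2) by simp
  then have "Y Z = 0"
    using trace_faithful [OF Y_finite_mem [OF Z(1)]] by simp
  then show ?thesis
    by (simp add: bop_ker_def)
qed

lemma ker_Y_null_subset:
  assumes AB: "A \<in> sets \<mu>" "B \<in> sets \<mu>" "null_subset \<mu> A B"
  shows "bop_ker (Y B) \<subseteq> bop_ker (Y A)"
proof -
  have null: "A - B \<in> null_sets \<mu>"
    using AB by (simp add: null_subset_def)
  have "bop_ker (Y (\<Union>n. binaryset B (A - B) n)) = (\<Inter>n. bop_ker (Y (binaryset B (A - B) n)))"
    using AB by (intro ker_Y_UN) (auto simp: range_binaryset_eq)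
  \<comment> \<open>Besides \<open>A - B\<close>, the empty sets that pad the sequence also have the
    full kernel.\<close>
  also have "\<dots> \<supseteq> bop_ker (Y B)"
    using ker_Y_null [OF null] ker_Y_null [of "{}"] by (auto simp: binaryset_def)
  finally have "bop_ker (Y B) \<subseteq> bop_ker (Y (A \<union> B))"
    by (simp add: UN_binaryset_eq Un_commute)
  also have "\<dots> \<subseteq> bop_ker (Y A)"
    using AB by (intro ker_Y_mono) auto
  finally show ?thesis .
qed

lemma Y_respects_null: "Y respects null_equiv \<mu>"
proof (rule congruentI)
  fix A B assume "(A, B) \<in> null_equiv \<mu>"
  then have AB: "A \<in> sets \<mu>" "B \<in> sets \<mu>" and null: "sym_diff A B \<in> null_sets \<mu>"
    by (auto simp: null_equiv_def)
  have "null_subset \<mu> A B" "null_subset \<mu> B A"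
    unfolding null_subset_def using AB by (auto intro!: null_sets_subset [OF null])
  then show "Y A = Y B"
    using ker_Y_null_subset AB by (intro projection_eqI [OF Y_projection Y_projection] equalityI) auto
qed

text \<open>The union of a sequence in \<Omega> that covers every member up to null sets is an upper
  bound, so it contains \<alpha> up to a null set; \<open>ker_Y_UN\<close> then gives the nontrivial
  inclusion.\<close>

lemma Y_lub:
  assumes \<Omega>: "\<Omega> \<subseteq> sets \<mu>" "\<Omega> \<noteq> {}" and lub: "null_lub \<mu> \<Omega> \<alpha>"
  shows "Y \<alpha> = Sup_projections (Y ` \<Omega>)"
proof (rule projection_eqI [OF Y_projection Sup_projections(1)])
  show \<alpha>: "\<alpha> \<in> sets \<mu>"
    using lub by (simp add: null_lub_def)
  obtain C :: "nat \<Rightarrow> 'x set" where C: "range C \<subseteq> \<Omega>"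
    "\<And>\<omega>. \<omega> \<in> \<Omega> \<Longrightarrow> null_subset \<mu> \<omega> (\<Union>n. C n)"
    using essential_countable_union [OF sigma_finite \<Omega>] unfolding null_subset_def by blast
  have Cs: "range C \<subseteq> sets \<mu>"
    using C \<Omega> by blast
  then have "null_subset \<mu> \<alpha> (\<Union>n. C n)"
    using lub C(2) unfolding null_lub_def by blast
  then have "bop_ker (Y (\<Union>n. C n)) \<subseteq> bop_ker (Y \<alpha>)"
    using \<alpha> Cs by (intro ker_Y_null_subset) auto
  then have "(\<Inter>\<omega>\<in>\<Omega>. bop_ker (Y \<omega>)) \<subseteq> bop_ker (Y \<alpha>)"
    using C(1) unfolding ker_Y_UN [OF Cs] by blast
  moreover have "bop_ker (Y \<alpha>) \<subseteq> bop_ker (Y \<omega>)" if "\<omega> \<in> \<Omega>" for \<omega>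
    using that \<alpha> \<Omega> lub by (intro ker_Y_null_subset) (auto simp: null_lub_def)
  moreover have "Y ` \<Omega> \<subseteq> projections UNIV"
    using \<Omega> Y_projection by blast
  ultimately show "bop_ker (Y \<alpha>) = bop_ker (Sup_projections (Y ` \<Omega>))"
    by (simp add: bop_ker_Sup_projections) blast
qed

text \<open>Truncation to an exhausting sequence of finite sets carries membership in
  \<open>M\<close>, the trace and freeness from finite to infinite measure.\<close>

lemma Y_exhaustion:
  obtains X :: "nat \<Rightarrow> 'x set"
  where "range X \<subseteq> sets \<mu>" "\<And>\<omega> n. \<omega> \<in> sets \<mu> \<Longrightarrow> \<omega> \<inter> X n \<in> finite_sets \<mu>"
    "\<And>\<omega>. \<omega> \<in> sets \<mu> \<Longrightarrow> (\<lambda>n. emeasure \<mu> (\<omega> \<inter> X n)) \<longlonglongrightarrow> emeasure \<mu> \<omega>"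
    "\<And>\<omega>. \<omega> \<in> sets \<mu> \<Longrightarrow> strong_limit (\<lambda>n. Y (\<omega> \<inter> X n)) (Y \<omega>)"
proof -
  obtain X :: "nat \<Rightarrow> 'x set" where X: "range X \<subseteq> sets \<mu>" "(\<Union>i. X i) = space \<mu>"
    "\<And>i. emeasure \<mu> (X i) \<noteq> \<infinity>" "incseq X"
    using sigma_finite_measure.sigma_finite_incseq [OF sigma_finite] by metis
  show ?thesis
  proof (rule that [OF X(1)])
    fix \<omega> assume \<omega>: "\<omega> \<in> sets \<mu>"
    have range: "range (\<lambda>n. \<omega> \<inter> X n) \<subseteq> sets \<mu>"
      using X \<omega> by auto
    have Un: "(\<Union>n. \<omega> \<inter> X n) = \<omega>"
      using X(2) sets.sets_into_space [OF \<omega>] by blast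
    have inc: "incseq (\<lambda>n. \<omega> \<inter> X n)"
      using X(4) by (auto simp: incseq_def)
    show "\<omega> \<inter> X n \<in> finite_sets \<mu>" for n
    proof -
      have "X n \<in> fmeasurable \<mu>"
        using X by (auto simp: fmeasurable_def less_top)
      then show ?thesis
        using \<omega> unfolding finite_sets_eq_fmeasurable by (auto intro: fmeasurableI2)
    qed
    show "(\<lambda>n. emeasure \<mu> (\<omega> \<inter> X n)) \<longlonglongrightarrow> emeasure \<mu> \<omega>"
      using Lim_emeasure_incseq [OF range inc] unfolding Un .
    show "strong_limit (\<lambda>n. Y (\<omega> \<inter> X n)) (Y \<omega>)"
    proof (rule strong_limit_projections)
      show "Y (\<omega> \<inter> X n) \<in> projections UNIV" for n
        using range by (intro Y_projection) auto
      show "bop_ker (Y (\<omega> \<inter> X (Suc n))) \<subseteq> bop_ker (Y (\<omega> \<inter> X n))" for n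
        using range inc by (intro ker_Y_mono) (auto simp: incseq_Suc_iff)
      show "bop_ker (Y \<omega>) = (\<Inter>n. bop_ker (Y (\<omega> \<inter> X n)))"
        using ker_Y_UN [OF range] by (simp only: Un)
    qed (rule Y_projection [OF \<omega>])
  qed
qed

lemma Y_mem_projections:
  assumes \<omega>: "\<omega> \<in> sets \<mu>"
  shows "Y \<omega> \<in> projections M"
proof -
  obtain X :: "nat \<Rightarrow> 'x set" where X: "range X \<subseteq> sets \<mu>"
    "\<And>\<omega> n. \<omega> \<in> sets \<mu> \<Longrightarrow> \<omega> \<inter> X n \<in> finite_sets \<mu>"
    "\<And>\<omega>. \<omega> \<in> sets \<mu> \<Longrightarrow> (\<lambda>n. emeasure \<mu> (\<omega> \<inter> X n)) \<longlonglongrightarrow> emeasure \<mu> \<omega>"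
    "\<And>\<omega>. \<omega> \<in> sets \<mu> \<Longrightarrow> strong_limit (\<lambda>n. Y (\<omega> \<inter> X n)) (Y \<omega>)"
    by (rule Y_exhaustion) (rule that)
  have "Y \<omega> \<in> M"
    by (rule von_neumann_algebra_strong_limit [OF vn X(4) Y_finite_mem]) (intro X \<omega>)+
  then show ?thesis
    using Y_projection [OF \<omega>] by (simp add: projections_def)
qed

lemma trace_Y:
  assumes \<omega>: "\<omega> \<in> sets \<mu>"
  shows "\<tau> (Y \<omega>) = complex_of_real (enn2real (min (emeasure \<mu> \<omega>) 1))"
proof -
  have fin: "\<tau> (Y \<alpha>) = complex_of_real (enn2real (min (emeasure \<mu> \<alpha>) 1))" if "\<alpha> \<in> finite_sets \<mu>" for \<alpha>
  proof -
    have "emeasure \<mu> \<alpha> = ennreal (measure \<mu> \<alpha>)"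
      using that by (intro emeasure_eq_ennreal_measure) (auto simp: finite_sets_def less_top)
    then have "min (emeasure \<mu> \<alpha>) 1 = ennreal (min (measure \<mu> \<alpha>) 1)"
      by (simp add: min_def)
    then show ?thesis
      using trace_Y_finite [OF that] by simp
  qed
  show ?thesis
  proof (cases "emeasure \<mu> \<omega> = \<infinity>")
    case True
    obtain X :: "nat \<Rightarrow> 'x set" where X: "range X \<subseteq> sets \<mu>"
      "\<And>\<omega> n. \<omega> \<in> sets \<mu> \<Longrightarrow> \<omega> \<inter> X n \<in> finite_sets \<mu>"
      "\<And>\<omega>. \<omega> \<in> sets \<mu> \<Longrightarrow> (\<lambda>n. emeasure \<mu> (\<omega> \<inter> X n)) \<longlonglongrightarrow> emeasure \<mu> \<omega>"
      "\<And>\<omega>. \<omega> \<in> sets \<mu> \<Longrightarrow> strong_limit (\<lambda>n. Y (\<omega> \<inter> X n)) (Y \<omega>)"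
      by (rule Y_exhaustion) (rule that)
    have "(\<lambda>n. \<tau> (Y (\<omega> \<inter> X n))) \<longlonglongrightarrow> \<tau> (Y \<omega>)"
      by (intro trace_strong_limit X Y_finite_mem \<omega>)
    \<comment> \<open>Once a truncation has measure above 1, its trace is exactly 1.\<close>
    moreover have "\<forall>\<^sub>F n in sequentially. 1 < emeasure \<mu> (\<omega> \<inter> X n)"
      using X(3) [OF \<omega>] unfolding True by (rule order_tendstoD) simp
    then have "(\<lambda>n. \<tau> (Y (\<omega> \<inter> X n))) \<longlonglongrightarrow> 1"
      by (intro tendsto_eventually) (auto elim!: eventually_mono simp: fin [OF X(2) [OF \<omega>]] min_def)
    ultimately show ?thesis
      using LIMSEQ_unique True by fastforce
  qed (use \<omega> fin in \<open>auto simp: finite_sets_def less_top\<close>)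
qed

end

section \<open>Freeness\<close>

text \<open>Idempotence closes the span of 1 and \<open>P\<close> under products.\<close>

lemma star_subalgebra_hull_projection:
  assumes P: "P \<in> projections N" and a: "a \<in> star_subalgebra hull {P}"
  shows "\<exists>c d. a = c *\<^sub>C 1 + d *\<^sub>C P"
proof -
  define A where "A = {c *\<^sub>C 1 + d *\<^sub>C P | c d. True}"
  have mem: "c *\<^sub>C 1 + d *\<^sub>C P \<in> A" for c d
    by (auto simp: A_def)
  have "star_subalgebra A"
    unfolding star_subalgebra_def
  proof (intro conjI ballI allI)
    show "1 \<in> A"
      using mem [of 1 0] by simp
    fix S assume "S \<in> A"
    then obtain c d where S: "S = c *\<^sub>C 1 + d *\<^sub>C P"
      by (auto simp: A_def)
    show "adj S \<in> A"
      using mem [of "cnj c" "cnj d"] by (simp add: S projectionsD [OF P])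
    show "e *\<^sub>C S \<in> A" for e
      using mem [of "e * c" "e * d"] by (simp add: S scaleC_bop_distrib)
    fix T assume "T \<in> A"
    then obtain c' d' where T: "T = c' *\<^sub>C 1 + d' *\<^sub>C P"
      by (auto simp: A_def)
    show "S + T \<in> A"
      using mem [of "c + c'" "d + d'"] by (simp add: S T scaleC_bop_distrib ac_simps)
    show "S * T \<in> A"
      using mem [of "c * c'" "c * d' + d * c' + d * d'"]
      by (simp add: S T scaleC_bop_distrib distrib_left distrib_right projectionsD [OF P] ac_simps)
  qed
  moreover have "P \<in> A"
    using mem [of 0 1] by simp
  ultimately have "star_subalgebra hull {P} \<subseteq> A"
    by (intro hull_minimal) auto
  then show ?thesis
    using a by (auto simp: A_def)
qed

text \<open>
  A centred element of the algebra of a projection \<open>P\<close> is a multiple of \<open>P - \<tau>(P)\<close>, so every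
  centred word in the \<open>P k\<close> is the strong limit of centred words in the \<open>X n k\<close>.
\<close>

lemma (in tracial_wstar_probability_space) freely_independent_limit:
  assumes free: "\<And>n. free_subalgebras \<tau> K (A n)"
    and A: "\<And>n k. k \<in> K \<Longrightarrow> star_subalgebra (A n k)"
    and X: "\<And>n k. k \<in> K \<Longrightarrow> X n k \<in> A n k" "\<And>n k. k \<in> K \<Longrightarrow> X n k \<in> M"
    and lim: "\<And>k. k \<in> K \<Longrightarrow> strong_limit (\<lambda>n. X n k) (P k)"
    and P: "\<And>k. k \<in> K \<Longrightarrow> P k \<in> projections UNIV"
  shows "freely_independent \<tau> K P"
  unfolding freely_independent_def free_subalgebras_def
proof (intro allI impI, elim conjE)
  fix w assume w: "w \<noteq> []" "distinct_adj (map fst w)"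
    and mem: "\<forall>(k, a)\<in>set w. k \<in> K \<and> a \<in> star_subalgebra hull {P k} \<and> \<tau> a = 0"
  have PM: "P k \<in> M" if "k \<in> K" for k
    by (rule von_neumann_algebra_strong_limit [OF vn lim]) (use that X in auto)
  have "\<exists>d. snd z = d *\<^sub>C (P (fst z) - \<tau> (P (fst z)) *\<^sub>C 1)" if "z \<in> set w" for z
  proof -
    obtain k a where z: "z = (k, a)"
      by (cases z)
    then have k: "k \<in> K" and a: "a \<in> star_subalgebra hull {P k}" "\<tau> a = 0"
      using mem that by auto
    then obtain c d where cd: "a = c *\<^sub>C 1 + d *\<^sub>C P k"
      using star_subalgebra_hull_projection [OF P] by blast
    then have "c = - (d * \<tau> (P k))"
      using a(2) k PM by (simp add: trace_add trace_scaleC M_mem trace_one eq_neg_iff_add_eq_0)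
    then have "a = d *\<^sub>C (P k - \<tau> (P k) *\<^sub>C 1)"
      unfolding minus_bop_def uminus_bop_def by (simp add: cd scaleC_bop_distrib add.commute)
    then show ?thesis
      by (auto simp: z)
  qed
  then obtain d where d: "\<And>z. z \<in> set w \<Longrightarrow> snd z = d z *\<^sub>C (P (fst z) - \<tau> (P (fst z)) *\<^sub>C 1)"
    by metis
  \<comment> \<open>The letters are centred by the trace of \<open>X n k\<close> and not by that of
    the limit \<open>P k\<close>, so each approximating word is centred exactly and freeness applies
    at every \<open>n\<close>.\<close>
  define b where "b n z = d z *\<^sub>C (X n (fst z) - \<tau> (X n (fst z)) *\<^sub>C 1)" for n z
  have wK: "fst z \<in> K" if "z \<in> set w" for z
    using mem that by auto
  have "(\<lambda>n. \<tau> (prod_list (map (b n) w))) \<longlonglongrightarrow> \<tau> (prod_list (map snd w))"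
  proof (rule trace_strong_limit)
    show "strong_limit (\<lambda>n. prod_list (map (b n) w)) (prod_list (map snd w))"
    proof (rule strong_limit_prod_list)
      fix z assume z: "z \<in> set w"
      have "(\<lambda>n. \<tau> (X n (fst z))) \<longlonglongrightarrow> \<tau> (P (fst z))"
        using wK [OF z] by (intro trace_strong_limit lim X)
      then show "strong_limit (\<lambda>n. b n z) (snd z)"
        unfolding d [OF z] b_def using wK [OF z]
        by (intro strong_limit_scaleC strong_limit_diff strong_limit_const lim tendsto_const)
    qed
    have "b n z \<in> M" if "z \<in> set w" for n z
      unfolding b_def using X wK [OF that] by (intro M_mem)
    then show "prod_list (map (b n) w) \<in> M" for n
      by (induction w) (auto intro: M_mem)
  qed
  moreover have "\<tau> (prod_list (map (b n) w)) = 0" for n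
  proof -
    define v where "v = map (\<lambda>z. (fst z, b n z)) w"
    have "b n z \<in> A n (fst z) \<and> \<tau> (b n z) = 0" if "z \<in> set w" for z
    proof
      show "b n z \<in> A n (fst z)"
        unfolding b_def using X wK [OF that] by (intro star_subalgebraD [OF A])
      show "\<tau> (b n z) = 0"
        unfolding b_def using X wK [OF that]
        by (simp add: trace_scaleC trace_diff trace_one M_mem)
    qed
    then have "\<forall>(k, a)\<in>set v. k \<in> K \<and> a \<in> A n k \<and> \<tau> a = 0"
      using wK by (auto simp: v_def)
    moreover have "map fst v = map fst w" "map snd v = map (b n) w" "v \<noteq> []"
      using w(1) by (auto simp: v_def)
    ultimately show ?thesis
      using free [of n, unfolded free_subalgebras_def, rule_format, of v] w(2) by simp
  qed
  ultimately show "\<tau> (prod_list (map snd w)) = 0"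
    by (simp add: LIMSEQ_const_iff)
qed

text \<open>A word has only finitely many letters.\<close>

lemma freely_independent_finite_subsets:
  assumes "\<And>F. finite F \<Longrightarrow> F \<subseteq> K \<Longrightarrow> freely_independent \<tau> F X"
  shows "freely_independent \<tau> K X"
  unfolding freely_independent_def free_subalgebras_def
proof (intro allI impI, elim conjE)
  fix w assume w: "w \<noteq> []" "distinct_adj (map fst w)"
    and mem: "\<forall>(k, a)\<in>set w. k \<in> K \<and> a \<in> star_subalgebra hull {X k} \<and> \<tau> a = 0"
  have "freely_independent \<tau> (fst ` set w) X"
    using mem by (intro assms) auto
  moreover have "\<forall>(k, a)\<in>set w. k \<in> fst ` set w \<and> a \<in> star_subalgebra hull {X k} \<and> \<tau> a = 0"
    using mem by force
  ultimately show "\<tau> (prod_list (map snd w)) = 0"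
    using w unfolding freely_independent_def free_subalgebras_def by blast
qed

text \<open>Injectivity of \<open>e\<close> keeps adjacent indices of a word distinct.\<close>

lemma free_subalgebras_reindex:
  assumes free: "free_subalgebras \<tau> J A" and e: "inj_on e K" "e ` K \<subseteq> J"
    and B: "\<And>k. k \<in> K \<Longrightarrow> B k = A (e k)"
  shows "free_subalgebras \<tau> K B"
  unfolding free_subalgebras_def
proof (intro allI impI, elim conjE)
  fix w assume w: "w \<noteq> []" "distinct_adj (map fst w)"
    and mem: "\<forall>(k, a)\<in>set w. k \<in> K \<and> a \<in> B k \<and> \<tau> a = 0"
  define v where "v = map (\<lambda>(k, a). (e k, a)) w"
  have "\<forall>(k, a)\<in>set v. k \<in> J \<and> a \<in> A k \<and> \<tau> a = 0"
    using mem e B by (fastforce simp: v_def)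
  moreover have "map fst v = map e (map fst w)" "map snd v = map snd w" "v \<noteq> []"
    using w(1) by (auto simp: v_def)
  moreover have "inj_on e (set (map fst w))"
    using mem by (intro inj_on_subset [OF e(1)]) auto
  then have "distinct_adj (map e (map fst w))"
    by (rule distinct_adj_mapI [OF w(2)])
  ultimately show "\<tau> (prod_list (map snd w)) = 0"
    using free [unfolded free_subalgebras_def, rule_format, of v] by simp
qed

context free_poisson_ranges
begin

lemma process_free:
  fixes \<alpha> :: "'i \<Rightarrow> 'x set"
  assumes K: "finite K" "disjoint_family_on \<alpha> K" "\<alpha> ` K \<subseteq> finite_sets \<mu>"
  shows "freely_independent \<tau> K (\<lambda>k. \<pi> (\<alpha> k))"
proof -
  obtain e :: "'i \<Rightarrow> nat" where e: "inj_on e K"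
    using finite_imp_inj_to_nat_seg [OF K(1)] by metis
  \<comment> \<open>The axiom speaks of sequences, so the finite family sits at the positions
    \<open>e k\<close> and the empty set fills the others.\<close>
  define A where "A n = (if n \<in> e ` K then \<alpha> (inv_into K e n) else {})" for n
  have Ae: "A (e k) = \<alpha> k" if "k \<in> K" for k
    using that e by (simp add: A_def)
  have fin: "range A \<subseteq> finite_sets \<mu>"
    using K e by (auto simp: A_def finite_sets_eq_fmeasurable)
  have "disjoint_family A"
    unfolding disjoint_family_on_def
  proof (intro ballI impI)
    fix m n :: nat assume "m \<noteq> n"
    show "A m \<inter> A n = {}"
    proof (cases "m \<in> e ` K \<and> n \<in> e ` K")
      case True
      then obtain j k where "j \<in> K" "k \<in> K" "m = e j" "n = e k" "j \<noteq> k"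
        using \<open>m \<noteq> n\<close> by blast
      then show ?thesis
        using disjoint_family_onD [OF K(2)] by (simp add: Ae)
    qed (auto simp: A_def)
  qed
  moreover have "(\<Union>n. A n) \<in> finite_sets \<mu>"
  proof -
    have "(\<Union>n. A n) = (\<Union>k\<in>K. \<alpha> k)"
      using Ae e by (auto simp: A_def)
    then show ?thesis
      using K fmeasurable.finite_UN [of K \<alpha> \<mu>] by (simp add: finite_sets_eq_fmeasurable image_subset_iff)
  qed
  ultimately have "freely_independent \<tau> UNIV (\<lambda>n. \<pi> (A n))"
    using fin by (intro process_disjoint)
  then show ?thesis
    unfolding freely_independent_def by (rule free_subalgebras_reindex [OF _ e]) (simp_all add: Ae)
qed

lemma Y_finite_free:
  assumes K: "finite K" "disjoint_family_on \<alpha> K" "\<alpha> ` K \<subseteq> finite_sets \<mu>"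
  shows "freely_independent \<tau> K (\<lambda>k. Y (\<alpha> k))"
proof -
  have fin: "\<alpha> k \<in> finite_sets \<mu>" if "k \<in> K" for k
    using K that by blast
  have "\<exists>c. strong_limit (\<lambda>n. op_poly (\<pi> (\<alpha> k)) (range_poly c n)) (Y (\<alpha> k))" if "k \<in> K" for k
    using range_projection_limit [OF process_adj [OF fin [OF that]]] Y_finite [OF fin [OF that]] by auto
  then obtain c where c:
    "\<And>k. k \<in> K \<Longrightarrow> strong_limit (\<lambda>n. op_poly (\<pi> (\<alpha> k)) (range_poly (c k) n)) (Y (\<alpha> k))"
    by metis
  show ?thesis
  proof (rule freely_independent_limit [OF _ _ _ _ c])
    show "free_subalgebras \<tau> K (\<lambda>k. star_subalgebra hull {\<pi> (\<alpha> k)})"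
      using process_free [OF K] by (simp add: freely_independent_def)
    show "op_poly (\<pi> (\<alpha> k)) (range_poly (c k) n) \<in> star_subalgebra hull {\<pi> (\<alpha> k)}" for k n
      by (intro op_poly_mem star_subalgebra_hull hull_inc) simp
    show "op_poly (\<pi> (\<alpha> k)) (range_poly (c k) n) \<in> M" if "k \<in> K" for k n
      by (intro op_poly_mem star_subalgebra_M process_mem fin that)
    show "Y (\<alpha> k) \<in> projections UNIV" if "k \<in> K" for k
      using fin [OF that] by (intro Y_projection) (simp add: finite_sets_def)
  qed (rule star_subalgebra_hull)
qed

text \<open>Three reductions: to finite index sets, to truly disjoint sets by removing null
  overlaps, and to finite measure by truncation.\<close>

lemma Y_free:
  assumes \<omega>: "\<omega> ` K \<subseteq> sets \<mu>"
    and null: "\<And>j k. \<lbrakk>j \<in> K; k \<in> K; j \<noteq> k\<rbrakk> \<Longrightarrow> \<omega> j \<inter> \<omega> k \<in> null_sets \<mu>"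
  shows "freely_independent \<tau> K (\<lambda>k. Y (\<omega> k))"
proof (rule freely_independent_finite_subsets)
  fix F assume F: "finite F" "F \<subseteq> K"
  \<comment> \<open>Finiteness of \<open>F\<close> makes the removed overlaps null.\<close>
  define \<alpha> where "\<alpha> k = \<omega> k - (\<Union>j\<in>F - {k}. \<omega> j)" for k
  have \<omega>s: "\<omega> k \<in> sets \<mu>" if "k \<in> F" for k
    using that F \<omega> by blast
  have \<alpha>s: "\<alpha> k \<in> sets \<mu>" if "k \<in> F" for k
    unfolding \<alpha>_def using that F \<omega>s by (intro sets.Diff sets.finite_UN) auto
  have Y_eq: "Y (\<alpha> k) = Y (\<omega> k)" if k: "k \<in> F" for k
  proof (rule congruentD [OF Y_respects_null])
    have "(\<Union>j\<in>F - {k}. \<omega> k \<inter> \<omega> j) \<in> null_sets \<mu>"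
      using F k by (intro null_sets.finite_UN) (auto intro!: null)
    moreover have "sym_diff (\<alpha> k) (\<omega> k) = (\<Union>j\<in>F - {k}. \<omega> k \<inter> \<omega> j)"
      by (auto simp: \<alpha>_def)
    ultimately show "(\<alpha> k, \<omega> k) \<in> null_equiv \<mu>"
      using \<alpha>s \<omega>s k by (simp add: null_equiv_def)
  qed
  obtain X :: "nat \<Rightarrow> 'x set" where X: "range X \<subseteq> sets \<mu>"
    "\<And>\<omega> n. \<omega> \<in> sets \<mu> \<Longrightarrow> \<omega> \<inter> X n \<in> finite_sets \<mu>"
    "\<And>\<omega>. \<omega> \<in> sets \<mu> \<Longrightarrow> (\<lambda>n. emeasure \<mu> (\<omega> \<inter> X n)) \<longlonglongrightarrow> emeasure \<mu> \<omega>"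
    "\<And>\<omega>. \<omega> \<in> sets \<mu> \<Longrightarrow> strong_limit (\<lambda>n. Y (\<omega> \<inter> X n)) (Y \<omega>)"
    by (rule Y_exhaustion) (rule that)
  \<comment> \<open>Here the algebras in the limit lemma vary with \<open>n\<close>: each is
    generated by a truncated projection.\<close>
  have "freely_independent \<tau> F (\<lambda>k. Y (\<alpha> k))"
  proof (rule freely_independent_limit)
    show "free_subalgebras \<tau> F (\<lambda>k. star_subalgebra hull {Y (\<alpha> k \<inter> X n)})" for n
    proof -
      have "freely_independent \<tau> F (\<lambda>k. Y (\<alpha> k \<inter> X n))"
      proof (rule Y_finite_free)
        show "disjoint_family_on (\<lambda>k. \<alpha> k \<inter> X n) F"
          by (auto simp: disjoint_family_on_def \<alpha>_def)
      qed (use F X \<alpha>s in auto)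
      then show ?thesis
        by (simp add: freely_independent_def)
    qed
    show "strong_limit (\<lambda>n. Y (\<alpha> k \<inter> X n)) (Y (\<alpha> k))" if "k \<in> F" for k
      by (intro X \<alpha>s that)
  qed (auto intro: star_subalgebra_hull hull_inc Y_finite_mem X \<alpha>s Y_projection)
  \<comment> \<open>The two families are known to agree only on \<open>F\<close>, so they are
    exchanged by reindexing along the identity.\<close>
  moreover have "freely_independent \<tau> F (\<lambda>k. Y (\<alpha> k)) = freely_independent \<tau> F (\<lambda>k. Y (\<omega> k))"
    by (auto simp: freely_independent_def Y_eq
        intro: free_subalgebras_reindex [of _ F _ "\<lambda>k. k"])
  ultimately show "freely_independent \<tau> F (\<lambda>k. Y (\<omega> k))"
    by simp
qed

end

section \<open>The generated von Neumann algebras\<close>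

lemma bop_sum_apply: "bop_apply (\<Sum>k\<in>F. S k) x = (\<Sum>k\<in>F. bop_apply (S k) x)"
  by (induction F rule: infinite_finite_induct) simp_all

lemma adj_sum: "adj (\<Sum>k\<in>F. S k) = (\<Sum>k\<in>F. adj (S k))"
  by (induction F rule: infinite_finite_induct) simp_all

text \<open>Polarisation turns the bound on the quadratic form into one on the bilinear form; the
  parallelogram law evaluates the sum.\<close>

lemma self_adjoint_form_bound:
  assumes D: "adj D = D" and \<kappa>: "\<And>x. \<bar>inner (bop_apply D x) x\<bar> \<le> \<kappa> * (norm x)\<^sup>2"
  shows "\<bar>inner (D x) y\<bar> \<le> \<kappa> / 2 * ((norm x)\<^sup>2 + (norm y)\<^sup>2)"
proof -
  have "4 * inner (D x) y = inner (D (x + y)) (x + y) - inner (D (x - y)) (x - y)"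
    using inner_self_adjoint [OF D, of y x] inner_commute [of y "D x"]
    by (simp add: inner_add_left inner_add_right inner_diff_left inner_diff_right)
  then have "4 * \<bar>inner (D x) y\<bar> \<le> \<bar>inner (D (x + y)) (x + y)\<bar> + \<bar>inner (D (x - y)) (x - y)\<bar>"
    by linarith
  also have "\<dots> \<le> \<kappa> * (norm (x + y))\<^sup>2 + \<kappa> * (norm (x - y))\<^sup>2"
    by (intro add_mono \<kappa>)
  also have "\<dots> = 2 * \<kappa> * ((norm x)\<^sup>2 + (norm y)\<^sup>2)"
    by (simp add: power2_norm_eq_inner inner_add_left inner_add_right inner_diff_left
        inner_diff_right algebra_simps)
  finally show ?thesis
    by simp
qed

context free_poisson_ranges
begin

text \<open>
  On a set of measure \<open>a < 1\<close>, the spectrum of \<open>\<pi> \<alpha>\<close> away from \<open>0\<close> lies in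
  \<open>{(1 - sqrt a)\<^sup>2..(1 + sqrt a)\<^sup>2}\<close>, so \<open>\<pi> \<alpha>\<close> is uniformly close to \<open>Y \<alpha>\<close> for small \<open>a\<close>.
\<close>

lemma process_near_Y:
  assumes \<alpha>: "\<alpha> \<in> finite_sets \<mu>" and \<epsilon>: "0 < \<epsilon>" "\<epsilon> \<le> 1 / 2" "measure \<mu> \<alpha> < (\<epsilon> / 3)\<^sup>2"
  shows "\<bar>inner ((\<pi> \<alpha> - Y \<alpha>) x) x\<bar> \<le> 2 * \<epsilon> * inner (\<pi> \<alpha> x) x"
proof -
  define s where "s = sqrt (measure \<mu> \<alpha>)"
  \<comment> \<open>With \<open>s \<le> \<epsilon> / 3\<close> and \<open>s^2 \<le> s\<close>, the
    deviation \<open>2 * s + s^2\<close> is at most \<epsilon>; hence the 3.\<close>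
  have s: "0 \<le> s" "s \<le> \<epsilon> / 3"
    unfolding s_def using \<epsilon> by (simp, intro real_le_lsqrt) auto
  have "s * s \<le> s * 1"
    using s \<epsilon> by (intro mult_left_mono) auto
  then have *: "1 - \<epsilon> \<le> (1 - s)\<^sup>2" "(1 + s)\<^sup>2 \<le> 1 + \<epsilon>"
    using s zero_le_square [of s] unfolding power2_eq_square distrib_left distrib_right
      left_diff_distrib right_diff_distrib by linarith+
  have AE: "AE t in free_poisson (measure \<mu> \<alpha>). t = 0 \<or> 1 - \<epsilon> \<le> t \<and> t \<le> 1 + \<epsilon>"
    using AE_free_poisson [of "measure \<mu> \<alpha>"] by eventually_elim (use * in \<open>auto simp: s_def\<close>)
  have "(1 - \<epsilon>) * inner (Y \<alpha> x) x \<le> inner (\<pi> \<alpha> x) x"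
    and "inner (\<pi> \<alpha> x) x \<le> (1 + \<epsilon>) * inner (Y \<alpha> x) x"
    unfolding Y_finite [OF \<alpha>]
    by (intro range_projection_bounds [OF process_mem process_adj process_distribution AE] \<alpha>)+
  moreover have "0 \<le> inner (Y \<alpha> x) x"
  proof -
    have "\<alpha> \<in> sets \<mu>"
      using \<alpha> by (simp add: finite_sets_def)
    then have "inner (Y \<alpha> x) x = inner (Y \<alpha> x) (Y \<alpha> x)"
      using projectionsD [OF Y_projection] inner_self_adjoint by metis
    then show ?thesis
      by simp
  qed
  \<comment> \<open>As \<open>1 - \<epsilon>\<close> is at least \<open>1 / 2\<close>, the form of
    \<open>Y \<alpha>\<close> is at most twice that of \<open>\<pi> \<alpha>\<close>. This moves the
    error from \<open>Y\<close> to \<pi>, which is additive.\<close>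
  ultimately have "\<bar>inner (\<pi> \<alpha> x) x - inner (Y \<alpha> x) x\<bar> \<le> \<epsilon> * inner (Y \<alpha> x) x"
    and "inner (Y \<alpha> x) x \<le> 2 * inner (\<pi> \<alpha> x) x"
    using mult_right_mono [OF \<epsilon>(2), of "inner (Y \<alpha> x) x"] by (auto simp: algebra_simps abs_le_iff)
  then show ?thesis
    using mult_left_mono [of "inner (Y \<alpha> x) x" "2 * inner (\<pi> \<alpha> x) x" \<epsilon>] \<epsilon>(1)
    unfolding bop_apply_simps inner_diff_left by linarith
qed

text \<open>Partial sums of \<open>Y (A k)\<close> commute with \<open>u\<close>, and they differ
  from those of \<open>\<pi> (A k)\<close> by a form of order \<epsilon>, uniformly in the number of
  terms. So each matrix coefficient of the commutator of \<open>\<pi> \<alpha>\<close> and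
  \<open>u\<close> is bounded by a multiple of \<epsilon>.\<close>

lemma process_commute:
  assumes atoms: "\<nexists>A. measure_atom \<mu> A" and \<alpha>: "\<alpha> \<in> finite_sets \<mu>"
    and u: "\<And>\<beta>. \<beta> \<in> finite_sets \<mu> \<Longrightarrow> Y \<beta> * u = u * Y \<beta>"
  shows "\<pi> \<alpha> * u = u * \<pi> \<alpha>"
proof -
  obtain c where c: "c > 0" "\<And>x. norm (\<pi> \<alpha> x) \<le> c * norm x"
    using bop_bound by blast
  have "inner (u (\<pi> \<alpha> x) - \<pi> \<alpha> (u x)) y = 0" for x y
  proof -
    \<comment> \<open>\<open>Q\<close> collects the two pairs at which the error form is evaluated,
      \<open>(x, adj u y)\<close> and \<open>(u x, y)\<close>. It does not involve the partition,
      which changes with \<epsilon>.\<close>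
    define Q where "Q = (norm x)\<^sup>2 + (norm (adj u y))\<^sup>2 + ((norm (u x))\<^sup>2 + (norm y)\<^sup>2)"
    have bound: "\<bar>inner (u (\<pi> \<alpha> x) - \<pi> \<alpha> (u x)) y\<bar> \<le> \<epsilon> * (c * Q)" if \<epsilon>: "0 < \<epsilon>" "\<epsilon> \<le> 1 / 2" for \<epsilon>
    proof -
      obtain A :: "nat \<Rightarrow> 'x set" where A: "disjoint_family A" "range A \<subseteq> finite_sets \<mu>"
        "(\<Union>n. A n) = \<alpha>" "\<And>n. measure \<mu> (A n) < (\<epsilon> / 3)\<^sup>2"
        using no_atoms_partition [OF sigma_finite atoms, of \<alpha> "(\<epsilon> / 3)\<^sup>2"] \<alpha> \<epsilon>
        unfolding finite_sets_eq_fmeasurable by auto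
      have fin: "A n \<in> finite_sets \<mu>" for n
        using A by blast
      have sums: "(\<lambda>n. \<pi> (A n) x) sums \<pi> \<alpha> x" for x
        using process_disjoint(1) [OF A(1,2)] \<alpha> unfolding A(3) by blast
      define D where "D m = (\<Sum>k<m. \<pi> (A k) - Y (A k))" for m
      have adjD: "adj (D m) = D m" for m
        using fin projectionsD(2) [OF Y_projection] unfolding D_def
        by (simp add: adj_sum process_adj finite_sets_def)
      have "\<bar>inner (D m x) x\<bar> \<le> (2 * \<epsilon> * c) * (norm x)\<^sup>2" for m x
      proof -
        have "\<bar>inner (D m x) x\<bar> \<le> (\<Sum>k<m. \<bar>inner ((\<pi> (A k) - Y (A k)) x) x\<bar>)"
          unfolding D_def bop_sum_apply inner_sum_left by (rule sum_abs)
        also have "\<dots> \<le> (\<Sum>k<m. 2 * \<epsilon> * inner (\<pi> (A k) x) x)"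
          by (intro sum_mono process_near_Y fin \<epsilon> A)
        also have "\<dots> = 2 * \<epsilon> * (\<Sum>k<m. inner (\<pi> (A k) x) x)"
          by (simp add: sum_distrib_left)
        \<comment> \<open>Positivity bounds every partial sum by the full sum, so the estimate does
          not depend on \<open>m\<close>.\<close>
        also have "\<dots> \<le> 2 * \<epsilon> * inner (\<pi> \<alpha> x) x"
        proof (rule mult_left_mono)
          have "(\<lambda>n. inner (\<pi> (A n) x) x) sums inner (\<pi> \<alpha> x) x"
            by (rule bounded_linear.sums [OF bounded_linear_inner_left sums])
          note s = this
          show "(\<Sum>k<m. inner (\<pi> (A k) x) x) \<le> inner (\<pi> \<alpha> x) x"
            using sum_le_suminf [OF sums_summable [OF s], of "{..<m}"] sums_unique [OF s]
              process_positive [OF fin]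
            by (simp add: positive_bop_def)
        qed (use \<epsilon> in simp)
        also have "inner (\<pi> \<alpha> x) x \<le> c * norm x * norm x"
          by (rule order_trans [OF norm_cauchy_schwarz]) (intro mult_right_mono c norm_ge_zero)
        finally show ?thesis
          using \<epsilon> by (simp add: power2_eq_square mult_ac)
      qed
      then have form: "\<bar>inner (D m x) y\<bar> \<le> \<epsilon> * c * ((norm x)\<^sup>2 + (norm y)\<^sup>2)" for m x y
        using self_adjoint_form_bound [OF adjD, of m "2 * \<epsilon> * c" x y] by simp
      define T where "T m x = (\<Sum>k<m. \<pi> (A k) x)" for m x
      have T: "(\<lambda>m. T m x) \<longlonglongrightarrow> \<pi> \<alpha> x" for x
        using sums unfolding T_def sums_def .
      have "\<bar>inner (u (T m x) - T m (u x)) y\<bar> \<le> \<epsilon> * (c * Q)" for m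
      proof -
        have "T m x = D m x + (\<Sum>k<m. Y (A k)) x" for x
          by (simp add: T_def D_def bop_sum_apply flip: sum.distrib)
        moreover have "u ((\<Sum>k<m. Y (A k)) x) = (\<Sum>k<m. Y (A k)) (u x)"
        proof -
          have "u * (\<Sum>k<m. Y (A k)) = (\<Sum>k<m. Y (A k)) * u"
            by (simp add: sum_distrib_left sum_distrib_right u fin)
          from arg_cong [OF this, of "\<lambda>S. S x"] show ?thesis
            by simp
        qed
        ultimately have "u (T m x) - T m (u x) = u (D m x) - D m (u x)"
          by simp
        then have "inner (u (T m x) - T m (u x)) y = inner (D m x) (adj u y) - inner (D m (u x)) y"
          by (simp add: inner_diff_left inner_adj [of u])
        then have "\<bar>inner (u (T m x) - T m (u x)) y\<bar> \<le> \<epsilon> * c * ((norm x)\<^sup>2 + (norm (adj u y))\<^sup>2) +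
            \<epsilon> * c * ((norm (u x))\<^sup>2 + (norm y)\<^sup>2)"
          using form [of m x "adj u y"] form [of m "u x" y] by linarith
        then show ?thesis
          by (simp add: Q_def algebra_simps)
      qed
      moreover have "(\<lambda>m. \<bar>inner (u (T m x) - T m (u x)) y\<bar>) \<longlonglongrightarrow> \<bar>inner (u (\<pi> \<alpha> x) - \<pi> \<alpha> (u x)) y\<bar>"
        by (intro tendsto_intros T)
      ultimately show ?thesis
        by (intro LIMSEQ_le_const2) auto
    qed
    have "((\<lambda>\<epsilon>. \<epsilon> * (c * Q)) \<longlongrightarrow> 0 * (c * Q)) (at_right 0)"
      by (intro tendsto_intros)
    moreover have "\<forall>\<^sub>F \<epsilon> in at_right 0. \<bar>inner (u (\<pi> \<alpha> x) - \<pi> \<alpha> (u x)) y\<bar> \<le> \<epsilon> * (c * Q)"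
      unfolding eventually_at_right_field by (intro exI [of _ "1 / 2"]) (auto intro: bound)
    ultimately have "\<bar>inner (u (\<pi> \<alpha> x) - \<pi> \<alpha> (u x)) y\<bar> \<le> 0"
      by (intro tendsto_lowerbound) auto
    then show ?thesis
      by simp
  qed
  then have "u (\<pi> \<alpha> x) - \<pi> \<alpha> (u x) = 0" for x
    using inner_eq_zero_iff by blast
  then show ?thesis
    by (intro bop_eqI) simp
qed

text \<open>One inclusion is the double commutant property applied to
  \<open>process_commute\<close>; the other rests on range projections being strong limits of
  polynomials.\<close>

lemma vn_generated_eq:
  assumes "\<nexists>A. measure_atom \<mu> A"
  shows "vn_generated (\<pi> ` finite_sets \<mu>) = vn_generated (Y ` finite_sets \<mu>)"
proof
  define N where "N = vn_generated (Y ` finite_sets \<mu>)"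
  have N: "von_neumann_algebra N"
    unfolding N_def by (rule von_neumann_algebra_hull)
  have Y: "Y \<beta> \<in> N" if "\<beta> \<in> finite_sets \<mu>" for \<beta>
    unfolding N_def using that by (intro hull_inc) simp
  have "\<pi> \<alpha> \<in> commutant (commutant N)" if "\<alpha> \<in> finite_sets \<mu>" for \<alpha>
    using process_commute [OF assms that] Y by (auto simp: commutant_def)
  then have "\<pi> ` finite_sets \<mu> \<subseteq> N"
    using N by (auto simp: von_neumann_algebra_def)
  then show "vn_generated (\<pi> ` finite_sets \<mu>) \<subseteq> vn_generated (Y ` finite_sets \<mu>)"
    using N unfolding N_def by (rule hull_minimal)
  have "Y \<alpha> \<in> vn_generated (\<pi> ` finite_sets \<mu>)" if "\<alpha> \<in> finite_sets \<mu>" for \<alpha>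
    unfolding Y_finite [OF that] using that
    by (intro range_projection_mem von_neumann_algebra_hull process_adj hull_inc imageI)
  then show "vn_generated (Y ` finite_sets \<mu>) \<subseteq> vn_generated (\<pi> ` finite_sets \<mu>)"
    by (intro hull_minimal von_neumann_algebra_hull) auto
qed

end

theorem theorem5p2:
  fixes \<mu> :: "'x measure"
    and M :: "'a::complex_hilbert_space bop set"
    and \<tau> :: "'a bop \<Rightarrow> complex"
    and \<pi> Y :: "'x set \<Rightarrow> 'a bop"
  assumes "sigma_finite_measure \<mu>"
    and "tracial_wstar_probability_space M \<tau>"
    and "free_poisson_process \<mu> M \<tau> \<pi>"
    and "\<And>\<alpha>. \<alpha> \<in> finite_sets \<mu> \<Longrightarrow> Y \<alpha> = range_projection (\<pi> \<alpha>)"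
    and "\<And>\<omega>. \<lbrakk>\<omega> \<in> sets \<mu>; emeasure \<mu> \<omega> = \<infinity>\<rbrakk> \<Longrightarrow>
           Y \<omega> = Sup_projections (Y ` {\<alpha> \<in> finite_sets \<mu>. \<alpha> \<subseteq> \<omega>})"
  shows "free_upper_extremal_process TYPE('k) \<mu> M \<tau> Y \<and>
    ((\<nexists>A. measure_atom \<mu> A) \<longrightarrow>
       vn_generated (\<pi> ` finite_sets \<mu>) = vn_generated (Y ` finite_sets \<mu>))"
proof -
  interpret free_poisson_ranges M \<tau> \<mu> \<pi> Y
    using assms by (simp add: free_poisson_ranges_def free_poisson_ranges_axioms_def)
  show ?thesis
    unfolding free_upper_extremal_process_def
    using Y_respects_null Y_mem_projections Y_lub trace_Y vn_generated_eq
    by (auto intro: Y_free)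
qed

end
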